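(* Let $c>0$ and $\Delta=(0,c]$. Let $\mu$ be an infinitely divisible distribution on $\mathbb R$ with Lévy measure $\nu$, and let $\nu_{(1)}(dx)=\mathbf 1_{(1,\infty)}(x)\,\nu(dx)/\nu((1,\infty))$. Suppose $\nu_{(1)}\in\mathcal L_\Delta$. Then the following are equivalent: (i) $\mu\in\mathcal S_\Delta\cap\mathcal D_\Delta$; (ii) $\nu_{(1)}\in\mathcal S_\Delta\cap\mathcal D_\Delta$; (iii) $\nu_{(1)}\in\mathcal L_\Delta\cap\mathcal D_\Delta$ and $\mu(x+\Delta)\sim\nu(x+\Delta)$.
   Context: An infinitely divisible distribution $\mu$ on $\mathbb R$ has characteristic function $\widehat\mu(z)=\exp\{\int_{-\infty}^\infty(e^{izy}-1-izy\mathbf 1_{\{|y|\le1\}})\nu(dy)+iaz-\frac12b^2z^2\}$ with $a\in\mathbb R$, $b\ge0$ and Lévy measure $\nu$ satisfying $\nu(\{0\})=0$, $\int(1\wedge x^2)\nu(dx)<\infty$. The hypothesis $\nu_{(1)}\in\mathcal L_\Delta$ includes $\nu((1,\infty))>0$, so that $\nu_{(1)}$ is defined. For $\Delta=(0,c]$ and a measure $F$, $F(x+\Delta):=F((x,x+c])$. $F^{*n}$ is the $n$-fold convolution. $\alpha(x)\sim\beta(x)$ means $\alpha(x)/\beta(x)\to1$ as $x\to\infty$. A non-negative measurable function $\alpha$ belongs to $\mathcal L$ if there is $x_0>0$ with $\alpha(x)>0$ for $x\ge x_0$ and, for every fixed $y>0$, $\alpha(x+y)\sim\alpha(x)$. A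 distribution $F$ is in $\mathcal L_\Delta$ if the function $x\mapsto F(x+\Delta)$ is in $\mathcal L$. $F\in\mathcal S_\Delta$ if $F\in\mathcal L_\Delta$ and $F^{*2}(x+\Delta)\sim 2F(x+\Delta)$. A function $\alpha:\mathbb R\to\mathbb R_+$ is almost decreasing if there exist $x_0>0$ and $K>0$ such that $\alpha(x+y)\le K\alpha(x)$ for all $x>x_0$, $y>0$. $F\in\mathcal D_\Delta$ if $x\mapsto F(x+\Delta)$ is almost decreasing. *)

theory Defs
  imports "HOL-Probability.Probability" "HOL-Library.Landau_Symbols"
begin

definition long_tailed :: "(real \<Rightarrow> real) set" where
  "long_tailed = {\<alpha>. \<alpha> \<in> borel_measurable borel \<and> (\<forall>x. 0 \<le> \<alpha> x) \<and>
     (\<exists>x0>0. \<forall>x\<ge>x0. 0 < \<alpha> x) \<and>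
     (\<forall>y>0. (\<lambda>x. \<alpha> (x + y)) \<sim>[at_top] \<alpha>)}"

definition almost_decreasing :: "(real \<Rightarrow> real) \<Rightarrow> bool" where
  "almost_decreasing \<alpha> \<longleftrightarrow> (\<forall>x. 0 \<le> \<alpha> x) \<and>
     (\<exists>x0>0. \<exists>K>0. \<forall>x>x0. \<forall>y>0. \<alpha> (x + y) \<le> K * \<alpha> x)"

text \<open>\<open>delta_mass c F x\<close> is \<open>F(x + \<Delta>)\<close> for \<open>\<Delta> = (0, c]\<close>. If \<open>F\<close> is a Levy measure it may be
  infinite on intervals near the origin, where \<^const>\<open>measure\<close> returns 0; for \<open>x > 0\<close> the value is
  the true, finite mass, so asymptotics at infinity are unaffected.\<close>

definition delta_mass :: "real \<Rightarrow> real measure \<Rightarrow> real \<Rightarrow> real" where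
  "delta_mass c F x = measure F {x<..x + c}"

definition L_Delta :: "real \<Rightarrow> real measure set" where
  "L_Delta c = {F. real_distribution F \<and> delta_mass c F \<in> long_tailed}"

definition S_Delta :: "real \<Rightarrow> real measure set" where
  "S_Delta c = {F \<in> L_Delta c. delta_mass c (F \<star> F) \<sim>[at_top] (\<lambda>x. 2 * delta_mass c F x)}"

definition D_Delta :: "real \<Rightarrow> real measure set" where
  "D_Delta c = {F. real_distribution F \<and> almost_decreasing (delta_mass c F)}"

primrec conv_power :: "real measure \<Rightarrow> nat \<Rightarrow> real measure" where
  "conv_power F 0 = return borel 0"
| "conv_power F (Suc n) = (F \<star> conv_power F n)"

definition infinitely_divisible :: "real measure \<Rightarrow> bool" where
  "infinitely_divisible \<mu> \<longleftrightarrow> real_distribution \<mu> \<and>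
     (\<forall>n\<ge>1. \<exists>\<rho>. real_distribution \<rho> \<and> conv_power \<rho> n = \<mu>)"

definition levy_measure :: "real measure \<Rightarrow> bool" where
  "levy_measure \<nu> \<longleftrightarrow> sets \<nu> = sets borel \<and> emeasure \<nu> {0} = 0 \<and>
     (\<integral>\<^sup>+x. ennreal (min 1 (x\<^sup>2)) \<partial>\<nu>) < \<infinity>"

definition has_levy_triplet :: "real measure \<Rightarrow> real \<Rightarrow> real \<Rightarrow> real measure \<Rightarrow> bool" where
  "has_levy_triplet \<mu> a b \<nu> \<longleftrightarrow> 0 \<le> b \<and> levy_measure \<nu> \<and>
     (\<forall>z. char \<mu> z = exp ((CLINT y|\<nu>. iexp (z * y) - 1
              - \<i> * complex_of_real (z * y * indicator {-1..1} y))
            + \<i> * complex_of_real (a * z) - complex_of_real (b\<^sup>2 * z\<^sup>2 / 2)))"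

text \<open>The normalised restriction of \<open>\<nu>\<close> to \<open>(1, \<infinity>)\<close>; a probability measure whenever \<open>\<nu>\<close> is a Levy
  measure charging \<open>(1, \<infinity>)\<close>.\<close>

definition levy_tail :: "real measure \<Rightarrow> real measure" where
  "levy_tail \<nu> = uniform_measure \<nu> {1<..}"

end

theory Submission
  imports Defs "HOL-Real_Asymp.Real_Asymp"
begin

text \<open>
  Write \<open>F\<close> for the normalised Levy measure on \<open>(1, \<infinity>)\<close>, \<open>\<lambda> = \<nu>(1, \<infinity>)\<close>, and abbreviate
  \<open>f(x) = F(x + \<Delta>)\<close>, \<open>m(x) = \<mu>(x + \<Delta>)\<close>. Splitting the Levy--Khintchine exponent at the jump size \<open>1\<close>
  gives \<open>\<mu> = CP(\<lambda>, F) \<star> R\<close>, a compound Poisson law with jump distribution \<open>F\<close> convolved with a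
  distribution \<open>R\<close> whose jumps are bounded above by \<open>1\<close> and which therefore satisfies
  \<open>E exp(R) < \<infinity>\<close> (\<open>levy_decomposition\<close>). The equivalence is a statement about such convolutions
  (\<open>compound_poisson_local_subexponentiality\<close>).

  The quantity that decides everything is the joint tail: the mass that a product \<open>H\<^sub>1 \<times> H\<^sub>2\<close> gives to
  \<open>{y > A, z > A, y + z \<in> x + \<Delta>}\<close>. For \<open>x \<ge> 2 A\<close> the local mass of \<open>H\<^sub>1 \<star> H\<^sub>2\<close> is the sum of the part with
  \<open>y \<le> A\<close>, the part with \<open>z \<le> A\<close>, and the joint tail (\<open>delta_mass_convolution_decompose\<close>). Dominated
  convergence, with the almost decreasing hypothesis as the source of the dominating constant even for
  negative arguments, evaluates the first two parts. Hence, relative to a reference function, local masses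
  add under convolution as soon as the joint tail is negligible (\<open>convolution_asymp_add\<close>). Fatou's lemma
  gives the converse: if the local mass of \<open>H\<^sub>1 \<star> H\<^sub>2\<close> is no larger than the sum of the local masses,
  then the joint tail is negligible (\<open>joint_negligible_if_convolution_upper\<close>). In particular,
  subexponentiality of a distribution \<open>G\<close> says that its own joint tail is negligible, and this property
  is inherited by all pairs of distributions whose local masses are of the order of that of \<open>G\<close>
  (\<open>joint_negligible_transfer\<close>).

  Take now a reference distribution \<open>G\<close> that is locally subexponential and almost decreasing, and for
  which \<open>f\<close> is of the order of \<open>g(x) = G(x + \<Delta>)\<close>. Induction on \<open>n\<close> gives \<open>F\<^sup>*\<^sup>n(x + \<Delta>) = n f(x) + o(g(x))\<close>
  together with a bound \<open>B\<^sup>n g(x)\<close>. The Poisson weights decay faster than any geometric sequence, so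
  they absorb even a large base \<open>B\<close>, and summation gives \<open>\<mu>(x + \<Delta>) = \<lambda> f(x) + o(g(x))\<close>
  (\<open>compound_poisson_convolution_asymp\<close>). With \<open>G = F\<close> this turns (ii) into (iii) and (i). With \<open>G = \<mu>\<close>,
  where the order condition comes from the single-jump term, it turns (i) into \<open>m \<sim> \<lambda> f\<close> and then into
  (ii).

  For (iii) implies (ii), each term \<open>F\<^sup>*\<^sup>n \<star> R\<close> of the Poisson mixture has lower rate at least \<open>n\<close> relative to
  \<open>f\<close>, and the Poisson mean of \<open>n\<close> is \<open>\<lambda>\<close>, so \<open>m \<sim> \<lambda> f\<close> leaves no room in any single term. The term
  \<open>n = 2\<close> shows that the joint tail of \<open>F\<close> and \<open>F \<star> R\<close> is negligible, and so is that of \<open>F\<close> with itself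
  (\<open>joint_negligible_if_compound_poisson_asymp\<close>).
\<close>

section \<open>Local masses of convolutions\<close>

text \<open>The set \<open>B\<close> stands for \<open>x + \<Delta>\<close> or for a finite union of translates of it: comparing two
  distributions through their masses on intervals of length \<open>c\<close> blurs the position of the sum.\<close>

definition joint_tail :: "real measure \<Rightarrow> real measure \<Rightarrow> real \<Rightarrow> real set \<Rightarrow> real" where
  "joint_tail H1 H2 A B = measure (H1 \<Otimes>\<^sub>M H2) {p. A < fst p \<and> A < snd p \<and> fst p + snd p \<in> B}"

lemma real_distribution_convolution:
  assumes "real_distribution H1" "real_distribution H2"
  shows "real_distribution (H1 \<star> H2)"
proof -
  interpret H1: real_distribution H1 by fact
  interpret H2: real_distribution H2 by fact
  interpret P: pair_prob_space H1 H2 ..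
  have "prob_space (H1 \<star> H2)"
    unfolding convolution_def by (rule P.prob_space_distr) simp
  then show ?thesis
    by (auto simp: real_distribution_def real_distribution_axioms_def)
qed

lemma delta_mass_nonneg [simp]: "0 \<le> delta_mass c H x"
  by (simp add: delta_mass_def)

lemma (in real_distribution) delta_mass_le_1: "delta_mass c M x \<le> 1"
  by (simp add: delta_mass_def)

lemma (in real_distribution) borel_measurable_delta_mass [measurable]:
  assumes "0 < c"
  shows "delta_mass c M \<in> borel_measurable borel"
proof -
  have "delta_mass c M = (\<lambda>x. cdf M (x + c) - cdf M x)"
    using assms by (auto simp: delta_mass_def cdf_diff_eq)
  moreover have "cdf M \<in> borel_measurable borel"
    by (rule borel_measurable_mono) (auto simp: mono_def cdf_nondecreasing)
  ultimately show ?thesis by simp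
qed

lemma measure_pair_left:
  fixes H1 H2 :: "real measure"
  assumes "real_distribution H1" "real_distribution H2" and B[measurable]: "B \<in> sets (borel \<Otimes>\<^sub>M borel)"
  shows "measure (H1 \<Otimes>\<^sub>M H2) B = (\<integral>y. measure H2 {z. (y, z) \<in> B} \<partial>H1)"
    and "integrable H1 (\<lambda>y. measure H2 {z. (y, z) \<in> B})"
proof -
  interpret H1: real_distribution H1 by fact
  interpret H2: real_distribution H2 by fact
  interpret P: pair_prob_space H1 H2 ..
  have [measurable_cong]: "sets H1 = sets borel" "sets H2 = sets borel" by auto
  have B': "B \<in> sets (H1 \<Otimes>\<^sub>M H2)" by measurable
  have eq: "{z. (y, z) \<in> B} = Pair y -` B" for y by auto
  have m: "(\<lambda>y. measure H2 (Pair y -` B)) \<in> borel_measurable H1"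
    unfolding measure_def
    by (rule measurable_compose[OF H2.measurable_emeasure_Pair[OF B']]) simp
  have "emeasure (H1 \<Otimes>\<^sub>M H2) B = (\<integral>\<^sup>+y. emeasure H2 (Pair y -` B) \<partial>H1)"
    by (rule H2.emeasure_pair_measure_alt[OF B'])
  also have "\<dots> = (\<integral>\<^sup>+y. ennreal (measure H2 (Pair y -` B)) \<partial>H1)"
    by (simp add: H2.emeasure_eq_measure)
  also have "\<dots> = ennreal (\<integral>y. measure H2 (Pair y -` B) \<partial>H1)"
    by (rule nn_integral_eq_integral, rule H1.integrable_const_bound[where B=1])
       (auto simp: m)
  finally show "measure (H1 \<Otimes>\<^sub>M H2) B = (\<integral>y. measure H2 {z. (y, z) \<in> B} \<partial>H1)"
    unfolding eq by (simp add: P.emeasure_eq_measure)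
  show "integrable H1 (\<lambda>y. measure H2 {z. (y, z) \<in> B})"
    unfolding eq by (rule H1.integrable_const_bound[where B=1]) (auto simp: m)
qed

lemma measure_pair_swap:
  fixes H1 H2 :: "real measure"
  assumes "real_distribution H1" "real_distribution H2" and B[measurable]: "B \<in> sets (borel \<Otimes>\<^sub>M borel)"
  shows "measure (H1 \<Otimes>\<^sub>M H2) B = measure (H2 \<Otimes>\<^sub>M H1) {(z, y). (y, z) \<in> B}"
proof -
  interpret H1: real_distribution H1 by fact
  interpret H2: real_distribution H2 by fact
  interpret P: pair_prob_space H1 H2 ..
  have [measurable_cong]: "sets H1 = sets borel" "sets H2 = sets borel" by auto
  have B': "B \<in> sets (H1 \<Otimes>\<^sub>M H2)" by measurable
  show ?thesis
    by (subst P.distr_pair_swap, subst measure_distr)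
       (use B' in \<open>auto intro!: arg_cong[where f="measure _"] simp: space_pair_measure\<close>)
qed

lemma sets_Collect_pair:
  assumes "{p \<in> space (borel \<Otimes>\<^sub>M borel). P p} \<in> sets (borel \<Otimes>\<^sub>M (borel :: real measure))"
  shows "{p :: real \<times> real. P p} \<in> sets (borel \<Otimes>\<^sub>M borel)"
  using assms by (simp add: space_pair_measure del: borel_prod)

text \<open>If \<open>2 A \<le> x\<close> and \<open>y + z > x\<close>, then \<open>y \<le> A\<close> and \<open>z \<le> A\<close> exclude each other, so the two truncated
  integrals and the joint tail count disjoint events.\<close>

lemma delta_mass_convolution_decompose:
  assumes H1: "real_distribution H1" and H2: "real_distribution H2" and "0 < c" "2 * A \<le> x"
  shows "delta_mass c (H1 \<star> H2) x =
     (\<integral>y. indicator {..A} y * delta_mass c H2 (x - y) \<partial>H1) +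
     (\<integral>z. indicator {..A} z * delta_mass c H1 (x - z) \<partial>H2) + joint_tail H1 H2 A {x<..x + c}"
proof -
  interpret H1: real_distribution H1 by fact
  interpret H2: real_distribution H2 by fact
  interpret P: pair_prob_space H1 H2 ..
  have [measurable_cong]: "sets H1 = sets borel" "sets H2 = sets borel" by auto
  define S where "S = {x<..x + c}"
  have [measurable]: "S \<in> sets borel" by (simp add: S_def)
  have slice: "measure H {z. y \<le> A \<and> y + z \<in> S} = indicator {..A} y * delta_mass c H (x - y)"
    for y and H :: "real measure"
  proof -
    have "{z. y \<le> A \<and> y + z \<in> S} = (if y \<le> A then {x - y<..x - y + c} else {})"
      by (auto simp: S_def)
    then show ?thesis by (auto simp: delta_mass_def)
  qed
  let ?U = "{p. fst p + snd p \<in> S}" and ?L = "{p. fst p \<le> A \<and> fst p + snd p \<in> S}"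
    and ?R = "{p. snd p \<le> A \<and> fst p + snd p \<in> S}"
    and ?J = "{p. A < fst p \<and> A < snd p \<and> fst p + snd p \<in> S}"
  have sets: "?U \<in> sets (borel \<Otimes>\<^sub>M borel)" "?L \<in> sets (borel \<Otimes>\<^sub>M borel)"
      "?R \<in> sets (borel \<Otimes>\<^sub>M borel)" "?J \<in> sets (borel \<Otimes>\<^sub>M borel)"
    by (rule sets_Collect_pair, measurable)+
  have setsH: "sets (H1 \<Otimes>\<^sub>M H2) = sets (borel \<Otimes>\<^sub>M borel)"
    by (intro sets_pair_measure_cong) auto
  have "delta_mass c (H1 \<star> H2) x = measure (H1 \<Otimes>\<^sub>M H2) ?U"
    unfolding delta_mass_def convolution_def
    by (subst measure_distr) (auto intro!: arg_cong[where f="measure _"] simp: space_pair_measure S_def)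
  also have "?U = ?L \<union> (?R \<union> ?J)"
    by auto
  also have "measure (H1 \<Otimes>\<^sub>M H2) \<dots> = measure (H1 \<Otimes>\<^sub>M H2) ?L + measure (H1 \<Otimes>\<^sub>M H2) (?R \<union> ?J)"
    using sets \<open>2 * A \<le> x\<close> by (intro P.finite_measure_Union) (auto simp: setsH S_def simp del: borel_prod)
  also have "measure (H1 \<Otimes>\<^sub>M H2) (?R \<union> ?J) = measure (H1 \<Otimes>\<^sub>M H2) ?R + measure (H1 \<Otimes>\<^sub>M H2) ?J"
    using sets by (intro P.finite_measure_Union) (auto simp: setsH simp del: borel_prod)
  also have "measure (H1 \<Otimes>\<^sub>M H2) ?J = joint_tail H1 H2 A S"
    by (simp add: joint_tail_def)
  also have "measure (H1 \<Otimes>\<^sub>M H2) ?L = (\<integral>y. indicator {..A} y * delta_mass c H2 (x - y) \<partial>H1)"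
    by (subst measure_pair_left[OF H1 H2 sets(2)]) (simp add: slice)
  also have "measure (H1 \<Otimes>\<^sub>M H2) ?R = measure (H2 \<Otimes>\<^sub>M H1) ?L"
    by (subst measure_pair_swap[OF H1 H2 sets(3)]) (auto intro!: arg_cong[where f="measure _"] simp: add.commute)
  also have "\<dots> = (\<integral>z. indicator {..A} z * delta_mass c H1 (x - z) \<partial>H2)"
    by (subst measure_pair_left[OF H2 H1 sets(2)]) (simp add: slice)
  finally show ?thesis by (simp add: S_def)
qed

section \<open>Long-tailed and almost decreasing reference functions\<close>

lemma long_tailed_eventually_pos:
  assumes "m \<in> long_tailed"
  shows "eventually (\<lambda>x. 0 < m x) at_top"
  using assms unfolding long_tailed_def by (auto simp: eventually_at_top_linorder)

lemma filterlim_shift_at_top: "filterlim (\<lambda>x::real. x + t) at_top at_top"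
  by (subst add.commute) (rule filterlim_tendsto_add_at_top[OF tendsto_const filterlim_ident])

lemma long_tailed_shift_tendsto:
  assumes m: "m \<in> long_tailed"
  shows "((\<lambda>x. m (x + t) / m x) \<longlongrightarrow> 1) at_top"
proof -
  note pos = long_tailed_eventually_pos[OF m]
  have right: "((\<lambda>x. m (x + s) / m x) \<longlongrightarrow> 1) at_top" if "0 < s" for s
  proof -
    have "(\<lambda>x. m (x + s)) \<sim>[at_top] m"
      using m that by (auto simp: long_tailed_def)
    from asymp_equivD[OF this] show ?thesis
      by (rule Lim_transform_eventually) (use pos in eventually_elim, auto)
  qed
  consider "t = 0" | "0 < t" | "t < 0" by linarith
  then show ?thesis
  proof cases
    case 1
    show ?thesis
      by (rule tendsto_eventually) (use pos in eventually_elim, simp add: 1)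
  next
    case 2
    then show ?thesis by (rule right)
  next
    case 3
    have "((\<lambda>x. inverse (m ((x + t) + (- t)) / m (x + t))) \<longlongrightarrow> inverse 1) at_top"
      by (intro tendsto_inverse filterlim_compose[OF right[of "- t"]]) (use 3 filterlim_shift_at_top in auto)
    then show ?thesis by simp
  qed
qed

lemma eventually_at_top_shift:
  fixes t :: real
  assumes "eventually P at_top"
  shows "eventually (\<lambda>x. P (x + t)) at_top"
  by (rule eventually_compose_filterlim[OF assms filterlim_shift_at_top])

text \<open>This is what the almost decreasing property is for. Given \<open>A\<close>, all values \<open>m(x - y)\<close> with \<open>y \<le> A\<close>
  are dominated by \<open>m(x - A)\<close>, which is comparable with \<open>m(x)\<close>; the constant does not depend on \<open>A\<close>,
  and arbitrarily negative \<open>y\<close> are included, so that distributions with a left tail cause no trouble.\<close>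

lemma almost_decreasing_uniform_bound:
  assumes m: "m \<in> long_tailed" and D: "almost_decreasing m"
  obtains K where "0 < K" "\<And>A. eventually (\<lambda>x. \<forall>y\<le>A. m (x - y) \<le> K * m x) at_top"
proof -
  obtain x0 K where K1: "0 < K" "\<forall>x>x0. \<forall>y>0. m (x + y) \<le> K * m x"
    using D unfolding almost_decreasing_def by blast
  then have K: "0 < K" "\<And>x y. x0 < x \<Longrightarrow> 0 < y \<Longrightarrow> m (x + y) \<le> K * m x" by blast+
  have nn: "0 \<le> m x" for x using m by (auto simp: long_tailed_def)
  have "eventually (\<lambda>x. \<forall>y\<le>A. m (x - y) \<le> (2 * (K + 1)) * m x) at_top" for A
  proof -
    have "eventually (\<lambda>x. m (x + - A) / m x < 2) at_top"
      using long_tailed_shift_tendsto[OF m] by (rule order_tendstoD) simp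
    moreover have "eventually (\<lambda>x. x0 + A < x) at_top" by (rule eventually_gt_at_top)
    ultimately show ?thesis
      using long_tailed_eventually_pos[OF m]
    proof eventually_elim
      case (elim x)
      then have *: "m (x - A) \<le> 2 * m x" by (simp add: field_simps)
      show ?case
      proof (intro allI impI)
        fix y assume "y \<le> A"
        have "m (x - y) \<le> (K + 1) * m (x - A)"
        proof (cases "y = A")
          case True
          then show ?thesis using K(1) nn[of "x - A"] by (simp add: distrib_right)
        next
          case False
          have "m ((x - A) + (A - y)) \<le> K * m (x - A)"
            using False \<open>y \<le> A\<close> elim by (intro K) auto
          then show ?thesis using nn[of "x - A"] by (simp add: distrib_right)
        qed
        also have "\<dots> \<le> (K + 1) * (2 * m x)"
          using * K(1) by (intro mult_left_mono) auto
        finally show "m (x - y) \<le> 2 * (K + 1) * m x" by (simp add: mult_ac)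
      qed
    qed
  qed
  then show thesis using that[of "2 * (K + 1)"] K(1) by auto
qed

section \<open>Lower bounds from Fatou's lemma\<close>

text \<open>This says \<open>liminf h / m \<ge> l\<close>, in a form that avoids division.\<close>

definition lower_rate :: "real \<Rightarrow> (real \<Rightarrow> real) \<Rightarrow> (real \<Rightarrow> real) \<Rightarrow> bool" where
  "lower_rate l h m \<longleftrightarrow> (\<forall>\<epsilon>>0. eventually (\<lambda>x. (l - \<epsilon>) * m x \<le> h x) at_top)"

lemma lower_rate_nonneg:
  assumes "m \<in> long_tailed" "\<And>x. 0 \<le> h x"
  shows "lower_rate 0 h m"
  unfolding lower_rate_def
proof (intro allI impI always_eventually)
  fix \<epsilon> x :: real assume "0 < \<epsilon>"
  moreover have "0 \<le> m x" using assms(1) by (auto simp: long_tailed_def)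
  ultimately have "0 \<le> \<epsilon> * m x" by simp
  then show "(0 - \<epsilon>) * m x \<le> h x" using assms(2)[of x] by simp
qed

lemma lower_rate_self:
  assumes "m \<in> long_tailed"
  shows "lower_rate 1 m m"
  unfolding lower_rate_def
proof (intro allI impI always_eventually)
  fix \<epsilon> x :: real assume "0 < \<epsilon>"
  moreover have "0 \<le> m x" using assms(1) by (auto simp: long_tailed_def)
  ultimately have "0 \<le> \<epsilon> * m x" by simp
  then show "(1 - \<epsilon>) * m x \<le> m x" by (simp add: algebra_simps)
qed

lemma lower_rate_shift:
  assumes m: "m \<in> long_tailed" and h: "lower_rate l h m"
  shows "lower_rate l (\<lambda>x. h (x + t)) m"
  unfolding lower_rate_def
proof (intro allI impI)
  fix \<epsilon> :: real assume "0 < \<epsilon>"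
  have "((\<lambda>x. (l - \<epsilon> / 2) * (m (x + t) / m x)) \<longlongrightarrow> (l - \<epsilon> / 2) * 1) at_top"
    by (intro tendsto_intros long_tailed_shift_tendsto m)
  then have "eventually (\<lambda>x. l - \<epsilon> < (l - \<epsilon> / 2) * (m (x + t) / m x)) at_top"
    by (rule order_tendstoD) (use \<open>0 < \<epsilon>\<close> in simp)
  moreover have "eventually (\<lambda>x. (l - \<epsilon> / 2) * m (x + t) \<le> h (x + t)) at_top"
    using h \<open>0 < \<epsilon>\<close> by (intro eventually_at_top_shift) (auto simp: lower_rate_def)
  ultimately show "eventually (\<lambda>x. (l - \<epsilon>) * m x \<le> h (x + t)) at_top"
    using long_tailed_eventually_pos[OF m]
  proof eventually_elim
    case (elim x)
    then have "(l - \<epsilon>) * m x < (l - \<epsilon> / 2) * m (x + t)" by (simp add: field_simps)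
    with elim show ?case by linarith
  qed
qed

text \<open>Capping the quotient at \<open>l\<close> turns a lower limit into a limit, so that dominated convergence can
  take the place of Fatou's lemma along the filter at infinity.\<close>

lemma lower_rate_imp_min_tendsto:
  assumes m: "m \<in> long_tailed" and h: "lower_rate l h m"
  shows "((\<lambda>x. min (h x / m x) l) \<longlongrightarrow> l) at_top"
proof (rule order_tendstoI)
  fix a assume "a < l"
  then have "eventually (\<lambda>x. (l - (l - a) / 2) * m x \<le> h x) at_top"
    using h by (auto simp: lower_rate_def)
  then show "eventually (\<lambda>x. a < min (h x / m x) l) at_top"
    using long_tailed_eventually_pos[OF m]
  proof eventually_elim
    case (elim x)
    then have "l - (l - a) / 2 \<le> h x / m x" by (simp add: pos_le_divide_eq)
    moreover have "a < l - (l - a) / 2" using \<open>a < l\<close> by (simp add: field_simps)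
    ultimately have "a < h x / m x" by linarith
    then show ?case using \<open>a < l\<close> by simp
  qed
next
  fix a assume "l < a"
  then show "eventually (\<lambda>x. min (h x / m x) l < a) at_top"
    by (auto simp: min_less_iff_disj)
qed

lemma (in real_distribution) fatou_truncated_shift:
  assumes m: "m \<in> long_tailed" and h: "lower_rate l h m" "\<And>x. 0 \<le> h x" "0 \<le> l"
    and [measurable]: "h \<in> borel_measurable borel"
  shows "((\<lambda>x. \<integral>y. indicator {..A} y * min (h (x - y) / m x) l \<partial>M) \<longlongrightarrow> l * cdf M A) at_top"
proof -
  have [measurable]: "m \<in> borel_measurable borel" and nn: "0 \<le> m x" for x
    using m by (auto simp: long_tailed_def)
  have "((\<lambda>x. \<integral>y. indicator {..A} y * min (h (x - y) / m x) l \<partial>M)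
      \<longlongrightarrow> (\<integral>y. indicator {..A} y * l \<partial>M)) at_top"
  proof (rule integral_dominated_convergence_at_top[where w="\<lambda>_. l"])
    show "AE y in M. ((\<lambda>x. indicator {..A} y * min (h (x - y) / m x) l) \<longlongrightarrow> indicator {..A} y * l) at_top"
    proof (rule AE_I2)
      fix y
      have "lower_rate l (\<lambda>x. h (x + - y)) m"
        by (rule lower_rate_shift[OF m h(1)])
      from lower_rate_imp_min_tendsto[OF m this]
      show "((\<lambda>x. indicator {..A} y * min (h (x - y) / m x) l) \<longlongrightarrow> indicator {..A} y * l) at_top"
        by (intro tendsto_intros) simp
    qed
    show "eventually (\<lambda>x. AE y in M. norm (indicator {..A} y * min (h (x - y) / m x) l) \<le> l) at_top"
      using h nn by (auto simp: indicator_def intro!: always_eventually AE_I2)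
  qed auto
  also have "(\<integral>y. indicator {..A} y * l \<partial>M) = l * cdf M A"
    by (simp add: cdf_def)
  finally show ?thesis .
qed

text \<open>Applying the Fatou argument to both truncated integrals, while keeping the joint tail, gives
  two facts at once: lower rates add under convolution, and any upper bound on the convolution that matches the
  sum of the lower rates leaves nothing for the joint tail.\<close>

lemma convolution_lower_bound:
  assumes c: "0 < c" and m: "m \<in> long_tailed"
    and H1: "real_distribution H1" and H2: "real_distribution H2"
    and l1: "lower_rate l1 (delta_mass c H1) m" "0 \<le> l1"
    and l2: "lower_rate l2 (delta_mass c H2) m" "0 \<le> l2" and "0 < \<epsilon>"
  shows "eventually (\<lambda>x. (l2 * cdf H1 A + l1 * cdf H2 A - \<epsilon>) * m x + joint_tail H1 H2 A {x<..x + c}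
           \<le> delta_mass c (H1 \<star> H2) x) at_top"
proof -
  interpret H1: real_distribution H1 by fact
  interpret H2: real_distribution H2 by fact
  note [measurable] = H1.borel_measurable_delta_mass[OF c] H2.borel_measurable_delta_mass[OF c]
  have bound: "(\<integral>y. indicator {..A} y * min (delta_mass c H' (x - y) / m x) l \<partial>H) * m x
       \<le> (\<integral>y. indicator {..A} y * delta_mass c H' (x - y) \<partial>H)"
    if x: "0 < m x" and "0 \<le> l" and H: "real_distribution H" and H': "real_distribution H'" for x l H H'
  proof -
    interpret H: real_distribution H by fact
    interpret H': real_distribution H' by fact
    note [measurable] = H.borel_measurable_delta_mass[OF c] H'.borel_measurable_delta_mass[OF c]
    have "(\<integral>y. indicator {..A} y * min (delta_mass c H' (x - y) / m x) l \<partial>H) * m x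
        = (\<integral>y. indicator {..A} y * min (delta_mass c H' (x - y) / m x) l * m x \<partial>H)"
      by simp
    also have "\<dots> \<le> (\<integral>y. indicator {..A} y * delta_mass c H' (x - y) \<partial>H)"
    proof (rule integral_mono)
      show "integrable H (\<lambda>y. indicator {..A} y * min (delta_mass c H' (x - y) / m x) l * m x)"
        by (rule H.integrable_const_bound[where B="l * m x"])
           (use that in \<open>auto simp: indicator_def abs_mult intro!: AE_I2 mult_right_mono\<close>)
      show "integrable H (\<lambda>y. indicator {..A} y * delta_mass c H' (x - y))"
        by (rule H.integrable_const_bound[where B=1])
           (auto simp: indicator_def H'.delta_mass_le_1)
      show "indicator {..A} y * min (delta_mass c H' (x - y) / m x) l * m x
          \<le> indicator {..A} y * delta_mass c H' (x - y)" for y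
      proof -
        have "min (delta_mass c H' (x - y) / m x) l * m x \<le> delta_mass c H' (x - y) / m x * m x"
          using x by (intro mult_right_mono) auto
        then show ?thesis using x by (auto simp: indicator_def)
      qed
    qed
    finally show ?thesis .
  qed
  have "((\<lambda>x. (\<integral>y. indicator {..A} y * min (delta_mass c H2 (x - y) / m x) l2 \<partial>H1) +
       (\<integral>y. indicator {..A} y * min (delta_mass c H1 (x - y) / m x) l1 \<partial>H2))
     \<longlongrightarrow> l2 * cdf H1 A + l1 * cdf H2 A) at_top"
    by (intro tendsto_add H1.fatou_truncated_shift H2.fatou_truncated_shift m l1 l2) auto
  then have "eventually (\<lambda>x. l2 * cdf H1 A + l1 * cdf H2 A - \<epsilon> <
      (\<integral>y. indicator {..A} y * min (delta_mass c H2 (x - y) / m x) l2 \<partial>H1) +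
       (\<integral>y. indicator {..A} y * min (delta_mass c H1 (x - y) / m x) l1 \<partial>H2)) at_top"
    by (rule order_tendstoD) (use \<open>0 < \<epsilon>\<close> in simp)
  moreover have "eventually (\<lambda>x. 2 * A \<le> x) at_top" by (rule eventually_ge_at_top)
  ultimately show ?thesis
    using long_tailed_eventually_pos[OF m]
  proof eventually_elim
    case (elim x)
    have "(l2 * cdf H1 A + l1 * cdf H2 A - \<epsilon>) * m x \<le>
      ((\<integral>y. indicator {..A} y * min (delta_mass c H2 (x - y) / m x) l2 \<partial>H1) +
       (\<integral>y. indicator {..A} y * min (delta_mass c H1 (x - y) / m x) l1 \<partial>H2)) * m x"
      using elim by (intro mult_right_mono) auto
    also have "\<dots> \<le> (\<integral>y. indicator {..A} y * delta_mass c H2 (x - y) \<partial>H1) +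
        (\<integral>y. indicator {..A} y * delta_mass c H1 (x - y) \<partial>H2)"
      unfolding distrib_right by (intro add_mono bound elim l1 l2 H1 H2)
    finally show ?case
      using delta_mass_convolution_decompose[OF H1 H2 c, of A x] elim by simp
  qed
qed

lemma (in real_distribution) cdf_eventually_close:
  assumes "0 < (\<epsilon>::real)" "0 \<le> l"
  shows "eventually (\<lambda>A. l - \<epsilon> < l * cdf M A) at_top"
proof -
  have "((\<lambda>A. l * cdf M A) \<longlongrightarrow> l * 1) at_top"
    by (intro tendsto_intros cdf_lim_at_top_prob)
  then show ?thesis
    by (rule order_tendstoD) (use assms in simp)
qed

lemma lower_rate_convolution:
  assumes c: "0 < c" and m: "m \<in> long_tailed"
    and H1: "real_distribution H1" and H2: "real_distribution H2"
    and l1: "lower_rate l1 (delta_mass c H1) m" "0 \<le> l1"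
    and l2: "lower_rate l2 (delta_mass c H2) m" "0 \<le> l2"
  shows "lower_rate (l1 + l2) (delta_mass c (H1 \<star> H2)) m"
  unfolding lower_rate_def
proof (intro allI impI)
  fix \<epsilon> :: real assume \<epsilon>: "0 < \<epsilon>"
  interpret H1: real_distribution H1 by fact
  interpret H2: real_distribution H2 by fact
  have "eventually (\<lambda>A. l2 - \<epsilon> / 3 < l2 * cdf H1 A \<and> l1 - \<epsilon> / 3 < l1 * cdf H2 A) at_top"
    using \<epsilon> l1 l2 by (intro eventually_conj H1.cdf_eventually_close H2.cdf_eventually_close) auto
  then obtain A where A: "l2 - \<epsilon> / 3 < l2 * cdf H1 A" "l1 - \<epsilon> / 3 < l1 * cdf H2 A"
    by (auto simp: eventually_at_top_linorder)
  have "0 < \<epsilon> / 3" using \<epsilon> by simp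
  from convolution_lower_bound[OF c m H1 H2 l1 l2 this, of A] long_tailed_eventually_pos[OF m]
  show "eventually (\<lambda>x. (l1 + l2 - \<epsilon>) * m x \<le> delta_mass c (H1 \<star> H2) x) at_top"
  proof eventually_elim
    case (elim x)
    have "(l1 + l2 - \<epsilon>) * m x \<le> (l2 * cdf H1 A + l1 * cdf H2 A - \<epsilon> / 3) * m x"
      using A elim by (intro mult_right_mono) auto
    moreover have "0 \<le> joint_tail H1 H2 A {x<..x + c}" by (simp add: joint_tail_def)
    ultimately show ?case using elim by linarith
  qed
qed

text \<open>The order of the quantifiers matters: first \<open>x\<close> tends to infinity for fixed \<open>A\<close>, then \<open>A\<close> does.
  Relative to \<open>m\<close> the two factors of \<open>H1 \<star> H2\<close> are not large simultaneously.\<close>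

definition joint_negligible :: "real \<Rightarrow> (real \<Rightarrow> real) \<Rightarrow> real measure \<Rightarrow> real measure \<Rightarrow> bool" where
  "joint_negligible c m H1 H2 \<longleftrightarrow> (\<forall>\<epsilon>>0. \<exists>A0. \<forall>A\<ge>A0.
     eventually (\<lambda>x. joint_tail H1 H2 A {x<..x + c} \<le> \<epsilon> * m x) at_top)"

lemma joint_negligible_if_convolution_upper:
  assumes c: "0 < c" and m: "m \<in> long_tailed"
    and H1: "real_distribution H1" and H2: "real_distribution H2"
    and l1: "lower_rate l1 (delta_mass c H1) m" "0 \<le> l1"
    and l2: "lower_rate l2 (delta_mass c H2) m" "0 \<le> l2"
    and upper: "\<And>\<epsilon>. 0 < \<epsilon> \<Longrightarrow> eventually (\<lambda>x. delta_mass c (H1 \<star> H2) x \<le> (l1 + l2 + \<epsilon>) * m x) at_top"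
  shows "joint_negligible c m H1 H2"
  unfolding joint_negligible_def
proof (intro allI impI)
  fix \<epsilon> :: real assume \<epsilon>: "0 < \<epsilon>"
  interpret H1: real_distribution H1 by fact
  interpret H2: real_distribution H2 by fact
  have "eventually (\<lambda>A. l2 - \<epsilon> / 4 < l2 * cdf H1 A \<and> l1 - \<epsilon> / 4 < l1 * cdf H2 A) at_top"
    using \<epsilon> l1 l2 by (intro eventually_conj H1.cdf_eventually_close H2.cdf_eventually_close) auto
  then obtain A0 where A0: "\<And>A. A0 \<le> A \<Longrightarrow> l2 - \<epsilon> / 4 < l2 * cdf H1 A \<and> l1 - \<epsilon> / 4 < l1 * cdf H2 A"
    by (auto simp: eventually_at_top_linorder)
  have \<epsilon>4: "0 < \<epsilon> / 4" using \<epsilon> by simp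
  have "eventually (\<lambda>x. joint_tail H1 H2 A {x<..x + c} \<le> \<epsilon> * m x) at_top" if "A0 \<le> A" for A
    using convolution_lower_bound[OF c m H1 H2 l1 l2 \<epsilon>4, of A] upper[OF \<epsilon>4] long_tailed_eventually_pos[OF m]
  proof eventually_elim
    case (elim x)
    have "(l1 + l2 - 3 * \<epsilon> / 4) * m x \<le> (l2 * cdf H1 A + l1 * cdf H2 A - \<epsilon> / 4) * m x"
      using A0[OF that] elim by (intro mult_right_mono) auto
    with elim have "joint_tail H1 H2 A {x<..x + c} \<le> (l1 + l2 + \<epsilon> / 4) * m x - (l1 + l2 - 3 * \<epsilon> / 4) * m x"
      by linarith
    also have "\<dots> = \<epsilon> * m x" by (simp add: algebra_simps)
    finally show ?case .
  qed
  then show "\<exists>A0. \<forall>A\<ge>A0. eventually (\<lambda>x. joint_tail H1 H2 A {x<..x + c} \<le> \<epsilon> * m x) at_top"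
    by blast
qed

section \<open>Additivity of local masses\<close>

lemma bigo_eventually_le:
  assumes "h \<in> O(m)" "m \<in> long_tailed"
  obtains B where "0 < B" "eventually (\<lambda>x. \<bar>h x\<bar> \<le> B * m x) at_top"
proof -
  obtain B where "0 < B" "eventually (\<lambda>x. norm (h x) \<le> B * norm (m x)) at_top"
    using assms(1) by (rule landau_o.bigE)
  moreover have "0 \<le> m x" for x using assms(2) by (auto simp: long_tailed_def)
  ultimately show thesis using that by simp
qed

text \<open>With \<open>h\<close> the local mass of the other factor, moving one factor by a bounded-above amount changes
  \<open>h\<close> only by \<open>o(m)\<close>. Insensitivity of \<open>h\<close> is measured in units of \<open>m\<close>, not of \<open>h\<close>, because \<open>h\<close> may be much
  smaller than \<open>m\<close>.\<close>

lemma (in real_distribution) truncated_shift_asymp: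
  assumes m: "m \<in> long_tailed" and D: "almost_decreasing m"
    and [measurable]: "h \<in> borel_measurable borel" and h: "h \<in> O(m)"
    and ins: "\<And>t. (\<lambda>x. h (x + t) - h x) \<in> o(m)" and nn: "\<And>x. 0 \<le> h x" and h1: "\<And>x. h x \<le> 1"
  shows "(\<lambda>x. (\<integral>y. indicator {..A} y * h (x - y) \<partial>M) - cdf M A * h x) \<in> o(m)"
proof -
  have [measurable]: "m \<in> borel_measurable borel" and nnm: "0 \<le> m x" for x
    using m by (auto simp: long_tailed_def)
  note pos = long_tailed_eventually_pos[OF m]
  obtain B where B: "0 < B" "eventually (\<lambda>x. \<bar>h x\<bar> \<le> B * m x) at_top"
    using bigo_eventually_le[OF h m] by blast
  then obtain x1 where x1: "\<And>x. x1 \<le> x \<Longrightarrow> h x \<le> B * m x"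
    by (auto simp: eventually_at_top_linorder nn)
  obtain K where K: "0 < K" "\<And>A. eventually (\<lambda>x. \<forall>y\<le>A. m (x - y) \<le> K * m x) at_top"
    using almost_decreasing_uniform_bound[OF m D] by blast
  have "((\<lambda>x. \<integral>y. indicator {..A} y * ((h (x - y) - h x) / m x) \<partial>M) \<longlongrightarrow> (\<integral>y. 0 \<partial>M)) at_top"
  proof (rule integral_dominated_convergence_at_top[where w="\<lambda>_. B * K + B"])
    show "AE y in M. ((\<lambda>x. indicator {..A} y * ((h (x - y) - h x) / m x)) \<longlongrightarrow> 0) at_top"
    proof (rule AE_I2)
      fix y
      have "((\<lambda>x. (h (x + - y) - h x) / m x) \<longlongrightarrow> 0) at_top"
        by (rule smalloD_tendsto[OF ins])
      from tendsto_mult[OF tendsto_const[of "indicator {..A} y"] this]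
      show "((\<lambda>x. indicator {..A} y * ((h (x - y) - h x) / m x)) \<longlongrightarrow> 0) at_top"
        by simp
    qed
    have "eventually (\<lambda>x. max x1 (x1 + A) \<le> x) at_top" by (rule eventually_ge_at_top)
    then show "eventually (\<lambda>x. AE y in M. norm (indicator {..A} y * ((h (x - y) - h x) / m x)) \<le> B * K + B) at_top"
      using pos K(2)[of A]
    proof eventually_elim
      case (elim x)
      have "norm (indicator {..A} y * ((h (x - y) - h x) / m x)) \<le> B * K + B" for y
      proof (cases "y \<le> A")
        case True
        have "\<bar>h (x - y) - h x\<bar> \<le> h (x - y) + h x" using nn[of "x - y"] nn[of x] by linarith
        also have "\<dots> \<le> B * m (x - y) + B * m x"
          using True elim by (intro add_mono x1) auto
        also have "\<dots> \<le> B * (K * m x) + B * m x"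
          using True elim B(1) by (intro add_mono mult_left_mono) auto
        finally show ?thesis using elim True by (simp add: field_simps)
      qed (use B K in simp)
      then show ?case by (intro AE_I2)
    qed
  qed auto
  then have "((\<lambda>x. \<integral>y. indicator {..A} y * ((h (x - y) - h x) / m x) \<partial>M) \<longlongrightarrow> 0) at_top" by simp
  moreover have "(\<integral>y. indicator {..A} y * ((h (x - y) - h x) / m x) \<partial>M) =
     ((\<integral>y. indicator {..A} y * h (x - y) \<partial>M) - cdf M A * h x) / m x" for x
  proof -
    have int: "integrable M (\<lambda>y. indicator {..A} y * h (x - y))" "integrable M (\<lambda>y. indicator {..A} y * h x)"
      by (auto intro!: integrable_const_bound[where B=1] simp: indicator_def nn h1)
    have "(\<integral>y. indicator {..A} y * ((h (x - y) - h x) / m x) \<partial>M) =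
       (\<integral>y. (indicator {..A} y * h (x - y) - indicator {..A} y * h x) / m x \<partial>M)"
      by (intro Bochner_Integration.integral_cong) (auto simp: indicator_def)
    also have "\<dots> = (\<integral>y. indicator {..A} y * h (x - y) - indicator {..A} y * h x \<partial>M) / m x"
      by simp
    also have "(\<integral>y. indicator {..A} y * h (x - y) - indicator {..A} y * h x \<partial>M) =
        (\<integral>y. indicator {..A} y * h (x - y) \<partial>M) - (\<integral>y. indicator {..A} y * h x \<partial>M)"
      by (intro Bochner_Integration.integral_diff int)
    also have "(\<integral>y. indicator {..A} y * h x \<partial>M) = cdf M A * h x" by (simp add: cdf_def)
    finally show ?thesis .
  qed
  ultimately have "((\<lambda>x. ((\<integral>y. indicator {..A} y * h (x - y) \<partial>M) - cdf M A * h x) / m x) \<longlongrightarrow> 0) at_top"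
    by (simp only:)
  then show ?thesis
    by (rule smalloI_tendsto) (use pos in \<open>auto elim: eventually_mono\<close>)
qed

text \<open>The principle of a single big jump: one factor stays below \<open>A\<close> and merely shifts the other, up
  to the joint tail. The errors are the two truncation errors, the two masses above \<open>A\<close> and the joint tail.\<close>

lemma convolution_asymp_add:
  assumes c: "0 < c" and m: "m \<in> long_tailed" and D: "almost_decreasing m"
    and H1: "real_distribution H1" and H2: "real_distribution H2"
    and neg: "joint_negligible c m H1 H2"
    and O1: "delta_mass c H1 \<in> O(m)" and O2: "delta_mass c H2 \<in> O(m)"
    and i1: "\<And>t. (\<lambda>x. delta_mass c H1 (x + t) - delta_mass c H1 x) \<in> o(m)"
    and i2: "\<And>t. (\<lambda>x. delta_mass c H2 (x + t) - delta_mass c H2 x) \<in> o(m)"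
  shows "(\<lambda>x. delta_mass c (H1 \<star> H2) x - (delta_mass c H1 x + delta_mass c H2 x)) \<in> o(m)"
proof (rule landau_o.smallI)
  fix \<epsilon> :: real assume \<epsilon>: "0 < \<epsilon>"
  interpret H1: real_distribution H1 by fact
  interpret H2: real_distribution H2 by fact
  obtain B1 where B1: "0 < B1" "eventually (\<lambda>x. \<bar>delta_mass c H1 x\<bar> \<le> B1 * m x) at_top"
    using bigo_eventually_le[OF O1 m] by blast
  obtain B2 where B2: "0 < B2" "eventually (\<lambda>x. \<bar>delta_mass c H2 x\<bar> \<le> B2 * m x) at_top"
    using bigo_eventually_le[OF O2 m] by blast
  \<comment> \<open>one \<open>\<delta>\<close> for each of the five error terms\<close>
  define \<delta> where "\<delta> = \<epsilon> / 5"
  have \<delta>: "0 < \<delta>" using \<epsilon> by (simp add: \<delta>_def)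
  have "eventually (\<lambda>A. B2 - \<delta> < B2 * cdf H1 A \<and> B1 - \<delta> < B1 * cdf H2 A) at_top"
    using \<delta> B1 B2 by (intro eventually_conj H1.cdf_eventually_close H2.cdf_eventually_close) auto
  moreover obtain A0 where "\<And>A. A0 \<le> A \<Longrightarrow> eventually (\<lambda>x. joint_tail H1 H2 A {x<..x + c} \<le> \<delta> * m x) at_top"
    using neg \<delta> unfolding joint_negligible_def by blast
  ultimately obtain A where A: "B2 - \<delta> < B2 * cdf H1 A" "B1 - \<delta> < B1 * cdf H2 A"
    and J: "eventually (\<lambda>x. joint_tail H1 H2 A {x<..x + c} \<le> \<delta> * m x) at_top"
    by (metis (mono_tags, lifting) eventually_at_top_linorder nle_le)
  let ?T1 = "\<lambda>x. (\<integral>y. indicator {..A} y * delta_mass c H2 (x - y) \<partial>H1) - cdf H1 A * delta_mass c H2 x"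
  let ?T2 = "\<lambda>x. (\<integral>y. indicator {..A} y * delta_mass c H1 (x - y) \<partial>H2) - cdf H2 A * delta_mass c H1 x"
  have T1: "?T1 \<in> o(m)"
    by (rule H1.truncated_shift_asymp[OF m D _ O2 i2])
       (auto simp: H2.delta_mass_le_1 H2.borel_measurable_delta_mass[OF c])
  have T2: "?T2 \<in> o(m)"
    by (rule H2.truncated_shift_asymp[OF m D _ O1 i1])
       (auto simp: H1.delta_mass_le_1 H1.borel_measurable_delta_mass[OF c])
  have nnm: "0 \<le> m x" for x using m by (auto simp: long_tailed_def)
  have "eventually (\<lambda>x. 2 * A \<le> x) at_top" by (rule eventually_ge_at_top)
  then show "eventually (\<lambda>x. norm (delta_mass c (H1 \<star> H2) x - (delta_mass c H1 x + delta_mass c H2 x))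
       \<le> \<epsilon> * norm (m x)) at_top"
    using landau_o.smallD[OF T1 \<delta>] landau_o.smallD[OF T2 \<delta>] J B1(2) B2(2)
  proof eventually_elim
    case (elim x)
    have a: "(1 - cdf H1 A) * delta_mass c H2 x \<le> \<delta> * m x"
    proof -
      have "(1 - cdf H1 A) * delta_mass c H2 x \<le> (1 - cdf H1 A) * (B2 * m x)"
        using elim by (intro mult_left_mono) (auto simp: H1.cdf_bounded_prob)
      also have "\<dots> = ((1 - cdf H1 A) * B2) * m x" by simp
      also have "\<dots> \<le> \<delta> * m x"
        using A nnm by (intro mult_right_mono) (auto simp: algebra_simps)
      finally show ?thesis .
    qed
    have b: "(1 - cdf H2 A) * delta_mass c H1 x \<le> \<delta> * m x"
    proof -
      have "(1 - cdf H2 A) * delta_mass c H1 x \<le> (1 - cdf H2 A) * (B1 * m x)"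
        using elim by (intro mult_left_mono) (auto simp: H2.cdf_bounded_prob)
      also have "\<dots> = ((1 - cdf H2 A) * B1) * m x" by simp
      also have "\<dots> \<le> \<delta> * m x"
        using A nnm by (intro mult_right_mono) (auto simp: algebra_simps)
      finally show ?thesis .
    qed
    have a': "0 \<le> (1 - cdf H1 A) * delta_mass c H2 x" "0 \<le> (1 - cdf H2 A) * delta_mass c H1 x"
      by (auto simp: H1.cdf_bounded_prob H2.cdf_bounded_prob)
    have J0: "0 \<le> joint_tail H1 H2 A {x<..x + c}" by (simp add: joint_tail_def)
    have "delta_mass c (H1 \<star> H2) x - (delta_mass c H1 x + delta_mass c H2 x) =
      ?T1 x + ?T2 x - (1 - cdf H1 A) * delta_mass c H2 x - (1 - cdf H2 A) * delta_mass c H1 x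
        + joint_tail H1 H2 A {x<..x + c}"
      using delta_mass_convolution_decompose[OF H1 H2 c, of A x] elim by (simp add: algebra_simps)
    moreover have \<epsilon>5: "\<epsilon> * m x = 5 * (\<delta> * m x)" by (simp add: \<delta>_def)
    have T: "\<bar>?T1 x\<bar> \<le> \<delta> * m x" "\<bar>?T2 x\<bar> \<le> \<delta> * m x"
      using elim nnm[of x] by auto
    have combine: "\<bar>t1 + t2 - u1 - u2 + j\<bar> \<le> 5 * d"
      if "\<bar>t1\<bar> \<le> d" "\<bar>t2\<bar> \<le> d" "0 \<le> u1" "u1 \<le> d" "0 \<le> u2" "u2 \<le> d" "0 \<le> j" "j \<le> d"
      for t1 t2 u1 u2 j d :: real
      using that by linarith
    ultimately have "\<bar>delta_mass c (H1 \<star> H2) x - (delta_mass c H1 x + delta_mass c H2 x)\<bar> \<le> \<epsilon> * m x"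
      unfolding \<epsilon>5 by (simp only: combine[OF T a'(1) a a'(2) b J0] elim)
    then show ?case using nnm[of x] by simp
  qed
qed

section \<open>Comparison of joint tails\<close>

text \<open>A bound between the masses of intervals of length \<open>c\<close> extends to other sets at the price of
  enlarging the set by \<open>c\<close>: cut \<open>(A, \<infinity>)\<close> into cells of length \<open>c\<close> and keep the cells that meet \<open>U\<close>.\<close>

lemma measure_cells_transfer:
  assumes H: "real_distribution H" and K: "real_distribution K" and c: "0 < c" and C: "0 \<le> C"
    and le: "\<And>u. A \<le> u \<Longrightarrow> delta_mass c H u \<le> C * delta_mass c K u"
    and [measurable]: "U \<in> sets borel" "V \<in> sets borel"
    and UV: "\<And>z w. z \<in> U \<Longrightarrow> \<bar>z - w\<bar> \<le> c \<Longrightarrow> w \<in> V"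
  shows "measure H (U \<inter> {A<..}) \<le> C * measure K (V \<inter> {A<..})"
proof -
  interpret H: real_distribution H by fact
  interpret K: real_distribution K by fact
  define I where "I n = {A + real n * c<..A + real n * c + c}" for n
  define J where "J n = (if I n \<inter> U = {} then {} else I n)" for n
  have [measurable]: "J n \<in> sets borel" for n by (simp add: J_def I_def)
  have disj: "disjoint_family J"
    unfolding disjoint_family_on_def
  proof (intro ballI impI)
    fix i j :: nat assume "i \<noteq> j"
    have "I i \<inter> I j = {}" if "i < j" for i j
    proof -
      have "real i * c + c \<le> real j * c"
        using that c mult_right_mono[of "real i + 1" "real j" c] by (simp add: algebra_simps)
      then show ?thesis by (auto simp: I_def)
    qed
    then have "I i \<inter> I j = {}" using \<open>i \<noteq> j\<close> by (metis Int_commute nat_neq_iff)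
    then show "J i \<inter> J j = {}" by (auto simp: J_def)
  qed
  have cover: "U \<inter> {A<..} \<subseteq> (\<Union>n. J n)"
  proof
    fix z assume z: "z \<in> U \<inter> {A<..}"
    \<comment> \<open>the cells are half-open on the left, hence the ceiling minus one\<close>
    define n where "n = nat (\<lceil>(z - A) / c\<rceil> - 1)"
    have pos: "0 < (z - A) / c" using z c by simp
    then have n: "real n = of_int \<lceil>(z - A) / c\<rceil> - 1"
      unfolding n_def by (subst of_nat_nat) auto
    have "real n < (z - A) / c" "(z - A) / c \<le> real n + 1" unfolding n by linarith+
    then have "real n * c < z - A" "z - A \<le> (real n + 1) * c"
      using c by (simp_all add: pos_less_divide_eq pos_divide_le_eq)
    then have "z \<in> I n" by (auto simp: I_def algebra_simps)
    then show "z \<in> (\<Union>n. J n)" using z by (auto simp: J_def)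
  qed
  have inV: "(\<Union>n. J n) \<subseteq> V \<inter> {A<..}"
  proof
    fix w assume "w \<in> (\<Union>n. J n)"
    then obtain n z where w: "w \<in> I n" "z \<in> I n" "z \<in> U" by (auto simp: J_def split: if_splits)
    then have "\<bar>z - w\<bar> \<le> c" by (auto simp: I_def)
    then have "w \<in> V" using UV w by blast
    moreover have "0 \<le> real n * c" "A + real n * c < w" using c w by (simp, simp add: I_def)
    then have "A < w" by linarith
    ultimately show "w \<in> V \<inter> {A<..}" by simp
  qed
  have cell: "emeasure H (J n) \<le> ennreal C * emeasure K (J n)" for n
  proof -
    have "A \<le> A + real n * c" using c by simp
    from le[OF this] have "measure H (I n) \<le> C * measure K (I n)" by (simp add: delta_mass_def I_def)
    then have "measure H (J n) \<le> C * measure K (J n)" by (auto simp: J_def)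
    then show ?thesis
      using C by (simp add: H.emeasure_eq_measure K.emeasure_eq_measure ennreal_mult[symmetric])
  qed
  have "emeasure H (U \<inter> {A<..}) \<le> emeasure H (\<Union>n. J n)"
    by (rule emeasure_mono[OF cover]) auto
  also have "\<dots> = (\<Sum>n. emeasure H (J n))"
    by (rule suminf_emeasure[symmetric, OF _ disj]) auto
  also have "\<dots> \<le> (\<Sum>n. ennreal C * emeasure K (J n))"
    by (intro suminf_le cell) auto
  also have "\<dots> = ennreal C * (\<Sum>n. emeasure K (J n))"
    by simp
  also have "(\<Sum>n. emeasure K (J n)) = emeasure K (\<Union>n. J n)"
    by (rule suminf_emeasure[OF _ disj]) auto
  also have "\<dots> \<le> emeasure K (V \<inter> {A<..})"
    by (rule emeasure_mono[OF inV]) auto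
  finally have "emeasure H (U \<inter> {A<..}) \<le> ennreal C * emeasure K (V \<inter> {A<..})"
    by (simp add: mult_left_mono)
  then show ?thesis
    using C by (simp add: H.emeasure_eq_measure K.emeasure_eq_measure ennreal_mult[symmetric])
qed

lemma sets_joint_tail_region:
  fixes B :: "real set"
  assumes [measurable]: "B \<in> sets borel"
  shows "{p. A < fst p \<and> A < snd p \<and> fst p + snd p \<in> B} \<in> sets (borel \<Otimes>\<^sub>M borel)"
  by (rule sets_Collect_pair) measurable

lemma joint_tail_commute:
  assumes H1: "real_distribution H1" and H2: "real_distribution H2" and B: "B \<in> sets borel"
  shows "joint_tail H1 H2 A B = joint_tail H2 H1 A B"
  unfolding joint_tail_def
  by (subst measure_pair_swap[OF H1 H2 sets_joint_tail_region[OF B]])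
     (auto intro!: arg_cong[where f="measure _"] simp: add.commute)

text \<open>For fixed \<open>y\<close> the second coordinate ranges over an interval intersected with \<open>(A, \<infinity>)\<close>, to which
  the comparison by cells applies.\<close>

lemma joint_tail_transfer_right:
  assumes H1: "real_distribution H1" and H2: "real_distribution H2" and K2: "real_distribution K2"
    and c: "0 < c" and C: "0 \<le> C"
    and le: "\<And>u. A \<le> u \<Longrightarrow> delta_mass c H2 u \<le> C * delta_mass c K2 u"
  shows "joint_tail H1 H2 A {s<..t} \<le> C * joint_tail H1 K2 A {s - c<..t + c}"
proof -
  interpret H1: real_distribution H1 by fact
  have S: "{s<..t} \<in> sets borel" "{s - c<..t + c} \<in> sets borel" by auto
  note L = measure_pair_left[OF H1 H2 sets_joint_tail_region[OF S(1), of A]]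
  note R = measure_pair_left[OF H1 K2 sets_joint_tail_region[OF S(2), of A]]
  show ?thesis
    unfolding joint_tail_def L(1) R(1)
  proof (subst integral_mult_right_zero[symmetric], rule integral_mono)
    show "integrable H1 (\<lambda>y. C * measure K2 {z. (y, z) \<in> {p. A < fst p \<and> A < snd p \<and> fst p + snd p \<in> {s - c<..t + c}}})"
      by (intro integrable_mult_right R(2))
    fix y
    have 1: "{z. (y, z) \<in> {p. A < fst p \<and> A < snd p \<and> fst p + snd p \<in> {s'<..t'}}}
        = (if A < y then {s' - y<..t' - y} \<inter> {A<..} else {})" for s' t'
      by auto
    have "measure H2 ({s - y<..t - y} \<inter> {A<..}) \<le> C * measure K2 ({s - c - y<..t + c - y} \<inter> {A<..})"
      by (rule measure_cells_transfer[OF H2 K2 c C le]) auto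
    then show "measure H2 {z. (y, z) \<in> {p. A < fst p \<and> A < snd p \<and> fst p + snd p \<in> {s<..t}}}
       \<le> C * measure K2 {z. (y, z) \<in> {p. A < fst p \<and> A < snd p \<and> fst p + snd p \<in> {s - c<..t + c}}}"
      unfolding 1 by simp
  qed (rule L(2))
qed

lemma joint_tail_transfer:
  assumes H1: "real_distribution H1" and H2: "real_distribution H2"
    and K1: "real_distribution K1" and K2: "real_distribution K2"
    and c: "0 < c" and C: "0 \<le> C1" "0 \<le> C2"
    and le1: "\<And>u. A \<le> u \<Longrightarrow> delta_mass c H1 u \<le> C1 * delta_mass c K1 u"
    and le2: "\<And>u. A \<le> u \<Longrightarrow> delta_mass c H2 u \<le> C2 * delta_mass c K2 u"
  shows "joint_tail H1 H2 A {x<..x + c} \<le> C1 * C2 * joint_tail K1 K2 A {x - 2 * c<..x + 3 * c}"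
proof -
  have "joint_tail H1 H2 A {x<..x + c} \<le> C2 * joint_tail H1 K2 A {x - c<..x + c + c}"
    by (rule joint_tail_transfer_right[OF H1 H2 K2 c C(2) le2])
  also have "joint_tail H1 K2 A {x - c<..x + c + c} = joint_tail K2 H1 A {x - c<..x + c + c}"
    by (rule joint_tail_commute[OF H1 K2]) simp
  also have "C2 * joint_tail K2 H1 A {x - c<..x + c + c}
      \<le> C2 * (C1 * joint_tail K2 K1 A {x - c - c<..x + c + c + c})"
    by (intro mult_left_mono[OF _ C(2)] joint_tail_transfer_right[OF K2 H1 K1 c C(1) le1])
  also have "joint_tail K2 K1 A {x - c - c<..x + c + c + c} = joint_tail K1 K2 A {x - c - c<..x + c + c + c}"
    by (rule joint_tail_commute[OF K2 K1]) simp
  also have "{x - c - c<..x + c + c + c} = {x - 2 * c<..x + 3 * c}"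
    by (simp add: algebra_simps)
  finally show ?thesis by (simp add: mult_ac)
qed

lemma joint_tail_split:
  assumes H1: "real_distribution H1" and H2: "real_distribution H2" and "s \<le> t" "t \<le> u"
  shows "joint_tail H1 H2 A {s<..u} \<le> joint_tail H1 H2 A {s<..t} + joint_tail H1 H2 A {t<..u}"
proof -
  interpret H1: real_distribution H1 by fact
  interpret H2: real_distribution H2 by fact
  interpret P: pair_prob_space H1 H2 ..
  have s: "{p. A < fst p \<and> A < snd p \<and> fst p + snd p \<in> B} \<in> sets (H1 \<Otimes>\<^sub>M H2)" if "B \<in> sets borel" for B :: "real set"
  proof -
    have "sets (H1 \<Otimes>\<^sub>M H2) = sets (borel \<Otimes>\<^sub>M borel)"
      by (intro sets_pair_measure_cong) auto
    then show ?thesis using sets_joint_tail_region[OF that] by simp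
  qed
  have eq: "{p. A < fst p \<and> A < snd p \<and> fst p + snd p \<in> {s<..u}}
      = {p. A < fst p \<and> A < snd p \<and> fst p + snd p \<in> {s<..t}} \<union> {p. A < fst p \<and> A < snd p \<and> fst p + snd p \<in> {t<..u}}"
    using assms(3,4) by auto
  show ?thesis
    unfolding joint_tail_def by (subst eq) (intro measure_Un_le s; simp)
qed

text \<open>The wider interval consists of five translates of \<open>x + \<Delta>\<close>, and each translate is handled by
  long-tailedness of \<open>m\<close>.\<close>

lemma joint_negligible_widen:
  assumes c: "0 < c" and m: "m \<in> long_tailed"
    and H1: "real_distribution H1" and H2: "real_distribution H2"
    and neg: "joint_negligible c m H1 H2" and \<epsilon>: "0 < \<epsilon>"
  shows "\<exists>A0. \<forall>A\<ge>A0. eventually (\<lambda>x. joint_tail H1 H2 A {x - 2 * c<..x + 3 * c} \<le> \<epsilon> * m x) at_top"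
proof -
  \<comment> \<open>five translates, each costing a factor \<open>2\<close> for the shift of \<open>m\<close>\<close>
  define \<delta> where "\<delta> = \<epsilon> / 10"
  have \<delta>: "0 < \<delta>" using \<epsilon> by (simp add: \<delta>_def)
  obtain A0 where A0: "\<And>A. A0 \<le> A \<Longrightarrow> eventually (\<lambda>x. joint_tail H1 H2 A {x<..x + c} \<le> \<delta> * m x) at_top"
    using neg \<delta> unfolding joint_negligible_def by blast
  have "eventually (\<lambda>x. joint_tail H1 H2 A {x - 2 * c<..x + 3 * c} \<le> \<epsilon> * m x) at_top" if A: "A0 \<le> A" for A
  proof -
    have cell: "eventually (\<lambda>x. joint_tail H1 H2 A {x + t<..x + t + c} \<le> \<delta> * (2 * m x)) at_top" for t
    proof -
      have "eventually (\<lambda>x. m (x + t) / m x < 2) at_top"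
        using long_tailed_shift_tendsto[OF m] by (rule order_tendstoD) simp
      then show ?thesis
        using eventually_at_top_shift[OF A0[OF A], of t] long_tailed_eventually_pos[OF m]
      proof eventually_elim
        case (elim x)
        have "\<delta> * m (x + t) \<le> \<delta> * (2 * m x)"
          using elim \<delta> by (intro mult_left_mono) (auto simp: field_simps)
        then show ?case using elim by linarith
      qed
    qed
    show ?thesis
      using cell[of "-2 * c"] cell[of "- c"] cell[of 0] cell[of c] cell[of "2 * c"]
    proof eventually_elim
      case (elim x)
      have "joint_tail H1 H2 A {x - 2 * c<..x + 3 * c} \<le>
         joint_tail H1 H2 A {x - 2 * c<..x - c} + joint_tail H1 H2 A {x - c<..x + 3 * c}"
        using c by (intro joint_tail_split H1 H2) auto
      also have "joint_tail H1 H2 A {x - c<..x + 3 * c} \<le>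
         joint_tail H1 H2 A {x - c<..x} + joint_tail H1 H2 A {x<..x + 3 * c}"
        using c by (intro joint_tail_split H1 H2) auto
      also have "joint_tail H1 H2 A {x<..x + 3 * c} \<le>
         joint_tail H1 H2 A {x<..x + c} + joint_tail H1 H2 A {x + c<..x + 3 * c}"
        using c by (intro joint_tail_split H1 H2) auto
      also have "joint_tail H1 H2 A {x + c<..x + 3 * c} \<le>
         joint_tail H1 H2 A {x + c<..x + 2 * c} + joint_tail H1 H2 A {x + 2 * c<..x + 3 * c}"
        using c by (intro joint_tail_split H1 H2) auto
      finally have "joint_tail H1 H2 A {x - 2 * c<..x + 3 * c} \<le> 5 * (\<delta> * (2 * m x))"
        using elim by (simp add: algebra_simps)
      also have "\<dots> = \<epsilon> * m x" by (simp add: \<delta>_def)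
      finally show ?case by simp
    qed
  qed
  then show ?thesis by blast
qed

text \<open>The smallness of the joint tail depends only on the orders of magnitude of the local masses. One
  subexponential reference distribution therefore controls all the pairs that occur below: \<open>F\<close> with its
  convolution powers, and compound Poisson distributions with \<open>R\<close>.\<close>

lemma joint_negligible_transfer:
  assumes c: "0 < c" and m: "m \<in> long_tailed"
    and H1: "real_distribution H1" and H2: "real_distribution H2"
    and K1: "real_distribution K1" and K2: "real_distribution K2"
    and le1: "delta_mass c H1 \<in> O(delta_mass c K1)" and le2: "delta_mass c H2 \<in> O(delta_mass c K2)"
    and neg: "joint_negligible c m K1 K2"
  shows "joint_negligible c m H1 H2"
  unfolding joint_negligible_def
proof (intro allI impI)
  fix \<epsilon> :: real assume \<epsilon>: "0 < \<epsilon>"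
  obtain C1 where C1: "0 < C1" "eventually (\<lambda>x. norm (delta_mass c H1 x) \<le> C1 * norm (delta_mass c K1 x)) at_top"
    using le1 by (rule landau_o.bigE)
  obtain C2 where C2: "0 < C2" "eventually (\<lambda>x. norm (delta_mass c H2 x) \<le> C2 * norm (delta_mass c K2 x)) at_top"
    using le2 by (rule landau_o.bigE)
  obtain x1 where x1: "\<And>x. x1 \<le> x \<Longrightarrow> delta_mass c H1 x \<le> C1 * delta_mass c K1 x"
      "\<And>x. x1 \<le> x \<Longrightarrow> delta_mass c H2 x \<le> C2 * delta_mass c K2 x"
    using eventually_conj[OF C1(2) C2(2)] by (auto simp: eventually_at_top_linorder)
  have "0 < \<epsilon> / (C1 * C2)" using \<epsilon> C1 C2 by simp
  from joint_negligible_widen[OF c m K1 K2 neg this] obtain A0 where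
    A0: "\<And>A. A0 \<le> A \<Longrightarrow> eventually (\<lambda>x. joint_tail K1 K2 A {x - 2 * c<..x + 3 * c} \<le> \<epsilon> / (C1 * C2) * m x) at_top"
    by blast
  show "\<exists>A0. \<forall>A\<ge>A0. eventually (\<lambda>x. joint_tail H1 H2 A {x<..x + c} \<le> \<epsilon> * m x) at_top"
  proof (intro exI allI impI)
    fix A assume "max A0 x1 \<le> A"
    then have A: "A0 \<le> A" "x1 \<le> A" by auto
    show "eventually (\<lambda>x. joint_tail H1 H2 A {x<..x + c} \<le> \<epsilon> * m x) at_top"
      using A0[OF A(1)]
    proof eventually_elim
      case (elim x)
      have "joint_tail H1 H2 A {x<..x + c} \<le> C1 * C2 * joint_tail K1 K2 A {x - 2 * c<..x + 3 * c}"
        using C1(1) C2(1) A(2) by (intro joint_tail_transfer[OF H1 H2 K1 K2 c] x1) auto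
      also have "\<dots> \<le> C1 * C2 * (\<epsilon> / (C1 * C2) * m x)"
        using elim C1(1) C2(1) by (intro mult_left_mono) auto
      also have "\<dots> = \<epsilon> * m x" using C1(1) C2(1) by simp
      finally show ?case .
    qed
  qed
qed

section \<open>A uniform bound for convolutions\<close>

text \<open>The constants \<open>\<kappa>\<close> and \<open>x1\<close> must not depend on \<open>H1\<close> and \<open>H2\<close>, since the bound is iterated over all
  convolution powers. For large \<open>x\<close> it follows from the decomposition with one fixed \<open>A\<close>; between \<open>x1\<close> and
  that threshold the mass is at most \<open>1\<close>, whereas \<open>G(x + \<Delta>)\<close> stays away from \<open>0\<close> because it is almost
  decreasing.\<close>

lemma convolution_uniform_bound:
  assumes c: "0 < c" and G: "real_distribution G"
    and m: "delta_mass c G \<in> long_tailed" and D: "almost_decreasing (delta_mass c G)"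
    and neg: "joint_negligible c (delta_mass c G) G G"
  obtains \<kappa> x1 where "1 \<le> \<kappa>" "x0 \<le> x1"
    "\<And>H1 H2 B1 B2 x. real_distribution H1 \<Longrightarrow> real_distribution H2 \<Longrightarrow> 1 \<le> B1 \<Longrightarrow> 1 \<le> B2 \<Longrightarrow>
      (\<And>u. x1 \<le> u \<Longrightarrow> delta_mass c H1 u \<le> B1 * delta_mass c G u) \<Longrightarrow>
      (\<And>u. x1 \<le> u \<Longrightarrow> delta_mass c H2 u \<le> B2 * delta_mass c G u) \<Longrightarrow>
      x1 \<le> x \<Longrightarrow> delta_mass c (H1 \<star> H2) x \<le> \<kappa> * B1 * B2 * delta_mass c G x"
proof -
  define m where "m = delta_mass c G"
  note m' = m[folded m_def]
  obtain xd K where "0 < K" "\<forall>x>xd. \<forall>y>0. m (x + y) \<le> K * m x"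
    using D[folded m_def] unfolding almost_decreasing_def by blast
  then have K: "0 < K" "\<And>x y. xd < x \<Longrightarrow> 0 < y \<Longrightarrow> m (x + y) \<le> K * m x" by auto
  obtain xp where xp: "\<And>x. xp \<le> x \<Longrightarrow> 0 < m x"
    using long_tailed_eventually_pos[OF m'] by (auto simp: eventually_at_top_linorder)
  define x1 where "x1 = max x0 (max (xd + 1) xp)"
  obtain K' where K': "0 < K'" "\<And>A. eventually (\<lambda>x. \<forall>y\<le>A. m (x - y) \<le> K' * m x) at_top"
    using almost_decreasing_uniform_bound[OF m' D[folded m_def]] by blast
  obtain A0 where A0: "\<And>A. A0 \<le> A \<Longrightarrow> eventually (\<lambda>x. joint_tail G G A {x - 2 * c<..x + 3 * c} \<le> 1 * m x) at_top"
    using joint_negligible_widen[OF c m' G G neg[folded m_def] zero_less_one] by blast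
  define A where "A = max A0 x1"
  have "eventually (\<lambda>x. joint_tail G G A {x - 2 * c<..x + 3 * c} \<le> 1 * m x \<and> (\<forall>y\<le>A. m (x - y) \<le> K' * m x)
     \<and> max (2 * A) (x1 + A) \<le> x) at_top"
    by (intro eventually_conj A0 K' eventually_ge_at_top) (simp add: A_def)
  then obtain x2 where x2: "\<And>x. x2 \<le> x \<Longrightarrow> joint_tail G G A {x - 2 * c<..x + 3 * c} \<le> m x"
      "\<And>x y. x2 \<le> x \<Longrightarrow> y \<le> A \<Longrightarrow> m (x - y) \<le> K' * m x" "\<And>x. x2 \<le> x \<Longrightarrow> 2 * A \<le> x \<and> x1 + A \<le> x"
    by (auto simp: eventually_at_top_linorder)
  define x3 where "x3 = max x1 x2"
  have m3: "0 < m x3" by (rule xp) (auto simp: x3_def x1_def)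
  \<comment> \<open>the first two summands serve \<open>x \<ge> x2\<close>, the last two serve \<open>x1 \<le> x < x2\<close>\<close>
  define \<kappa> where "\<kappa> = 2 * K' + 1 + K / m x3 + 1 / m x3"
  have \<kappa>: "2 * K' + 1 \<le> \<kappa>" "K / m x3 \<le> \<kappa>" "1 / m x3 \<le> \<kappa>" "1 \<le> \<kappa>"
    using K(1) K'(1) m3 by (auto simp: \<kappa>_def)
  show thesis
  proof (rule that[OF \<kappa>(4)])
    show "x0 \<le> x1" by (simp add: x1_def)
    fix H1 H2 B1 B2 x
    assume H1: "real_distribution H1" and H2: "real_distribution H2" and B: "1 \<le> B1" "1 \<le> B2"
      and le1': "\<And>u. x1 \<le> u \<Longrightarrow> delta_mass c H1 u \<le> B1 * delta_mass c G u"
      and le2': "\<And>u. x1 \<le> u \<Longrightarrow> delta_mass c H2 u \<le> B2 * delta_mass c G u" and x: "x1 \<le> x"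
    note le1 = le1'[folded m_def] and le2 = le2'[folded m_def]
    interpret H1: real_distribution H1 by fact
    interpret H2: real_distribution H2 by fact
    interpret HH: real_distribution "H1 \<star> H2" by (rule real_distribution_convolution[OF H1 H2])
    have mx: "0 < m x" using x by (intro xp) (auto simp: x1_def)
    have BB: "1 \<le> B1 * B2" using mult_mono[of 1 B1 1 B2] B by simp
    show "delta_mass c (H1 \<star> H2) x \<le> \<kappa> * B1 * B2 * delta_mass c G x"
    proof (cases "x2 \<le> x")
      case True
      have one: "(\<integral>y. indicator {..A} y * delta_mass c H' (x - y) \<partial>H) \<le> B * (K' * m x)"
        if H: "real_distribution H" and H': "real_distribution H'" and B: "1 \<le> B"
          and le: "\<And>u. x1 \<le> u \<Longrightarrow> delta_mass c H' u \<le> B * m u" for H H' B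
      proof -
        interpret H: real_distribution H by fact
        interpret H': real_distribution H' by fact
        note [measurable] = H'.borel_measurable_delta_mass[OF c]
        have "(\<integral>y. indicator {..A} y * delta_mass c H' (x - y) \<partial>H) \<le> (\<integral>y. B * (K' * m x) \<partial>H)"
        proof (rule integral_mono)
          show "integrable H (\<lambda>y. indicator {..A} y * delta_mass c H' (x - y))"
            by (rule H.integrable_const_bound[where B=1]) (auto simp: indicator_def H'.delta_mass_le_1)
          show "indicator {..A} y * delta_mass c H' (x - y) \<le> B * (K' * m x)" for y
          proof (cases "y \<le> A")
            case yA: True
            have "delta_mass c H' (x - y) \<le> B * m (x - y)"
              using x2(3)[OF True] yA by (intro le) auto
            also have "\<dots> \<le> B * (K' * m x)" using B x2(2)[OF True yA] by (intro mult_left_mono) auto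
            finally show ?thesis using yA by simp
          qed (use B K'(1) mx in simp)
        qed auto
        then show ?thesis using H.prob_space by simp
      qed
      have "delta_mass c (H1 \<star> H2) x \<le> B2 * (K' * m x) + B1 * (K' * m x) + B1 * B2 * m x"
      proof -
        have "joint_tail H1 H2 A {x<..x + c} \<le> B1 * B2 * joint_tail G G A {x - 2 * c<..x + 3 * c}"
          using B le1 le2 by (intro joint_tail_transfer[OF H1 H2 G G c]) (auto simp: A_def m_def)
        also have "\<dots> \<le> B1 * B2 * m x"
          using B x2(1)[OF True] by (intro mult_left_mono) auto
        finally show ?thesis
          using delta_mass_convolution_decompose[OF H1 H2 c, of A x] x2(3)[OF True]
            one[OF H1 H2 B(2) le2] one[OF H2 H1 B(1) le1] by linarith
      qed
      also have "\<dots> \<le> (B1 * B2) * (K' * m x) + (B1 * B2) * (K' * m x) + B1 * B2 * m x"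
        using B K'(1) mx by (intro add_mono mult_right_mono) auto
      also have "\<dots> = (2 * K' + 1) * (B1 * B2 * m x)" by (simp add: algebra_simps)
      also have "\<dots> \<le> \<kappa> * (B1 * B2 * m x)"
        using \<kappa>(1) BB mx by (intro mult_right_mono) auto
      finally show ?thesis by (simp add: m_def mult_ac)
    next
      case False
      then have x3: "x \<le> x3" by (simp add: x3_def)
      have "1 \<le> \<kappa> * m x"
      proof (cases "x = x3")
        case True
        then show ?thesis using \<kappa>(3) m3 by (simp add: pos_divide_le_eq)
      next
        case False
        have "m (x + (x3 - x)) \<le> K * m x" using False x3 x by (intro K(2)) (auto simp: x1_def)
        then have "m x3 \<le> K * m x" by simp
        then have "1 \<le> (K / m x3) * m x" using m3 by (simp add: field_simps)
        also have "\<dots> \<le> \<kappa> * m x" using \<kappa>(2) mx by (intro mult_right_mono) auto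
        finally show ?thesis .
      qed
      also have "\<kappa> * m x * 1 \<le> \<kappa> * m x * (B1 * B2)"
        using \<kappa>(4) mx BB by (intro mult_left_mono) auto
      finally show ?thesis using HH.delta_mass_le_1[of c x] by (simp add: m_def mult_ac)
    qed
  qed
qed

section \<open>Poisson mixtures\<close>

lemma
  fixes f :: "nat \<Rightarrow> 'a::{banach, second_countable_topology}"
  assumes "summable (\<lambda>n. norm (pmf p n *\<^sub>R f n))"
  shows integrable_nat_pmf: "integrable (measure_pmf p) f"
    and sums_integral_nat_pmf: "(\<lambda>n. pmf p n *\<^sub>R f n) sums (\<integral>n. f n \<partial>measure_pmf p)"
proof -
  have int: "integrable (count_space UNIV) (\<lambda>n. pmf p n *\<^sub>R f n)"
    using assms by (simp only: integrable_count_space_nat_iff)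
  show "integrable (measure_pmf p) f"
    unfolding measure_pmf_eq_density by (subst integrable_density) (auto simp: int)
  have "(\<integral>n. f n \<partial>measure_pmf p) = (\<integral>n. pmf p n *\<^sub>R f n \<partial>count_space UNIV)"
    unfolding measure_pmf_eq_density by (subst integral_density) auto
  then show "(\<lambda>n. pmf p n *\<^sub>R f n) sums (\<integral>n. f n \<partial>measure_pmf p)"
    using sums_integral_count_space_nat[OF int] by simp
qed

text \<open>The generating function of the Poisson distribution, for real arguments (exponential moments) and
  complex ones (characteristic functions).\<close>

lemma
  fixes z :: "'a::{real_normed_field, banach, second_countable_topology}"
  assumes l: "0 < l"
  shows integrable_poisson_power: "integrable (measure_pmf (poisson_pmf l)) (\<lambda>n. z ^ n)"
    and integral_poisson_power: "(\<integral>n. z ^ n \<partial>measure_pmf (poisson_pmf l)) = exp (of_real l * (z - 1))"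
proof -
  have eq: "pmf (poisson_pmf l) n *\<^sub>R z ^ n = exp (- l) *\<^sub>R ((of_real l * z) ^ n /\<^sub>R fact n)" for n
    by (simp add: l power_mult_distrib scaleR_conv_of_real field_simps)
  have sum: "summable (\<lambda>n. norm (pmf (poisson_pmf l) n *\<^sub>R z ^ n))"
    unfolding eq norm_scaleR by (intro summable_mult) (use summable_norm_exp[of "of_real l * z"] in simp)
  show "integrable (measure_pmf (poisson_pmf l)) (\<lambda>n. z ^ n)"
    by (rule integrable_nat_pmf[OF sum])
  have "(\<lambda>n. pmf (poisson_pmf l) n *\<^sub>R z ^ n) sums (exp (- l) *\<^sub>R exp (of_real l * z))"
    unfolding eq by (intro sums_scaleR_right exp_converges)
  moreover have "exp (- l) *\<^sub>R exp (of_real l * z) = exp (of_real l * (z - 1))"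
    by (simp add: scaleR_conv_of_real exp_of_real[symmetric] mult_exp_exp algebra_simps)
  ultimately show "(\<integral>n. z ^ n \<partial>measure_pmf (poisson_pmf l)) = exp (of_real l * (z - 1))"
    using sums_integral_nat_pmf[OF sum] sums_unique2 by metis
qed

lemma
  assumes l: "0 < l"
  shows integrable_poisson_of_nat: "integrable (measure_pmf (poisson_pmf l)) (\<lambda>n. real n)"
    and integral_poisson_of_nat: "(\<integral>n. real n \<partial>measure_pmf (poisson_pmf l)) = l"
proof -
  have shift: "pmf (poisson_pmf l) (Suc n) *\<^sub>R real (Suc n) = l * pmf (poisson_pmf l) n" for n
    using l by (simp add: divide_simps del: of_nat_Suc)
  have "(\<lambda>n. exp (- l) * (l ^ n /\<^sub>R fact n)) sums (exp (- l) * exp l)"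
    by (intro sums_mult exp_converges)
  then have one: "(\<lambda>n. pmf (poisson_pmf l) n) sums 1"
    by (simp add: l mult_exp_exp divide_inverse mult_ac)
  have "(\<lambda>n. pmf (poisson_pmf l) (Suc n) *\<^sub>R real (Suc n)) sums (l * 1)"
    unfolding shift by (rule sums_mult[OF one])
  then have s: "(\<lambda>n. pmf (poisson_pmf l) n *\<^sub>R real n) sums l"
    by (subst (asm) sums_Suc_iff) simp
  have "(\<lambda>n. norm (pmf (poisson_pmf l) n *\<^sub>R real n)) = (\<lambda>n. pmf (poisson_pmf l) n *\<^sub>R real n)"
    by (auto simp: l abs_mult simp del: pmf_poisson)
  then have sum: "summable (\<lambda>n. norm (pmf (poisson_pmf l) n *\<^sub>R real n))"
    using sums_summable[OF s] by simp
  show "integrable (measure_pmf (poisson_pmf l)) (\<lambda>n. real n)"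
    by (rule integrable_nat_pmf[OF sum])
  show "(\<integral>n. real n \<partial>measure_pmf (poisson_pmf l)) = l"
    using sums_integral_nat_pmf[OF sum] s sums_unique2 by metis
qed

text \<open>Giry's bind is used so that local masses, characteristic functions and exponential moments all become
  integrals over the Poisson distribution, where dominated convergence applies. The rate \<open>l\<close> must be
  positive for \<^const>\<open>poisson_pmf\<close> to be meaningful.\<close>

definition compound_poisson :: "real \<Rightarrow> real measure \<Rightarrow> real measure" where
  "compound_poisson l P = measure_pmf (poisson_pmf l) \<bind> conv_power P"

lemma real_distribution_conv_power:
  assumes "real_distribution P"
  shows "real_distribution (conv_power P n)"
proof (induction n)
  case 0
  have "prob_space (return borel (0::real))" by (rule prob_space_return) simp
  then show ?case by (simp add: real_distribution_def real_distribution_axioms_def)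
next
  case (Suc n)
  then show ?case using real_distribution_convolution[OF assms] by simp
qed

lemma real_distribution_kernel:
  assumes "\<And>n. real_distribution (K n)"
  shows "K \<in> measurable (measure_pmf p) (subprob_algebra borel)"
proof -
  have "subprob_space (K n) \<and> sets (K n) = sets borel" for n
  proof -
    interpret real_distribution "K n" by fact
    show ?thesis by (auto intro: prob_space_imp_subprob_space prob_space_axioms)
  qed
  then show ?thesis by (simp add: space_subprob_algebra)
qed

lemma real_distribution_bind_pmf:
  assumes "\<And>n. real_distribution (K n)"
  shows "real_distribution (measure_pmf p \<bind> K)"
proof -
  have "prob_space (measure_pmf p \<bind> K)"
    by (rule measure_pmf.prob_space_bind[OF _ real_distribution_kernel[OF assms]])
       (use assms in \<open>auto simp: real_distribution_def\<close>)
  moreover have "sets (measure_pmf p \<bind> K) = sets borel"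
    by (rule sets_bind) (use assms in \<open>auto simp: real_distribution_def real_distribution_axioms_def\<close>)
  ultimately show ?thesis
    by (auto simp: real_distribution_def real_distribution_axioms_def dest: sets_eq_imp_space_eq)
qed

lemma real_distribution_compound_poisson:
  assumes "real_distribution P"
  shows "real_distribution (compound_poisson l P)"
  unfolding compound_poisson_def
  by (intro real_distribution_bind_pmf real_distribution_conv_power assms)

lemma delta_mass_bind_pmf:
  assumes "\<And>n. real_distribution (K n)"
  shows "delta_mass c (measure_pmf p \<bind> K) x = (\<integral>n. delta_mass c (K n) x \<partial>measure_pmf p)"
  unfolding delta_mass_def
  by (rule measure_pmf.measure_bind[OF real_distribution_kernel[OF assms]]) simp

text \<open>Convolution with \<open>R\<close> passes through the mixture, so that the terms \<open>conv_power P n \<star> R\<close> can be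
  studied one by one.\<close>

lemma compound_poisson_convolution:
  assumes P: "real_distribution P" and R: "real_distribution R"
  shows "compound_poisson l P \<star> R = measure_pmf (poisson_pmf l) \<bind> (\<lambda>n. conv_power P n \<star> R)"
proof (rule measure_eqI)
  interpret R: real_distribution R by fact
  interpret CP: real_distribution "compound_poisson l P"
    by (rule real_distribution_compound_poisson[OF P])
  have k: "real_distribution (conv_power P n \<star> R)" for n
    by (intro real_distribution_convolution real_distribution_conv_power P R)
  interpret B: real_distribution "measure_pmf (poisson_pmf l) \<bind> (\<lambda>n. conv_power P n \<star> R)"
    by (rule real_distribution_bind_pmf[OF k])
  show "sets (compound_poisson l P \<star> R) = sets (measure_pmf (poisson_pmf l) \<bind> (\<lambda>n. conv_power P n \<star> R))"
    by simp
  fix S assume "S \<in> sets (compound_poisson l P \<star> R)"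
  then have S[measurable]: "S \<in> sets borel" by simp
  have [measurable_cong]: "sets R = sets borel" by simp
  have meas: "(\<lambda>x. \<integral>\<^sup>+y. indicator S (x + y) \<partial>R) \<in> borel_measurable borel"
    by measurable
  have "emeasure (compound_poisson l P \<star> R) S = (\<integral>\<^sup>+x. \<integral>\<^sup>+y. indicator S (x + y) \<partial>R \<partial>compound_poisson l P)"
    by (rule convolution_emeasure') (auto intro: CP.finite_measure_axioms R.finite_measure_axioms)
  also have "\<dots> = (\<integral>\<^sup>+n. \<integral>\<^sup>+x. \<integral>\<^sup>+y. indicator S (x + y) \<partial>R \<partial>conv_power P n \<partial>measure_pmf (poisson_pmf l))"
    unfolding compound_poisson_def
    by (rule nn_integral_bind[OF meas real_distribution_kernel[OF real_distribution_conv_power[OF P]]])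
  also have "\<dots> = (\<integral>\<^sup>+n. emeasure (conv_power P n \<star> R) S \<partial>measure_pmf (poisson_pmf l))"
  proof (rule nn_integral_cong)
    fix n
    interpret Pn: real_distribution "conv_power P n" by (rule real_distribution_conv_power[OF P])
    show "(\<integral>\<^sup>+x. \<integral>\<^sup>+y. indicator S (x + y) \<partial>R \<partial>conv_power P n) = emeasure (conv_power P n \<star> R) S"
      by (rule convolution_emeasure'[symmetric]) (auto intro: Pn.finite_measure_axioms R.finite_measure_axioms)
  qed
  also have "\<dots> = emeasure (measure_pmf (poisson_pmf l) \<bind> (\<lambda>n. conv_power P n \<star> R)) S"
    by (rule emeasure_bind[symmetric, OF _ real_distribution_kernel[OF k] S]) simp
  finally show "emeasure (compound_poisson l P \<star> R) S = emeasure (measure_pmf (poisson_pmf l) \<bind> (\<lambda>n. conv_power P n \<star> R)) S" .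
qed

section \<open>Local asymptotics of compound Poisson distributions\<close>

lemma smallo_shift:
  assumes m: "m \<in> long_tailed" and e: "e \<in> o(m)"
  shows "(\<lambda>x. e (x + t)) \<in> o(m)"
proof -
  have "(\<lambda>x. e (x + t)) \<in> o(\<lambda>x. m (x + t))"
    by (rule landau_o.small.compose[OF e filterlim_shift_at_top])
  moreover have "(\<lambda>x. m (x + t)) \<in> O(m)"
    using long_tailed_shift_tendsto[OF m] by (rule bigoI_tendsto)
      (use long_tailed_eventually_pos[OF m] in \<open>auto elim: eventually_mono\<close>)
  ultimately show ?thesis by (rule landau_o.small_big_trans)
qed

lemma long_tailed_shift_diff:
  assumes m: "m \<in> long_tailed"
  shows "(\<lambda>x. m (x + t) - m x) \<in> o(m)"
proof -
  have "((\<lambda>x. m (x + t) / m x - 1) \<longlongrightarrow> 0) at_top"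
    using tendsto_diff[OF long_tailed_shift_tendsto[OF m, of t] tendsto_const[of 1]] by simp
  then have "((\<lambda>x. (m (x + t) - m x) / m x) \<longlongrightarrow> 0) at_top"
    by (rule Lim_transform_eventually)
       (use long_tailed_eventually_pos[OF m] in \<open>eventually_elim, simp add: diff_divide_distrib\<close>)
  then show ?thesis
    by (rule smalloI_tendsto) (use long_tailed_eventually_pos[OF m] in \<open>auto elim: eventually_mono\<close>)
qed

lemma insensitive_transfer:
  assumes m: "m \<in> long_tailed" and f: "\<And>t. (\<lambda>x. f (x + t) - f x) \<in> o(m)"
    and h: "(\<lambda>x. h x - a * f x) \<in> o(m)"
  shows "(\<lambda>x. h (x + t) - h x) \<in> o(m)"
proof -
  have "(\<lambda>x. (h (x + t) - a * f (x + t)) - (h x - a * f x) + a * (f (x + t) - f x)) \<in> o(m)"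
    using f[of t] by (intro sum_in_smallo smallo_shift[OF m h] h) (simp add: landau_o.small.cmult)
  then show ?thesis by (simp add: algebra_simps)
qed

lemma bigo_transfer:
  assumes f: "f \<in> O(m)" and h: "(\<lambda>x. h x - a * f x) \<in> o(m)"
  shows "h \<in> O(m)"
proof -
  have "(\<lambda>x. (h x - a * f x) + a * f x) \<in> O(m)"
    using f by (intro sum_in_bigo(1)[OF landau_o.small_imp_big[OF h]]) (cases "a = 0", simp_all)
  then show ?thesis by simp
qed

text \<open>The convolution square of \<open>G\<close> attains exactly the lower bound \<open>1 + 1\<close> that Fatou's lemma gives.\<close>

lemma subexponential_joint_negligible:
  assumes c: "0 < c" and G: "G \<in> S_Delta c"
  shows "joint_negligible c (delta_mass c G) G G"
proof -
  let ?m = "delta_mass c G"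
  have Gd: "real_distribution G" and m: "?m \<in> long_tailed"
    and S: "delta_mass c (G \<star> G) \<sim>[at_top] (\<lambda>x. 2 * ?m x)"
    using G by (auto simp: S_Delta_def L_Delta_def)
  note pos = long_tailed_eventually_pos[OF m]
  show ?thesis
  proof (rule joint_negligible_if_convolution_upper[OF c m Gd Gd lower_rate_self[OF m] _ lower_rate_self[OF m]])
    fix \<epsilon> :: real assume \<epsilon>: "0 < \<epsilon>"
    have "eventually (\<lambda>x. (if delta_mass c (G \<star> G) x = 0 \<and> 2 * ?m x = 0 then 1
        else delta_mass c (G \<star> G) x / (2 * ?m x)) < 1 + \<epsilon> / 2) at_top"
      using asymp_equivD[OF S] by (rule order_tendstoD) (use \<epsilon> in simp)
    then show "eventually (\<lambda>x. delta_mass c (G \<star> G) x \<le> (1 + 1 + \<epsilon>) * ?m x) at_top"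
      using pos
    proof eventually_elim
      case (elim x)
      then have "delta_mass c (G \<star> G) x < (1 + \<epsilon> / 2) * (2 * ?m x)"
        by (simp add: pos_divide_less_eq)
      then show ?case by (simp add: algebra_simps)
    qed
  qed auto
qed

text \<open>The error is measured by the reference distribution \<open>G\<close>, not by \<open>F\<close>: when \<open>G\<close> is the infinitely
  divisible distribution itself, nothing better than \<open>f = O(g)\<close> is known about \<open>F\<close> at this stage.\<close>

lemma conv_power_asymp:
  assumes c: "0 < c" and G: "G \<in> S_Delta c" "G \<in> D_Delta c" and F: "F \<in> L_Delta c"
    and fO: "delta_mass c F \<in> O(delta_mass c G)"
  shows "(\<lambda>x. delta_mass c (conv_power F n) x - real n * delta_mass c F x) \<in> o(delta_mass c G)"
proof (induction n)
  case 0
  show ?case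
  proof (rule landau_o.smallI)
    fix \<epsilon> :: real assume "0 < \<epsilon>"
    then show "eventually (\<lambda>x. norm (delta_mass c (conv_power F 0) x - real 0 * delta_mass c F x)
        \<le> \<epsilon> * norm (delta_mass c G x)) at_top"
      by (auto intro!: eventually_mono[OF eventually_ge_at_top[of 0]] simp: delta_mass_def measure_return)
  qed
next
  case (Suc n)
  let ?m = "delta_mass c G" and ?f = "delta_mass c F"
  have Gd: "real_distribution G" and m: "?m \<in> long_tailed" and D: "almost_decreasing ?m"
    using G by (auto simp: S_Delta_def L_Delta_def D_Delta_def)
  have Fd: "real_distribution F" and f: "?f \<in> long_tailed"
    using F by (auto simp: L_Delta_def)
  have Fn: "real_distribution (conv_power F n)" by (rule real_distribution_conv_power[OF Fd])
  have i1: "(\<lambda>x. ?f (x + t) - ?f x) \<in> o(?m)" for t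
    using long_tailed_shift_diff[OF f] fO by (rule landau_o.small_big_trans)
  have O2: "delta_mass c (conv_power F n) \<in> O(?m)" by (rule bigo_transfer[OF fO Suc.IH])
  have i2: "(\<lambda>x. delta_mass c (conv_power F n) (x + t) - delta_mass c (conv_power F n) x) \<in> o(?m)" for t
    by (rule insensitive_transfer[OF m i1 Suc.IH])
  have neg: "joint_negligible c ?m F (conv_power F n)"
    by (rule joint_negligible_transfer[OF c m Fd Fn Gd Gd fO O2 subexponential_joint_negligible[OF c G(1)]])
  have "(\<lambda>x. (delta_mass c (F \<star> conv_power F n) x - (?f x + delta_mass c (conv_power F n) x))
     + (delta_mass c (conv_power F n) x - real n * ?f x)) \<in> o(?m)"
    by (intro sum_in_smallo convolution_asymp_add[OF c m D Fd Fn neg fO O2 i1 i2] Suc.IH)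
  then show ?case by (simp add: algebra_simps)
qed

text \<open>A crude counterpart of Kesten's bound, where the base would be arbitrarily close to \<open>1\<close>. It comes from
  iterating the uniform bound for two factors, which costs the constant \<open>\<kappa>\<close> each time.\<close>

lemma conv_power_exponential_bound:
  assumes c: "0 < c" and G: "G \<in> S_Delta c" "G \<in> D_Delta c" and F: "F \<in> L_Delta c"
    and fO: "delta_mass c F \<in> O(delta_mass c G)"
  obtains B x1 where "1 \<le> B" "\<And>n x. x1 \<le> x \<Longrightarrow> delta_mass c (conv_power F n) x \<le> B ^ n * delta_mass c G x"
proof -
  let ?m = "delta_mass c G" and ?f = "delta_mass c F"
  have Gd: "real_distribution G" and m: "?m \<in> long_tailed" and D: "almost_decreasing ?m"
    using G by (auto simp: S_Delta_def L_Delta_def D_Delta_def)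
  have Fd: "real_distribution F" and f: "?f \<in> long_tailed"
    using F by (auto simp: L_Delta_def)
  obtain B where B: "0 < B" "eventually (\<lambda>x. \<bar>?f x\<bar> \<le> B * ?m x) at_top"
    using bigo_eventually_le[OF fO m] by blast
  then obtain x0 where x0: "\<And>x. x0 \<le> x \<Longrightarrow> ?f x \<le> B * ?m x"
    by (auto simp: eventually_at_top_linorder)
  \<comment> \<open>\<open>x1 \<ge> 0\<close> makes the point mass at \<open>0\<close> vanish on \<open>(x, x + c]\<close>, which starts the induction\<close>
  obtain \<kappa> x1 where \<kappa>: "1 \<le> \<kappa>" "max x0 0 \<le> x1" and conv:
    "\<And>H1 H2 B1 B2 x. real_distribution H1 \<Longrightarrow> real_distribution H2 \<Longrightarrow> 1 \<le> B1 \<Longrightarrow> 1 \<le> B2 \<Longrightarrow>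
      (\<And>u. x1 \<le> u \<Longrightarrow> delta_mass c H1 u \<le> B1 * ?m u) \<Longrightarrow>
      (\<And>u. x1 \<le> u \<Longrightarrow> delta_mass c H2 u \<le> B2 * ?m u) \<Longrightarrow>
      x1 \<le> x \<Longrightarrow> delta_mass c (H1 \<star> H2) x \<le> \<kappa> * B1 * B2 * ?m x"
    using convolution_uniform_bound[OF c Gd m D subexponential_joint_negligible[OF c G(1)], of "max x0 0"] by blast
  define B' where "B' = max B 1"
  have B': "1 \<le> B'" "B \<le> B'" by (auto simp: B'_def)
  have K: "1 \<le> \<kappa> * B'" using mult_mono[of 1 \<kappa> 1 B'] \<kappa> B' by simp
  have f': "?f u \<le> B' * ?m u" if "x1 \<le> u" for u
  proof -
    have "?f u \<le> B * ?m u" using that \<kappa>(2) by (intro x0) auto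
    also have "\<dots> \<le> B' * ?m u" using B' by (intro mult_right_mono) auto
    finally show ?thesis .
  qed
  have "\<forall>x\<ge>x1. delta_mass c (conv_power F n) x \<le> (\<kappa> * B') ^ n * ?m x" for n
  proof (induction n)
    case 0
    then show ?case using \<kappa>(2) by (auto simp: delta_mass_def measure_return)
  next
    case (Suc n)
    have "delta_mass c (F \<star> conv_power F n) x \<le> \<kappa> * B' * (\<kappa> * B') ^ n * ?m x" if "x1 \<le> x" for x
      by (rule conv[OF Fd real_distribution_conv_power[OF Fd] B'(1) one_le_power[OF K] f' _ that])
         (use Suc.IH in auto)
    then show ?case by simp
  qed
  then show thesis using that[OF K] by blast
qed

lemma compound_poisson_asymp:
  assumes c: "0 < c" and G: "G \<in> S_Delta c" "G \<in> D_Delta c" and F: "F \<in> L_Delta c"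
    and fO: "delta_mass c F \<in> O(delta_mass c G)" and l: "0 < l"
  shows "(\<lambda>x. delta_mass c (compound_poisson l F) x - l * delta_mass c F x) \<in> o(delta_mass c G)"
proof -
  let ?m = "delta_mass c G" and ?f = "delta_mass c F" and ?p = "measure_pmf (poisson_pmf l)"
  have m: "?m \<in> long_tailed" using G by (auto simp: S_Delta_def L_Delta_def)
  note pos = long_tailed_eventually_pos[OF m]
  have Fd: "real_distribution F" using F by (auto simp: L_Delta_def)
  have Fn: "real_distribution (conv_power F n)" for n by (rule real_distribution_conv_power[OF Fd])
  obtain B x1 where B: "1 \<le> B" "\<And>n x. x1 \<le> x \<Longrightarrow> delta_mass c (conv_power F n) x \<le> B ^ n * ?m x"
    using conv_power_exponential_bound[OF c G F fO] by blast
  obtain C where C: "0 < C" "eventually (\<lambda>x. \<bar>?f x\<bar> \<le> C * ?m x) at_top"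
    using bigo_eventually_le[OF fO m] by blast
  have "((\<lambda>x. \<integral>n. (delta_mass c (conv_power F n) x - real n * ?f x) / ?m x \<partial>?p) \<longlongrightarrow> (\<integral>n. 0 \<partial>?p)) at_top"
  proof (rule integral_dominated_convergence_at_top[where w="\<lambda>n. B ^ n + C * real n"])
    show "integrable ?p (\<lambda>n. B ^ n + C * real n)"
      by (intro Bochner_Integration.integrable_add integrable_mult_right
            integrable_poisson_power integrable_poisson_of_nat l)
    show "AE n in ?p. ((\<lambda>x. (delta_mass c (conv_power F n) x - real n * ?f x) / ?m x) \<longlongrightarrow> 0) at_top"
      by (intro AE_I2 smalloD_tendsto conv_power_asymp[OF c G F fO])
    show "eventually (\<lambda>x. AE n in ?p. norm ((delta_mass c (conv_power F n) x - real n * ?f x) / ?m x) \<le> B ^ n + C * real n) at_top"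
      using pos C(2) eventually_ge_at_top[of x1]
    proof eventually_elim
      case (elim x)
      have "norm ((delta_mass c (conv_power F n) x - real n * ?f x) / ?m x) \<le> B ^ n + C * real n" for n
      proof -
        have "\<bar>delta_mass c (conv_power F n) x - real n * ?f x\<bar> \<le> delta_mass c (conv_power F n) x + real n * ?f x"
          by (simp add: abs_le_iff)
        also have "\<dots> \<le> B ^ n * ?m x + real n * (C * ?m x)"
          using elim B(2)[of x n] by (intro add_mono mult_left_mono) auto
        finally show ?thesis using elim by (simp add: pos_divide_le_eq algebra_simps)
      qed
      then show ?case by (intro AE_I2)
    qed
  qed auto
  moreover have "(\<integral>n. (delta_mass c (conv_power F n) x - real n * ?f x) / ?m x \<partial>?p)
      = (delta_mass c (compound_poisson l F) x - l * ?f x) / ?m x" for x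
  proof -
    have int: "integrable ?p (\<lambda>n. delta_mass c (conv_power F n) x)"
    proof (rule measure_pmf.integrable_const_bound[where B=1])
      show "AE n in ?p. norm (delta_mass c (conv_power F n) x) \<le> 1"
        by (intro AE_I2) (simp add: real_distribution.delta_mass_le_1[OF Fn])
    qed simp
    have "(\<integral>n. (delta_mass c (conv_power F n) x - real n * ?f x) / ?m x \<partial>?p)
      = (\<integral>n. delta_mass c (conv_power F n) x - real n * ?f x \<partial>?p) / ?m x" by simp
    also have "(\<integral>n. delta_mass c (conv_power F n) x - real n * ?f x \<partial>?p) =
       (\<integral>n. delta_mass c (conv_power F n) x \<partial>?p) - (\<integral>n. real n * ?f x \<partial>?p)"
      by (intro Bochner_Integration.integral_diff int integrable_mult_left integrable_poisson_of_nat l)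
    also have "(\<integral>n. real n * ?f x \<partial>?p) = l * ?f x"
      using integral_poisson_of_nat[OF l] by simp
    also have "(\<integral>n. delta_mass c (conv_power F n) x \<partial>?p) = delta_mass c (compound_poisson l F) x"
      unfolding compound_poisson_def by (rule delta_mass_bind_pmf[symmetric, OF Fn])
    finally show ?thesis .
  qed
  ultimately have "((\<lambda>x. (delta_mass c (compound_poisson l F) x - l * ?f x) / ?m x) \<longlongrightarrow> 0) at_top"
    by (simp only: integral_zero)
  then show ?thesis
    by (rule smalloI_tendsto) (use pos in \<open>auto elim: eventually_mono\<close>)
qed

text \<open>Long-tailedness gives \<open>m(x + 1) \<ge> exp(-1/2) m(x)\<close> eventually, hence \<open>m\<close> decays at most like
  \<open>exp(-x/2)\<close> along a progression of step \<open>1\<close>; the almost decreasing property fills the gaps.\<close>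

lemma exponential_smallo_long_tailed:
  assumes m: "m \<in> long_tailed" and D: "almost_decreasing m"
  shows "(\<lambda>x. exp (- x)) \<in> o(m)"
proof -
  note pos = long_tailed_eventually_pos[OF m]
  obtain xd K where "0 < K" "\<forall>x>xd. \<forall>y>0. m (x + y) \<le> K * m x"
    using D unfolding almost_decreasing_def by blast
  then have K: "0 < K" "\<And>x y. xd < x \<Longrightarrow> 0 < y \<Longrightarrow> m (x + y) \<le> K * m x" by auto
  have "eventually (\<lambda>x. exp (-1/2) < m (x + 1) / m x) at_top"
    using long_tailed_shift_tendsto[OF m] by (rule order_tendstoD) simp
  then have "eventually (\<lambda>x. exp (-1/2) * m x \<le> m (x + 1) \<and> 0 < m x \<and> xd < x) at_top"
    using pos eventually_gt_at_top[of xd] by eventually_elim (simp add: field_simps)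
  then obtain a where a: "\<And>x. a \<le> x \<Longrightarrow> exp (-1/2) * m x \<le> m (x + 1) \<and> 0 < m x \<and> xd < x"
    by (auto simp: eventually_at_top_linorder)
  have grow: "exp (- real n / 2) * m a \<le> m (a + real n)" for n
  proof (induction n)
    case (Suc n)
    have "- real (Suc n) / 2 = -1/2 + - real n / 2" by (simp add: field_simps)
    then have "exp (- real (Suc n) / 2) * m a = exp (-1/2) * (exp (- real n / 2) * m a)"
      by (simp only: exp_add mult.assoc)
    also have "\<dots> \<le> exp (-1/2) * m (a + real n)" using Suc by (intro mult_left_mono) auto
    also have "\<dots> \<le> m (a + real n + 1)" using a[of "a + real n"] by auto
    finally show ?case by (simp add: algebra_simps)
  qed simp
  define d where "d = exp (- 1 / 2 + a / 2) * m a / K"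
  have d: "0 < d" using a[of a] K(1) by (simp add: d_def)
  have low: "d * exp (- x / 2) \<le> m x" if "a \<le> x" for x
  proof -
    define n where "n = nat (\<lfloor>x - a\<rfloor> + 1)"
    have n: "real n = of_int \<lfloor>x - a\<rfloor> + 1" using that unfolding n_def by (subst of_nat_nat) auto
    then have n': "x - a < real n" "real n \<le> x - a + 1" by linarith+
    have "m (x + (a + real n - x)) \<le> K * m x" using a[OF that] n' by (intro K(2)) auto
    then have 1: "m (a + real n) \<le> K * m x" by simp
    have "exp (- (x - a + 1) / 2) * m a \<le> exp (- real n / 2) * m a"
      using n' a[of a] by (intro mult_right_mono) auto
    also have "\<dots> \<le> K * m x" using grow[of n] 1 by linarith
    finally have "exp (- (x - a + 1) / 2) * m a / K \<le> m x" using K(1) by (simp add: pos_divide_le_eq mult.commute)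
    moreover have "- (x - a + 1) / 2 = (- 1 / 2 + a / 2) + (- x / 2)" by (simp add: field_simps)
    then have "exp (- (x - a + 1) / 2) = exp (- 1 / 2 + a / 2) * exp (- x / 2)" by (simp only: exp_add)
    then have "d * exp (- x / 2) = exp (- (x - a + 1) / 2) * m a / K"
      by (simp add: d_def)
    ultimately show ?thesis by simp
  qed
  have "(\<lambda>x. exp (- x)) \<in> o(\<lambda>x::real. d * exp (- x / 2))"
    using d by real_asymp
  moreover have "(\<lambda>x. d * exp (- x / 2)) \<in> O(m)"
  proof (rule bigoI[of _ 1])
    show "eventually (\<lambda>x. norm (d * exp (- x / 2)) \<le> 1 * norm (m x)) at_top"
      using eventually_ge_at_top[of a]
    proof eventually_elim
      case (elim x)
      have "norm (d * exp (- x / 2)) = d * exp (- x / 2)" using d by simp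
      also have "\<dots> \<le> m x" by (rule low[OF elim])
      finally show ?case by simp
    qed
  qed
  ultimately show ?thesis by (rule landau_o.small_big_trans)
qed

section \<open>Asymptotic equivalence\<close>

lemma asymp_equiv_if_diff_smallo:
  assumes m: "m \<in> long_tailed" and "0 < a" and h: "(\<lambda>x. h x - a * m x) \<in> o(m)"
  shows "h \<sim>[at_top] (\<lambda>x. a * m x)"
proof (rule asymp_equivI')
  have "((\<lambda>x. (h x - a * m x) / m x / a + 1) \<longlongrightarrow> 0 / a + 1) at_top"
    by (intro tendsto_intros smalloD_tendsto[OF h]) (use \<open>0 < a\<close> in simp)
  then have "((\<lambda>x. (h x - a * m x) / m x / a + 1) \<longlongrightarrow> 1) at_top" by simp
  then show "((\<lambda>x. h x / (a * m x)) \<longlongrightarrow> 1) at_top"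
    by (rule Lim_transform_eventually)
      (use long_tailed_eventually_pos[OF m] in \<open>eventually_elim, insert \<open>0 < a\<close>, simp add: field_simps\<close>)
qed

lemma diff_smallo_if_asymp_equiv:
  assumes m: "m \<in> long_tailed" and h: "h \<sim>[at_top] (\<lambda>x. a * m x)" and "0 < a"
  shows "(\<lambda>x. h x - a * m x) \<in> o(m)"
proof -
  note pos = long_tailed_eventually_pos[OF m]
  have "((\<lambda>x. h x / (a * m x)) \<longlongrightarrow> 1) at_top"
    using asymp_equivD[OF h] by (rule Lim_transform_eventually)
      (use pos in \<open>eventually_elim, insert \<open>0 < a\<close>, auto\<close>)
  from tendsto_mult[OF tendsto_const[of a] tendsto_diff[OF this tendsto_const[of 1]]]
  have "((\<lambda>x. a * (h x / (a * m x) - 1)) \<longlongrightarrow> 0) at_top" by simp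
  then have "((\<lambda>x. (h x - a * m x) / m x) \<longlongrightarrow> 0) at_top"
    by (rule Lim_transform_eventually)
      (use pos in \<open>eventually_elim, insert \<open>0 < a\<close>, simp add: field_simps\<close>)
  then show ?thesis
    by (rule smalloI_tendsto) (use pos in \<open>auto elim: eventually_mono\<close>)
qed

lemma asymp_equiv_eventually_bounds:
  assumes m: "m \<in> long_tailed" and h: "h \<sim>[at_top] (\<lambda>x. a * m x)" and a: "0 < a"
  shows "eventually (\<lambda>x. a / 2 * m x \<le> h x \<and> h x \<le> 2 * a * m x) at_top"
proof -
  have "0 < a / 2" using a by simp
  from landau_o.smallD[OF diff_smallo_if_asymp_equiv[OF m h a] this] long_tailed_eventually_pos[OF m]
  show ?thesis
  proof eventually_elim
    case (elim x)
    then have "\<bar>h x - a * m x\<bar> \<le> a / 2 * m x" by simp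
    moreover have "0 < a * m x" "a / 2 * m x = (a * m x) / 2" "2 * a * m x = 2 * (a * m x)"
      using elim a by simp_all
    ultimately show ?case by linarith
  qed
qed

lemma long_tailed_asymp_equiv:
  assumes m: "m \<in> long_tailed" and h: "h \<sim>[at_top] (\<lambda>x. a * m x)" and a: "0 < a"
    and [measurable]: "h \<in> borel_measurable borel" and nn: "\<And>x. 0 \<le> h x"
  shows "h \<in> long_tailed"
  unfolding long_tailed_def
proof (intro CollectI conjI allI impI)
  have "eventually (\<lambda>x. 0 < h x) at_top"
    using asymp_equiv_eventually_bounds[OF m h a] long_tailed_eventually_pos[OF m]
  proof eventually_elim
    case (elim x)
    have "0 < a / 2 * m x" using elim a by simp
    then show ?case using elim by linarith
  qed
  then obtain b where b: "\<And>x. b \<le> x \<Longrightarrow> 0 < h x" by (auto simp: eventually_at_top_linorder)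
  have "\<forall>x\<ge>max b 1. 0 < h x" using b by auto
  then show "\<exists>x0>0. \<forall>x\<ge>x0. 0 < h x" by (intro exI[of _ "max b 1"]) auto
  fix y :: real assume "0 < y"
  have "(\<lambda>x. h (x + y)) \<sim>[at_top] (\<lambda>x. a * m (x + y))"
    by (rule asymp_equiv_compose'[OF h filterlim_shift_at_top])
  also have "(\<lambda>x. a * m (x + y)) \<sim>[at_top] (\<lambda>x. a * m x)"
    using m \<open>0 < y\<close> by (intro asymp_equiv_mult) (auto simp: long_tailed_def)
  also have "(\<lambda>x. a * m x) \<sim>[at_top] h" using h by (rule asymp_equiv_symI)
  finally show "(\<lambda>x. h (x + y)) \<sim>[at_top] h" .
qed (use nn in auto)

lemma almost_decreasing_asymp_equiv:
  assumes m: "m \<in> long_tailed" and D: "almost_decreasing m" and h: "h \<sim>[at_top] (\<lambda>x. a * m x)"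
    and a: "0 < a" and nn: "\<And>x. 0 \<le> h x"
  shows "almost_decreasing h"
proof -
  obtain xd K where K: "0 < K" "\<forall>x>xd. \<forall>y>0. m (x + y) \<le> K * m x"
    using D unfolding almost_decreasing_def by blast
  obtain x1 where x1: "\<And>x. x1 \<le> x \<Longrightarrow> a / 2 * m x \<le> h x \<and> h x \<le> 2 * a * m x"
    using asymp_equiv_eventually_bounds[OF m h a] by (auto simp: eventually_at_top_linorder)
  have bound: "h (x + y) \<le> 4 * K * h x" if x: "max 1 (max xd x1) < x" and y: "0 < y" for x y
  proof -
    have "h (x + y) \<le> 2 * a * m (x + y)" using x1[of "x + y"] x y by auto
    also have "\<dots> \<le> 2 * a * (K * m x)" using a K(2) x y by (intro mult_left_mono) auto
    also have "\<dots> = 4 * K * (a / 2 * m x)" by simp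
    also have "\<dots> \<le> 4 * K * h x" using x1[of x] x K(1) by (intro mult_left_mono) auto
    finally show ?thesis .
  qed
  show ?thesis
    unfolding almost_decreasing_def
    by (intro conjI allI nn exI[of _ "max 1 (max xd x1)"] exI[of _ "4 * K"]) (use bound K in auto)
qed

section \<open>Convolution with a distribution of light right tail\<close>

text \<open>Valued in the extended non-negative reals, so that multiplicativity under convolution needs no
  integrability side conditions.\<close>

definition exp_moment :: "real \<Rightarrow> real measure \<Rightarrow> ennreal" where
  "exp_moment s H = (\<integral>\<^sup>+x. ennreal (exp (s * x)) \<partial>H)"

lemma exp_markov:
  assumes "real_distribution H" and M: "exp_moment s H \<le> ennreal M" "0 \<le> M" and A: "A \<in> sets borel" "\<And>x. x \<in> A \<Longrightarrow> k \<le> s * x"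
  shows "measure H A \<le> M * exp (- k)"
proof -
  interpret real_distribution H by fact
  have "ennreal (exp k) * emeasure H A = (\<integral>\<^sup>+x. ennreal (exp k) * indicator A x \<partial>H)"
    using A by (subst nn_integral_cmult_indicator) auto
  also have "\<dots> \<le> exp_moment s H"
    unfolding exp_moment_def using A(2) by (intro nn_integral_mono) (auto simp: indicator_def)
  also note M(1)
  finally have "ennreal (exp k * measure H A) \<le> ennreal M"
    by (simp add: emeasure_eq_measure ennreal_mult)
  then have "exp k * measure H A \<le> M" using M(2) by simp
  then have "exp (- k) * (exp k * measure H A) \<le> exp (- k) * M" by (intro mult_left_mono) auto
  then show ?thesis by (simp add: mult.assoc[symmetric] mult_exp_exp mult.commute)
qed

lemma exp_moment_delta_mass_bigo:
  assumes R: "real_distribution R" and fin: "exp_moment 1 R < \<infinity>"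
  shows "delta_mass c R \<in> O(\<lambda>x. exp (- x))"
proof -
  obtain I where I: "0 \<le> I" "exp_moment 1 R \<le> ennreal I"
    using fin by (cases "exp_moment 1 R") auto
  have "delta_mass c R x \<le> I * exp (- x)" for x
    unfolding delta_mass_def by (rule exp_markov[OF R I(2,1)]) auto
  then show ?thesis by (intro bigoI[of _ I]) (auto intro!: always_eventually)
qed

text \<open>The component \<open>R\<close> has local mass \<open>o(g)\<close>, by Markov's inequality and because \<open>g\<close> is heavier than
  any exponential; it disappears in the additivity of local masses.\<close>

lemma compound_poisson_convolution_asymp:
  assumes c: "0 < c" and G: "G \<in> S_Delta c" "G \<in> D_Delta c" and F: "F \<in> L_Delta c"
    and fO: "delta_mass c F \<in> O(delta_mass c G)" and l: "0 < l"
    and R: "real_distribution R" and fin: "exp_moment 1 R < \<infinity>"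
  shows "(\<lambda>x. delta_mass c (compound_poisson l F \<star> R) x - l * delta_mass c F x) \<in> o(delta_mass c G)"
proof -
  let ?m = "delta_mass c G" and ?f = "delta_mass c F" and ?Q = "compound_poisson l F"
  have Gd: "real_distribution G" and m: "?m \<in> long_tailed" and D: "almost_decreasing ?m"
    using G by (auto simp: S_Delta_def L_Delta_def D_Delta_def)
  have Fd: "real_distribution F" and f: "?f \<in> long_tailed" using F by (auto simp: L_Delta_def)
  have Qd: "real_distribution ?Q" by (rule real_distribution_compound_poisson[OF Fd])
  have i: "(\<lambda>x. ?f (x + t) - ?f x) \<in> o(?m)" for t
    using long_tailed_shift_diff[OF f] fO by (rule landau_o.small_big_trans)
  have Q: "(\<lambda>x. delta_mass c ?Q x - l * ?f x) \<in> o(?m)" by (rule compound_poisson_asymp[OF c G F fO l])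
  have r: "delta_mass c R \<in> o(?m)"
    using exp_moment_delta_mass_bigo[OF R fin] exponential_smallo_long_tailed[OF m D]
    by (rule landau_o.big_small_trans)
  have OQ: "delta_mass c ?Q \<in> O(?m)" by (rule bigo_transfer[OF fO Q])
  have OR: "delta_mass c R \<in> O(?m)" by (rule landau_o.small_imp_big[OF r])
  have neg: "joint_negligible c ?m ?Q R"
    by (rule joint_negligible_transfer[OF c m Qd R Gd Gd OQ OR subexponential_joint_negligible[OF c G(1)]])
  have iQ: "(\<lambda>x. delta_mass c ?Q (x + t) - delta_mass c ?Q x) \<in> o(?m)" for t
    by (rule insensitive_transfer[OF m i Q])
  have iR: "(\<lambda>x. delta_mass c R (x + t) - delta_mass c R x) \<in> o(?m)" for t
    by (intro sum_in_smallo smallo_shift[OF m r] r)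
  have "(\<lambda>x. (delta_mass c (?Q \<star> R) x - (delta_mass c ?Q x + delta_mass c R x))
     + ((delta_mass c ?Q x - l * ?f x) + delta_mass c R x)) \<in> o(?m)"
    by (rule sum_in_smallo(1)[OF convolution_asymp_add[OF c m D Qd R neg OQ OR iQ iR]
        sum_in_smallo(1)[OF Q r]])
  also have "(\<lambda>x. (delta_mass c (?Q \<star> R) x - (delta_mass c ?Q x + delta_mass c R x))
     + ((delta_mass c ?Q x - l * ?f x) + delta_mass c R x)) = (\<lambda>x. delta_mass c (?Q \<star> R) x - l * ?f x)"
    by (rule ext) linarith
  finally show ?thesis .
qed

lemma square_asymp:
  assumes c: "0 < c" and m: "m \<in> long_tailed" and D: "almost_decreasing m"
    and H: "real_distribution H" and neg: "joint_negligible c m H H"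
    and hO: "delta_mass c H \<in> O(m)" and i: "\<And>t. (\<lambda>x. delta_mass c H (x + t) - delta_mass c H x) \<in> o(m)"
  shows "(\<lambda>x. delta_mass c (H \<star> H) x - 2 * delta_mass c H x) \<in> o(m)"
  using convolution_asymp_add[OF c m D H H neg hO hO i i] by (simp only: mult_2)

section \<open>Necessity of the negligible joint tail\<close>

text \<open>Lower rates add: each copy of \<open>F\<close> contributes \<open>1\<close> and \<open>R\<close> contributes \<open>0\<close>.\<close>

lemma lower_rate_conv_power_convolution:
  assumes c: "0 < c" and F: "F \<in> L_Delta c" and R: "real_distribution R"
  shows "lower_rate (real n) (delta_mass c (conv_power F n \<star> R)) (delta_mass c F)"
proof -
  have Fd: "real_distribution F" and f: "delta_mass c F \<in> long_tailed" using F by (auto simp: L_Delta_def)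
  note Fn = real_distribution_conv_power[OF Fd]
  have "lower_rate (real n) (delta_mass c (conv_power F n)) (delta_mass c F)"
  proof (induction n)
    case (Suc n)
    from lower_rate_convolution[OF c f Fd Fn lower_rate_self[OF f] _ Suc] show ?case by simp
  qed (simp add: lower_rate_nonneg[OF f])
  from lower_rate_convolution[OF c f Fn R this _ lower_rate_nonneg[OF f, of "delta_mass c R"]]
  show ?thesis by simp
qed

lemma bigo_if_lower_rate:
  assumes m: "m \<in> long_tailed" and h: "lower_rate l h m" and l: "0 < l"
  shows "m \<in> O(h)"
proof (rule bigoI)
  have "eventually (\<lambda>x. (l - l / 2) * m x \<le> h x) at_top"
    using l by (intro h[unfolded lower_rate_def, rule_format]) simp
  then show "eventually (\<lambda>x. norm (m x) \<le> 2 / l * norm (h x)) at_top"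
    using long_tailed_eventually_pos[OF m]
  proof eventually_elim
    case (elim x)
    then have "l * m x \<le> 2 * h x" by (simp add: algebra_simps)
    also have "\<dots> \<le> 2 * \<bar>h x\<bar>" by simp
    finally show ?case using elim l by (simp add: field_simps)
  qed
qed

lemma compound_poisson_convolution_delta_mass:
  assumes P: "real_distribution P" and R: "real_distribution R"
  shows "delta_mass c (compound_poisson l P \<star> R) x =
     (\<integral>n. delta_mass c (conv_power P n \<star> R) x \<partial>measure_pmf (poisson_pmf l))"
  unfolding compound_poisson_convolution[OF P R]
  by (intro delta_mass_bind_pmf real_distribution_convolution real_distribution_conv_power P R)

lemma integrable_delta_mass_pmf:
  assumes "\<And>n. real_distribution (K n)"
  shows "integrable (measure_pmf p) (\<lambda>n. delta_mass c (K n) x)"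
proof (rule measure_pmf.integrable_const_bound[where B=1])
  show "AE n in measure_pmf p. norm (delta_mass c (K n) x) \<le> 1"
    by (intro AE_I2) (simp add: real_distribution.delta_mass_le_1[OF assms])
qed simp

text \<open>The single-jump term of the Poisson mixture alone is of the order of \<open>f\<close>.\<close>

lemma tail_bigo_compound_poisson:
  assumes c: "0 < c" and F: "F \<in> L_Delta c" and R: "real_distribution R" and l: "0 < l"
  shows "delta_mass c F \<in> O(delta_mass c (compound_poisson l F \<star> R))"
proof -
  have Fd: "real_distribution F" and f: "delta_mass c F \<in> long_tailed" using F by (auto simp: L_Delta_def)
  let ?p = "measure_pmf (poisson_pmf l)"
  define q where "q = pmf (poisson_pmf l) 1"
  have q: "0 < q" using l by (simp add: q_def)
  have Kn: "real_distribution (conv_power F n \<star> R)" for n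
    by (intro real_distribution_convolution real_distribution_conv_power Fd R)
  have le: "q * delta_mass c (conv_power F 1 \<star> R) x \<le> delta_mass c (compound_poisson l F \<star> R) x" for x
  proof -
    have "q * delta_mass c (conv_power F 1 \<star> R) x = (\<integral>n. indicator {1} n * delta_mass c (conv_power F 1 \<star> R) x \<partial>?p)"
      by (simp add: q_def measure_pmf_single del: pmf_poisson)
    also have "\<dots> \<le> (\<integral>n. delta_mass c (conv_power F n \<star> R) x \<partial>?p)"
    proof (rule integral_mono)
      show "integrable ?p (\<lambda>n. indicator {1} n * delta_mass c (conv_power F 1 \<star> R) x)"
        by (intro integrable_mult_left measure_pmf.integrable_const_bound[where B=1]) auto
      show "indicator {1} n * delta_mass c (conv_power F 1 \<star> R) x \<le> delta_mass c (conv_power F n \<star> R) x" for n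
        by (auto simp: indicator_def)
    qed (rule integrable_delta_mass_pmf[OF Kn])
    finally show ?thesis by (simp add: compound_poisson_convolution_delta_mass[OF Fd R])
  qed
  have "delta_mass c F \<in> O(delta_mass c (conv_power F 1 \<star> R))"
    using bigo_if_lower_rate[OF f lower_rate_conv_power_convolution[OF c F R, of 1]] by simp
  also have "delta_mass c (conv_power F 1 \<star> R) \<in> O(delta_mass c (compound_poisson l F \<star> R))"
    by (rule bigoI[of _ "1 / q"])
       (use le q in \<open>auto intro!: always_eventually simp: pos_le_divide_eq mult.commute\<close>)
  finally show ?thesis .
qed

text \<open>All terms of the mixture with \<open>n \<noteq> 2\<close> together contribute at least \<open>\<lambda> - 2 q\<close>, where \<open>q\<close> is the Poisson
  weight of \<open>2\<close>. As the total is \<open>\<lambda>\<close>, the term with weight \<open>q\<close> contributes at most \<open>2 q\<close>.\<close>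

lemma two_fold_upper_bound:
  assumes c: "0 < c" and F: "F \<in> L_Delta c" and R: "real_distribution R" and l: "0 < l"
    and eq: "delta_mass c (compound_poisson l F \<star> R) \<sim>[at_top] (\<lambda>x. l * delta_mass c F x)"
    and \<epsilon>: "0 < \<epsilon>"
  shows "eventually (\<lambda>x. delta_mass c (conv_power F 2 \<star> R) x \<le> (2 + \<epsilon>) * delta_mass c F x) at_top"
proof -
  let ?p = "measure_pmf (poisson_pmf l)" and ?f = "delta_mass c F"
  have Fd: "real_distribution F" and f: "?f \<in> long_tailed" using F by (auto simp: L_Delta_def)
  note pos = long_tailed_eventually_pos[OF f]
  define a where "a n = delta_mass c (conv_power F n \<star> R)" for n
  have a0: "0 \<le> a n x" for n x by (simp add: a_def)
  have Kn: "real_distribution (conv_power F n \<star> R)" for n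
    by (intro real_distribution_convolution real_distribution_conv_power Fd R)
  define q where "q = pmf (poisson_pmf l) 2"
  have q: "0 < q" using l by (simp add: q_def)
  \<comment> \<open>\<open>\<delta>\<close> is spent twice, and dividing by \<open>q\<close> at the end leaves \<open>\<epsilon>\<close>\<close>
  define \<delta> where "\<delta> = q * \<epsilon> / 2"
  have \<delta>: "0 < \<delta>" using q \<epsilon> by (simp add: \<delta>_def)
  let ?N = "- {2::nat}"
  have "((\<lambda>x. \<integral>n. indicator ?N n * min (a n x / ?f x) (real n) \<partial>?p) \<longlongrightarrow> (\<integral>n. indicator ?N n * real n \<partial>?p)) at_top"
  proof (rule integral_dominated_convergence_at_top[where w="\<lambda>n. real n"])
    show "integrable ?p (\<lambda>n. real n)" by (rule integrable_poisson_of_nat[OF l])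
    show "AE n in ?p. ((\<lambda>x. indicator ?N n * min (a n x / ?f x) (real n)) \<longlongrightarrow> indicator ?N n * real n) at_top"
      unfolding a_def
      by (intro AE_I2 tendsto_intros lower_rate_imp_min_tendsto[OF f lower_rate_conv_power_convolution[OF c F R]])
    show "eventually (\<lambda>x. AE n in ?p. norm (indicator ?N n * min (a n x / ?f x) (real n)) \<le> real n) at_top"
      by (intro always_eventually allI AE_I2) (auto simp: indicator_def a0)
  qed auto
  moreover have "(\<integral>n. indicator ?N n * real n \<partial>?p) = l - 2 * q"
  proof -
    have "(\<integral>n. indicator ?N n * real n \<partial>?p) = (\<integral>n. real n - indicator {2} n * 2 \<partial>?p)"
      by (intro Bochner_Integration.integral_cong) (auto simp: indicator_def)
    also have "\<dots> = (\<integral>n. real n \<partial>?p) - (\<integral>n. indicator {2} n * 2 \<partial>?p)"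
      by (intro Bochner_Integration.integral_diff integrable_poisson_of_nat l integrable_mult_left
            measure_pmf.integrable_const_bound[where B=1]) auto
    also have "\<dots> = l - 2 * q"
      by (simp add: integral_poisson_of_nat[OF l] q_def measure_pmf_single del: pmf_poisson)
    finally show ?thesis .
  qed
  ultimately have "eventually (\<lambda>x. l - 2 * q - \<delta> < (\<integral>n. indicator ?N n * min (a n x / ?f x) (real n) \<partial>?p)) at_top"
    using \<delta> by (intro order_tendstoD(1)) auto
  then show ?thesis
    using pos landau_o.smallD[OF diff_smallo_if_asymp_equiv[OF f eq l] \<delta>]
  proof eventually_elim
    case (elim x)
    let ?J = "\<integral>n. indicator ?N n * min (a n x / ?f x) (real n) \<partial>?p"
    have "?J * ?f x + q * a 2 x = (\<integral>n. indicator ?N n * min (a n x / ?f x) (real n) * ?f x \<partial>?p)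
        + (\<integral>n. indicator {2} n * a 2 x \<partial>?p)"
      by (simp add: q_def measure_pmf_single del: pmf_poisson)
    also have "\<dots> = (\<integral>n. indicator ?N n * min (a n x / ?f x) (real n) * ?f x + indicator {2} n * a 2 x \<partial>?p)"
    proof (rule Bochner_Integration.integral_add[symmetric])
      show "integrable ?p (\<lambda>n. indicator ?N n * min (a n x / ?f x) (real n) * ?f x)"
        by (intro integrable_mult_left Bochner_Integration.integrable_bound[OF integrable_poisson_of_nat[OF l]])
           (auto simp: indicator_def a0)
      show "integrable ?p (\<lambda>n. indicator {2} n * a 2 x)"
        by (intro integrable_mult_left measure_pmf.integrable_const_bound[where B=1]) auto
    qed
    also have "\<dots> \<le> (\<integral>n. a n x \<partial>?p)"
    proof (rule integral_mono)
      show "integrable ?p (\<lambda>n. a n x)" unfolding a_def by (rule integrable_delta_mass_pmf[OF Kn])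
      show "integrable ?p (\<lambda>n. indicator ?N n * min (a n x / ?f x) (real n) * ?f x + indicator {2} n * a 2 x)"
        by (intro Bochner_Integration.integrable_add integrable_mult_left
              Bochner_Integration.integrable_bound[OF integrable_poisson_of_nat[OF l]]
              measure_pmf.integrable_const_bound[where B=1])
           (auto simp: indicator_def a0)
      show "indicator ?N n * min (a n x / ?f x) (real n) * ?f x + indicator {2} n * a 2 x \<le> a n x" for n
      proof -
        have "min (a n x / ?f x) (real n) * ?f x \<le> a n x / ?f x * ?f x"
          using elim by (intro mult_right_mono) auto
        then show ?thesis using elim by (auto simp: indicator_def)
      qed
    qed
    also have "\<dots> = delta_mass c (compound_poisson l F \<star> R) x"
      unfolding a_def by (rule compound_poisson_convolution_delta_mass[OF Fd R, symmetric])
    also have "\<dots> \<le> (l + \<delta>) * ?f x" using elim by (auto simp: algebra_simps abs_le_iff)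
    finally have "q * a 2 x \<le> (l + \<delta>) * ?f x - ?J * ?f x" by simp
    also have "\<dots> = (l + \<delta> - ?J) * ?f x" by (simp add: algebra_simps)
    also have "\<dots> \<le> (2 * q + 2 * \<delta>) * ?f x"
      using elim by (intro mult_right_mono) auto
    also have "\<dots> = q * ((2 + \<epsilon>) * ?f x)" by (simp add: \<delta>_def algebra_simps)
    finally have "a 2 x \<le> (2 + \<epsilon>) * ?f x" using q by simp
    then show ?case by (simp add: a_def)
  qed
qed

text \<open>The two-fold term is read as the convolution of \<open>F\<close> with \<open>H = F \<star> R\<close>. Both have lower rate \<open>1\<close>, so the
  bound for the two-fold term makes their joint tail negligible; as \<open>f\<close> is of the order of the local mass of
  \<open>H\<close>, the factor \<open>H\<close> may be replaced by \<open>F\<close>.\<close>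

lemma joint_negligible_if_compound_poisson_asymp:
  assumes c: "0 < c" and F: "F \<in> L_Delta c" and R: "real_distribution R" and l: "0 < l"
    and eq: "delta_mass c (compound_poisson l F \<star> R) \<sim>[at_top] (\<lambda>x. l * delta_mass c F x)"
  shows "joint_negligible c (delta_mass c F) F F"
proof -
  let ?f = "delta_mass c F" and ?H = "conv_power F 1 \<star> R"
  have Fd: "real_distribution F" and f: "?f \<in> long_tailed" using F by (auto simp: L_Delta_def)
  interpret F: real_distribution F by fact
  interpret R: real_distribution R by fact
  interpret F1: real_distribution "conv_power F 1" by (rule real_distribution_conv_power[OF Fd])
  have Hd: "real_distribution ?H"
    by (intro real_distribution_convolution real_distribution_conv_power Fd R)
  have h: "lower_rate 1 (delta_mass c ?H) ?f"
    using lower_rate_conv_power_convolution[OF c F R, of 1] by simp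
  have assoc: "(conv_power F 2 \<star> R) = (F \<star> ?H)"
  proof -
    have "conv_power F 2 = (F \<star> conv_power F 1)" by (simp add: numeral_2_eq_2)
    then show ?thesis
      using convolution_associative[of "conv_power F 1" R F]
        F.finite_measure_axioms R.finite_measure_axioms F1.finite_measure_axioms by simp
  qed
  have neg: "joint_negligible c ?f F ?H"
  proof (rule joint_negligible_if_convolution_upper[OF c f Fd Hd lower_rate_self[OF f] _ h])
    show "eventually (\<lambda>x. delta_mass c (F \<star> ?H) x \<le> (1 + 1 + \<epsilon>) * ?f x) at_top" if "0 < \<epsilon>" for \<epsilon>
      using two_fold_upper_bound[OF c F R l eq that] unfolding assoc by simp
  qed auto
  show ?thesis
    by (rule joint_negligible_transfer[OF c f Fd Fd Fd Hd _ bigo_if_lower_rate[OF f h] neg]) auto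
qed

section \<open>The equivalence for compound Poisson convolutions\<close>

text \<open>The implications from (ii) use \<open>F\<close> as reference distribution, the one from (i) uses \<open>\<mu>\<close>; in the latter case
  the errors \<open>o(m)\<close> become \<open>o(f)\<close> once \<open>m \<sim> \<lambda> f\<close> is known.\<close>

theorem compound_poisson_local_subexponentiality:
  assumes c: "0 < c" and F: "F \<in> L_Delta c" and l: "0 < l"
    and R: "real_distribution R" and fin: "exp_moment 1 R < \<infinity>"
  defines "\<mu> \<equiv> compound_poisson l F \<star> R"
  shows "(\<mu> \<in> S_Delta c \<inter> D_Delta c \<longleftrightarrow> F \<in> S_Delta c \<inter> D_Delta c) \<and>
    (F \<in> S_Delta c \<inter> D_Delta c \<longleftrightarrow>
      F \<in> L_Delta c \<inter> D_Delta c \<and> delta_mass c \<mu> \<sim>[at_top] (\<lambda>x. l * delta_mass c F x))"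
proof -
  let ?f = "delta_mass c F" and ?m = "delta_mass c \<mu>"
  have Fd: "real_distribution F" and f: "?f \<in> long_tailed" using F by (auto simp: L_Delta_def)
  have md: "real_distribution \<mu>"
    unfolding \<mu>_def by (intro real_distribution_convolution real_distribution_compound_poisson Fd R)
  interpret F: real_distribution F by fact
  interpret mu: real_distribution \<mu> by fact
  have i: "(\<lambda>x. ?f (x + t) - ?f x) \<in> o(?f)" for t by (rule long_tailed_shift_diff[OF f])
  have S: "F \<in> S_Delta c" if "(\<lambda>x. delta_mass c (F \<star> F) x - 2 * ?f x) \<in> o(?f)"
    using asymp_equiv_if_diff_smallo[OF f _ that] F by (simp add: S_Delta_def)
  have ii_asymp: "(\<lambda>x. ?m x - l * ?f x) \<in> o(?f)" if "F \<in> S_Delta c" "F \<in> D_Delta c"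
    unfolding \<mu>_def by (rule compound_poisson_convolution_asymp[OF c that F _ l R fin]) simp
  have ii_i: "\<mu> \<in> S_Delta c \<inter> D_Delta c" if FS: "F \<in> S_Delta c" and FD: "F \<in> D_Delta c"
  proof -
    have D: "almost_decreasing ?f" using FD by (simp add: D_Delta_def)
    note as = ii_asymp[OF FS FD]
    note eq = asymp_equiv_if_diff_smallo[OF f l as]
    have mO: "?m \<in> O(?f)" by (rule bigo_transfer[OF landau_o.big_refl as])
    have neg: "joint_negligible c ?f \<mu> \<mu>"
      by (rule joint_negligible_transfer[OF c f md md Fd Fd mO mO subexponential_joint_negligible[OF c FS]])
    have mi: "(\<lambda>x. ?m (x + t) - ?m x) \<in> o(?f)" for t by (rule insensitive_transfer[OF f i as])
    have mL: "?m \<in> long_tailed"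
      by (rule long_tailed_asymp_equiv[OF f eq l]) (auto simp: c)
    have fm: "?f \<in> O(?m)" unfolding \<mu>_def by (rule tail_bigo_compound_poisson[OF c F R l])
    have "(\<lambda>x. delta_mass c (\<mu> \<star> \<mu>) x - 2 * ?m x) \<in> o(?f)"
      by (rule square_asymp[OF c f D md neg mO mi])
    then have "(\<lambda>x. delta_mass c (\<mu> \<star> \<mu>) x - 2 * ?m x) \<in> o(?m)"
      using fm by (rule landau_o.small_big_trans)
    from asymp_equiv_if_diff_smallo[OF mL _ this] have "\<mu> \<in> S_Delta c"
      using md mL by (simp add: S_Delta_def L_Delta_def)
    moreover have "\<mu> \<in> D_Delta c"
      using almost_decreasing_asymp_equiv[OF f D eq l] md by (simp add: D_Delta_def)
    ultimately show ?thesis by simp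
  qed
  have i_ii: "F \<in> S_Delta c \<inter> D_Delta c" if mS: "\<mu> \<in> S_Delta c" and mD: "\<mu> \<in> D_Delta c"
  proof -
    have mL: "?m \<in> long_tailed" and D: "almost_decreasing ?m"
      using mS mD by (auto simp: S_Delta_def L_Delta_def D_Delta_def)
    have fm: "?f \<in> O(?m)" unfolding \<mu>_def by (rule tail_bigo_compound_poisson[OF c F R l])
    have as: "(\<lambda>x. ?m x - l * ?f x) \<in> o(?m)"
      using compound_poisson_convolution_asymp[OF c mS mD F fm l R fin] unfolding \<mu>_def .
    have "(\<lambda>x. - (1 / l) * (?m x - l * ?f x)) \<in> o(?m)"
      using as l by (subst landau_o.small.cmult_in_iff) auto
    also have "(\<lambda>x. - (1 / l) * (?m x - l * ?f x)) = (\<lambda>x. ?f x - 1 / l * ?m x)"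
      using l by (intro ext) (simp add: field_simps)
    finally have "(\<lambda>x. ?f x - 1 / l * ?m x) \<in> o(?m)" .
    from asymp_equiv_if_diff_smallo[OF mL _ this] have eq: "?f \<sim>[at_top] (\<lambda>x. 1 / l * ?m x)"
      using l by simp
    have "F \<in> D_Delta c"
      using almost_decreasing_asymp_equiv[OF mL D eq] l Fd by (simp add: D_Delta_def)
    have mf: "?m \<in> O(?f)"
    proof (rule bigoI[of _ "2 * l"])
      have "eventually (\<lambda>x. 1 / l / 2 * ?m x \<le> ?f x \<and> ?f x \<le> 2 * (1 / l) * ?m x) at_top"
        using asymp_equiv_eventually_bounds[OF mL eq] l by simp
      then show "eventually (\<lambda>x. norm (?m x) \<le> 2 * l * norm (?f x)) at_top"
        by eventually_elim (use l in \<open>simp add: field_simps\<close>)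
    qed
    have neg: "joint_negligible c ?m F F"
      by (rule joint_negligible_transfer[OF c mL Fd Fd md md fm fm subexponential_joint_negligible[OF c mS]])
    have "(\<lambda>x. delta_mass c (F \<star> F) x - 2 * ?f x) \<in> o(?m)"
      by (rule square_asymp[OF c mL D Fd neg fm landau_o.small_big_trans[OF i fm]])
    then have "(\<lambda>x. delta_mass c (F \<star> F) x - 2 * ?f x) \<in> o(?f)"
      using mf by (rule landau_o.small_big_trans)
    then show ?thesis using S \<open>F \<in> D_Delta c\<close> by simp
  qed
  have iii_ii: "F \<in> S_Delta c" if FD: "F \<in> D_Delta c" and eq: "?m \<sim>[at_top] (\<lambda>x. l * ?f x)"
  proof (rule S)
    have D: "almost_decreasing ?f" using FD by (simp add: D_Delta_def)
    show "(\<lambda>x. delta_mass c (F \<star> F) x - 2 * ?f x) \<in> o(?f)"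
      by (rule square_asymp[OF c f D Fd joint_negligible_if_compound_poisson_asymp[OF c F R l eq[unfolded \<mu>_def]] _ i])
         simp
  qed
  have ii_iii: "?m \<sim>[at_top] (\<lambda>x. l * ?f x)" if "F \<in> S_Delta c" "F \<in> D_Delta c"
    by (rule asymp_equiv_if_diff_smallo[OF f l ii_asymp[OF that]])
  show ?thesis
  proof (intro conjI iffI)
    show "F \<in> S_Delta c \<inter> D_Delta c" if "\<mu> \<in> S_Delta c \<inter> D_Delta c"
      using that i_ii by simp
    show "\<mu> \<in> S_Delta c \<inter> D_Delta c" if "F \<in> S_Delta c \<inter> D_Delta c"
      using that ii_i by simp
    show "F \<in> L_Delta c \<inter> D_Delta c" if "F \<in> S_Delta c \<inter> D_Delta c"
      using that F by simp
    show "?m \<sim>[at_top] (\<lambda>x. l * ?f x)" if "F \<in> S_Delta c \<inter> D_Delta c"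
      by (rule ii_iii) (use that in auto)
    show "F \<in> S_Delta c \<inter> D_Delta c"
      if "F \<in> L_Delta c \<inter> D_Delta c \<and> ?m \<sim>[at_top] (\<lambda>x. l * ?f x)"
      using that iii_ii by simp
  qed
qed

section \<open>Characteristic functions and exponential moments of compound Poisson distributions\<close>

lemma char_convolution:
  assumes "real_distribution H1" "real_distribution H2"
  shows "char (H1 \<star> H2) z = char H1 z * char H2 z"
proof -
  interpret H1: real_distribution H1 by fact
  interpret H2: real_distribution H2 by fact
  interpret P: pair_prob_space H1 H2 ..
  have [measurable_cong]: "sets H1 = sets borel" "sets H2 = sets borel" by auto
  have "char (H1 \<star> H2) z = (\<integral>p. iexp (z * (fst p + snd p)) \<partial>(H1 \<Otimes>\<^sub>M H2))"
    unfolding char_def convolution_def by (subst integral_distr) (auto simp: case_prod_beta)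
  also have "\<dots> = (\<integral>x. (\<integral>y. iexp (z * (x + y)) \<partial>H2) \<partial>H1)"
    by (subst P.integral_fst'[symmetric]) (auto intro!: P.P.integrable_iexp)
  also have "\<dots> = (\<integral>x. iexp (z * x) * char H2 z \<partial>H1)"
    by (simp add: char_def distrib_left exp_add)
  also have "\<dots> = char H1 z * char H2 z"
    by (simp add: char_def)
  finally show ?thesis .
qed

lemma (in real_distribution) char_Re_Im:
  "Re (char M z) = (\<integral>x. cos (z * x) \<partial>M)" "Im (char M z) = (\<integral>x. sin (z * x) \<partial>M)"
proof -
  have int: "integrable M (\<lambda>x. iexp (z * x))" by (rule integrable_iexp) auto
  show "Re (char M z) = (\<integral>x. cos (z * x) \<partial>M)" "Im (char M z) = (\<integral>x. sin (z * x) \<partial>M)"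
    unfolding char_def integral_Re[OF int, symmetric] integral_Im[OF int, symmetric]
    by (simp_all add: Re_exp Im_exp)
qed

lemma char_bind_pmf:
  assumes K: "\<And>n. real_distribution (K n)"
  shows "char (measure_pmf p \<bind> K) z = (\<integral>n. char (K n) z \<partial>measure_pmf p)"
proof (rule complex_eqI)
  interpret B: real_distribution "measure_pmf p \<bind> K" by (rule real_distribution_bind_pmf[OF K])
  have int: "integrable (measure_pmf p) (\<lambda>n. char (K n) z)"
    by (rule measure_pmf.integrable_const_bound[where B=1])
       (auto simp: real_distribution.cmod_char_le_1[OF K])
  have space: "AE n in measure_pmf p. emeasure (K n) (space (K n)) \<le> ennreal 1"
  proof (rule AE_I2)
    fix n
    interpret real_distribution "K n" by (rule K)
    show "emeasure (K n) (space (K n)) \<le> ennreal 1" by (simp add: emeasure_space_1 del: space_eq_univ)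
  qed
  note bind = integral_bind[where B=1 and K=borel, OF _ _ real_distribution_kernel[OF K]
      measure_pmf.finite_measure_axioms space]
  have "Re (char (measure_pmf p \<bind> K) z) = (\<integral>n. (\<integral>x. cos (z * x) \<partial>K n) \<partial>measure_pmf p)"
    unfolding B.char_Re_Im by (rule bind) auto
  also have "\<dots> = (\<integral>n. Re (char (K n) z) \<partial>measure_pmf p)"
    by (simp add: real_distribution.char_Re_Im[OF K])
  also have "\<dots> = Re (\<integral>n. char (K n) z \<partial>measure_pmf p)" by (rule integral_Re[OF int])
  finally show "Re (char (measure_pmf p \<bind> K) z) = Re (\<integral>n. char (K n) z \<partial>measure_pmf p)" .
  have "Im (char (measure_pmf p \<bind> K) z) = (\<integral>n. (\<integral>x. sin (z * x) \<partial>K n) \<partial>measure_pmf p)"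
    unfolding B.char_Re_Im by (rule bind) auto
  also have "\<dots> = (\<integral>n. Im (char (K n) z) \<partial>measure_pmf p)"
    by (simp add: real_distribution.char_Re_Im[OF K])
  also have "\<dots> = Im (\<integral>n. char (K n) z \<partial>measure_pmf p)" by (rule integral_Im[OF int])
  finally show "Im (char (measure_pmf p \<bind> K) z) = Im (\<integral>n. char (K n) z \<partial>measure_pmf p)" .
qed

lemma char_return: "char (return borel a) z = iexp (z * a)"
  by (simp add: char_def integral_return)

lemma char_compound_poisson:
  assumes P: "real_distribution P" and l: "0 < l"
  shows "char (compound_poisson l P) z = exp (of_real l * (char P z - 1))"
proof -
  have Pn: "char (conv_power P n) z = char P z ^ n" for n
    by (induction n) (auto simp: char_return char_convolution P real_distribution_conv_power)
  show ?thesis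
    unfolding compound_poisson_def char_bind_pmf[OF real_distribution_conv_power[OF P]] Pn
    by (rule integral_poisson_power[OF l])
qed

lemma exp_moment_convolution:
  assumes "real_distribution H1" "real_distribution H2"
  shows "exp_moment s (H1 \<star> H2) = exp_moment s H1 * exp_moment s H2"
proof -
  interpret H1: real_distribution H1 by fact
  interpret H2: real_distribution H2 by fact
  have "exp_moment s (H1 \<star> H2) = (\<integral>\<^sup>+x. \<integral>\<^sup>+y. ennreal (exp (s * (x + y))) \<partial>H2 \<partial>H1)"
    unfolding exp_moment_def
    by (rule nn_integral_convolution) (auto intro: H1.finite_measure_axioms H2.finite_measure_axioms)
  also have "\<dots> = (\<integral>\<^sup>+x. \<integral>\<^sup>+y. ennreal (exp (s * x)) * ennreal (exp (s * y)) \<partial>H2 \<partial>H1)"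
    by (simp add: distrib_left exp_add ennreal_mult)
  also have "\<dots> = exp_moment s H1 * exp_moment s H2"
    by (simp add: exp_moment_def nn_integral_cmult nn_integral_multc)
  finally show ?thesis .
qed

lemma exp_moment_return: "exp_moment s (return borel a) = ennreal (exp (s * a))"
  by (simp add: exp_moment_def nn_integral_return)

lemma exp_moment_compound_poisson:
  assumes P: "real_distribution P" and l: "0 < l" and M: "exp_moment s P = ennreal M" "0 \<le> M"
  shows "exp_moment s (compound_poisson l P) = ennreal (exp (l * (M - 1)))"
proof -
  have Pn: "exp_moment s (conv_power P n) = ennreal (M ^ n)" for n
    by (induction n)
       (auto simp: exp_moment_return exp_moment_convolution P real_distribution_conv_power M ennreal_mult)
  have "exp_moment s (compound_poisson l P) = (\<integral>\<^sup>+n. exp_moment s (conv_power P n) \<partial>measure_pmf (poisson_pmf l))"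
    unfolding exp_moment_def compound_poisson_def
    by (rule nn_integral_bind[OF _ real_distribution_kernel[OF real_distribution_conv_power[OF P]]]) auto
  also have "\<dots> = ennreal (\<integral>n. M ^ n \<partial>measure_pmf (poisson_pmf l))"
    unfolding Pn by (rule nn_integral_eq_integral[OF integrable_poisson_power[OF l]]) (use M in auto)
  also have "(\<integral>n. M ^ n \<partial>measure_pmf (poisson_pmf l)) = exp (l * (M - 1))"
    using integral_poisson_power[OF l, of M] by simp
  finally show ?thesis .
qed

lemma emeasure_nontrivial:
  assumes "emeasure M A \<noteq> 0" "emeasure M A \<noteq> \<infinity>"
  shows "0 < measure M A" "emeasure M A < \<infinity>" "emeasure M A = ennreal (measure M A)"
proof -
  show eq: "emeasure M A = ennreal (measure M A)"
    using assms(2) by (intro emeasure_eq_ennreal_measure) simp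
  have "measure M A \<noteq> 0"
  proof
    assume "measure M A = 0"
    with eq assms(1) show False by simp
  qed
  then show "0 < measure M A" using measure_nonneg[of M A] by linarith
  show "emeasure M A < \<infinity>" by (subst eq) simp
qed

lemma integral_uniform_measure:
  fixes f :: "'a \<Rightarrow> 'b::{banach, second_countable_topology}"
  assumes A: "A \<in> sets M" "emeasure M A \<noteq> 0" "emeasure M A \<noteq> \<infinity>" and [measurable]: "f \<in> borel_measurable M"
  shows "(\<integral>x. f x \<partial>uniform_measure M A) = (1 / measure M A) *\<^sub>R (LINT x:A|M. f x)"
proof -
  have [measurable]: "A \<in> sets M" by fact
  note pos = emeasure_nontrivial(1)[OF A(2,3)] and eq = emeasure_nontrivial(3)[OF A(2,3)]
  have "uniform_measure M A = density M (\<lambda>x. ennreal (indicator A x / measure M A))"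
    unfolding uniform_measure_def eq
  proof (intro density_cong AE_I2)
    show "indicator A x / ennreal (measure M A) = ennreal (indicator A x / measure M A)" for x
      using divide_ennreal[of "indicator A x" "measure M A"] pos by (simp add: ennreal_indicator)
  qed auto
  then have "(\<integral>x. f x \<partial>uniform_measure M A) = (\<integral>x. (indicator A x / measure M A) *\<^sub>R f x \<partial>M)"
    by (simp add: integral_density)
  also have "\<dots> = (\<integral>x. (1 / measure M A) *\<^sub>R (indicator A x *\<^sub>R f x) \<partial>M)"
    by simp
  also have "\<dots> = (1 / measure M A) *\<^sub>R (LINT x:A|M. f x)"
    unfolding set_lebesgue_integral_def by (rule integral_scaleR_right)
  finally show ?thesis .
qed

lemma real_distribution_uniform_measure:
  assumes "sets N = sets borel" "emeasure N A \<noteq> 0" "emeasure N A \<noteq> \<infinity>"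
  shows "real_distribution (uniform_measure N A)"
  using prob_space_uniform_measure[OF assms(2,3)] assms(1) sets_eq_imp_space_eq[OF assms(1)]
  by (simp add: real_distribution_def real_distribution_axioms_def)

lemma set_integrable_bounded:
  fixes f :: "_ \<Rightarrow> _::{banach, second_countable_topology}"
  assumes "A \<in> sets N" "emeasure N A < \<infinity>" "f \<in> borel_measurable N" "\<And>x. x \<in> A \<Longrightarrow> norm (f x) \<le> B"
  shows "set_integrable N A f"
  unfolding set_integrable_def
  by (rule integrableI_bounded_set_indicator[where B=B]) (use assms in auto)

lemma char_compound_poisson_uniform:
  assumes N: "sets N = sets borel" and A: "A \<in> sets borel" "emeasure N A \<noteq> 0" "emeasure N A \<noteq> \<infinity>"
  shows "char (compound_poisson (measure N A) (uniform_measure N A)) z = exp (LINT y:A|N. iexp (z * y) - 1)"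
proof -
  have [measurable_cong]: "sets N = sets borel" by fact
  have A': "A \<in> sets N" using N A by simp
  note l = emeasure_nontrivial(1)[OF A(2,3)] and fin = emeasure_nontrivial(2)[OF A(2,3)]
  have int: "set_integrable N A (\<lambda>y. iexp (z * y))" "set_integrable N A (\<lambda>y. 1 :: complex)"
    by (rule set_integrable_bounded[where B=1, OF A' fin]; simp)+
  have "char (uniform_measure N A) z = (1 / measure N A) *\<^sub>R (LINT y:A|N. iexp (z * y))"
    unfolding char_def by (rule integral_uniform_measure[OF A' A(2,3)]) simp
  moreover have "(LINT y:A|N. iexp (z * y) - 1) = (LINT y:A|N. iexp (z * y)) - (LINT y:A|N. 1)"
    by (rule set_integral_diff(2)[OF int])
  moreover have "(LINT y:A|N. (1::complex)) = of_real (measure N A)"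
    using A' fin by (simp add: set_lebesgue_integral_def scaleR_conv_of_real)
  ultimately have "of_real (measure N A) * (char (uniform_measure N A) z - 1) = (LINT y:A|N. iexp (z * y) - 1)"
    using l by (simp add: scaleR_conv_of_real right_diff_distrib)
  then show ?thesis
    by (simp add: char_compound_poisson[OF real_distribution_uniform_measure[OF N A(2,3)] l])
qed

text \<open>For a set of measure zero the normalised restriction is not a probability measure; the required
  distribution is then the point mass at \<open>0\<close>.\<close>

lemma compound_poisson_of_finite_part:
  assumes N: "sets N = sets borel" and A: "A \<in> sets borel" "emeasure N A < \<infinity>"
  obtains Q where "real_distribution Q" "\<And>z. char Q z = exp (LINT y:A|N. iexp (z * y) - 1)"
    "\<And>s. set_integrable N A (\<lambda>y. exp (s * y)) \<Longrightarrow> exp_moment s Q = ennreal (exp (LINT y:A|N. exp (s * y) - 1))"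
proof (cases "emeasure N A = 0")
  case True
  have A': "A \<in> sets N" using N A by simp
  then have null: "A \<in> null_sets N" using True by auto
  have zero: "(LINT y:A|N. f y) = 0" for f :: "real \<Rightarrow> 'b::{banach, second_countable_topology}"
    unfolding set_lebesgue_integral_def
    by (rule integral_eq_zero_AE) (use AE_not_in[OF null] in \<open>eventually_elim, simp\<close>)
  have ret: "real_distribution (return borel 0)"
    using real_distribution_conv_power[of "return borel 0" 0] prob_space_return[of 0 borel]
    by (simp add: real_distribution_def real_distribution_axioms_def)
  show thesis
    by (rule that[OF ret]) (simp_all add: char_return exp_moment_return zero)
next
  case False
  have [measurable_cong]: "sets N = sets borel" by fact
  have A': "A \<in> sets N" using N A by simp
  have fin: "emeasure N A \<noteq> \<infinity>" using A by simp
  note l = emeasure_nontrivial(1)[OF False fin] and eq = emeasure_nontrivial(3)[OF False fin]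
  let ?P = "uniform_measure N A"
  have P: "real_distribution ?P" by (rule real_distribution_uniform_measure[OF N False fin])
  have mom: "exp_moment s (compound_poisson (measure N A) ?P) = ennreal (exp (LINT y:A|N. exp (s * y) - 1))"
    if int: "set_integrable N A (\<lambda>y. exp (s * y))" for s
  proof -
    let ?I = "LINT y:A|N. exp (s * y)"
    have I0: "0 \<le> ?I" by (auto simp: set_lebesgue_integral_def intro!: integral_nonneg_AE)
    have "exp_moment s ?P = (\<integral>\<^sup>+y. ennreal (exp (s * y)) * indicator A y \<partial>N) / emeasure N A"
      unfolding exp_moment_def by (rule nn_integral_uniform_measure[OF _ A']) simp
    also have "(\<integral>\<^sup>+y. ennreal (exp (s * y)) * indicator A y \<partial>N) = ennreal ?I"
      using nn_integral_eq_integral[OF int[unfolded set_integrable_def]]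
      by (simp add: set_lebesgue_integral_def ennreal_mult ennreal_indicator mult.commute)
    also have "ennreal ?I / emeasure N A = ennreal (?I / measure N A)"
      unfolding eq by (rule divide_ennreal[OF I0 l])
    finally have M: "exp_moment s ?P = ennreal (?I / measure N A)" .
    have "exp_moment s (compound_poisson (measure N A) ?P) = ennreal (exp (measure N A * (?I / measure N A - 1)))"
      by (rule exp_moment_compound_poisson[OF P l M]) (use I0 l in simp)
    also have "measure N A * (?I / measure N A - 1) = ?I - measure N A"
      using l by (simp add: right_diff_distrib)
    also have "\<dots> = ?I - (LINT y:A|N. 1)"
      using A' A(2) by (simp add: set_lebesgue_integral_def)
    also have "\<dots> = (LINT y:A|N. exp (s * y) - 1)"
      by (rule set_integral_diff(2)[symmetric, OF int set_integrable_bounded[where B=1]])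
         (use A' A in auto)
    finally show ?thesis .
  qed
  show thesis
    by (rule that[OF real_distribution_compound_poisson[OF P] char_compound_poisson_uniform[OF N A(1) False fin] mom])
qed

section \<open>Levy measures\<close>

lemma levy_measure_integrable_min:
  assumes "levy_measure \<nu>"
  shows "integrable \<nu> (\<lambda>y. min 1 (y\<^sup>2))"
proof -
  have [measurable_cong]: "sets \<nu> = sets borel" using assms by (simp add: levy_measure_def)
  show ?thesis
    by (rule integrableI_bounded) (use assms in \<open>auto simp: levy_measure_def\<close>)
qed

lemma levy_measure_finite_away_from_0:
  assumes L: "levy_measure \<nu>" and \<epsilon>: "0 < \<epsilon>" "\<epsilon> \<le> 1" and A: "A \<in> sets borel" "\<And>y. y \<in> A \<Longrightarrow> \<epsilon> \<le> \<bar>y\<bar>"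
  shows "emeasure \<nu> A < \<infinity>"
proof -
  have [measurable_cong]: "sets \<nu> = sets borel" using L by (simp add: levy_measure_def)
  have "ennreal (\<epsilon>\<^sup>2) * emeasure \<nu> A = (\<integral>\<^sup>+y. ennreal (\<epsilon>\<^sup>2) * indicator A y \<partial>\<nu>)"
    using A L by (subst nn_integral_cmult_indicator) (auto simp: levy_measure_def)
  also have "\<dots> \<le> (\<integral>\<^sup>+y. ennreal (min 1 (y\<^sup>2)) \<partial>\<nu>)"
  proof (intro nn_integral_mono)
    fix y
    have "\<epsilon>\<^sup>2 \<le> min 1 (y\<^sup>2)" if "y \<in> A"
      using A(2)[OF that] \<epsilon> abs_le_square_iff[of \<epsilon> y] power_le_one[of \<epsilon> 2] by simp
    then show "ennreal (\<epsilon>\<^sup>2) * indicator A y \<le> ennreal (min 1 (y\<^sup>2))"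
      by (auto simp: indicator_def intro!: ennreal_leI simp del: min.bounded_iff)
  qed
  also have "\<dots> < \<infinity>" using L by (simp add: levy_measure_def)
  finally have "ennreal (\<epsilon>\<^sup>2) * emeasure \<nu> A < \<infinity>" .
  then show ?thesis using \<epsilon> by (auto simp: ennreal_mult_less_top)
qed

text \<open>The integrand of the Levy--Khintchine formula.\<close>

definition levy_exponent :: "real \<Rightarrow> real \<Rightarrow> complex" where
  "levy_exponent z y = iexp (z * y) - 1 - \<i> * complex_of_real (z * y * indicator {-1..1} y)"

lemma borel_measurable_levy_exponent [measurable]: "levy_exponent z \<in> borel_measurable borel"
  unfolding levy_exponent_def[abs_def] by measurable

text \<open>The compensating linear term makes the integrand quadratic at \<open>0\<close>, which is the order of
  integrability that a Levy measure provides.\<close>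

lemma norm_levy_exponent_le:
  "norm (levy_exponent z y) \<le> (2 + z\<^sup>2) * min 1 (y\<^sup>2)"
proof (cases "y \<in> {-1..1}")
  case True
  have "norm (levy_exponent z y) \<le> \<bar>z * y\<bar>\<^sup>2 / 2"
    using iexp_approx1[of "z * y" 1] True by (simp add: levy_exponent_def power2_eq_square diff_diff_eq numeral_2_eq_2)
  also have "\<dots> = z\<^sup>2 / 2 * y\<^sup>2" by (simp add: power_mult_distrib)
  also have "\<dots> \<le> (2 + z\<^sup>2) * y\<^sup>2" by (intro mult_right_mono) (auto intro: add_nonneg_nonneg)
  also have "y\<^sup>2 = min 1 (y\<^sup>2)" using True abs_le_square_iff[of y 1] by auto
  finally show ?thesis .
next
  case False
  have "levy_exponent z y = iexp (z * y) - 1"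
    using False by (simp add: levy_exponent_def)
  then have "norm (levy_exponent z y) \<le> norm (iexp (z * y)) + norm (1::complex)"
    by (simp only: norm_triangle_ineq4)
  also have "\<dots> \<le> 2 + z\<^sup>2" by simp
  finally have "norm (levy_exponent z y) \<le> 2 + z\<^sup>2" .
  moreover have "min 1 (y\<^sup>2) = 1" using False abs_le_square_iff[of 1 y] by auto
  ultimately show ?thesis by (simp only: mult_1_right)
qed

lemma levy_measure_set_integrable_exponent:
  assumes L: "levy_measure \<nu>" and A: "A \<in> sets borel"
  shows "set_integrable \<nu> A (levy_exponent z)"
proof -
  have [measurable_cong]: "sets \<nu> = sets borel" using L by (simp add: levy_measure_def)
  have "integrable \<nu> (levy_exponent z)"
    by (rule Bochner_Integration.integrable_bound[OF integrable_mult_right[OF levy_measure_integrable_min[OF L]]])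
       (auto intro!: norm_levy_exponent_le order_trans[OF norm_levy_exponent_le abs_ge_self])
  then have "set_integrable \<nu> UNIV (levy_exponent z)" by (simp add: set_integrable_def)
  then show ?thesis by (rule set_integrable_subset) (use A L in \<open>auto simp: levy_measure_def\<close>)
qed

section \<open>The component with small jumps\<close>

text \<open>By Markov's inequality the moment with parameter \<open>1\<close> controls the right tails uniformly, and the one with
  parameter \<open>-1\<close> the left tails.\<close>

lemma tight_if_exp_moments:
  assumes d: "\<And>n. real_distribution (\<rho> n)" and M: "0 \<le> M" "\<And>n. exp_moment 1 (\<rho> n) \<le> ennreal M"
    "\<And>n. exp_moment (-1) (\<rho> n) \<le> ennreal M"
  shows "tight \<rho>"
  unfolding tight_def
proof (intro conjI allI impI d)
  fix \<epsilon> :: real assume \<epsilon>: "0 < \<epsilon>"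
  have "((\<lambda>k::real. 2 * M * exp (- k)) \<longlongrightarrow> 0) at_top" by real_asymp
  then have "eventually (\<lambda>k. 2 * M * exp (- k) < \<epsilon> \<and> 0 < k) at_top"
    by (intro eventually_conj order_tendstoD eventually_gt_at_top) (use \<epsilon> in auto)
  then obtain k where k: "2 * M * exp (- k) < \<epsilon>" "0 < k" by (auto simp: eventually_at_top_linorder)
  have "1 - \<epsilon> < measure (\<rho> n) {-k<..k}" for n
  proof -
    interpret real_distribution "\<rho> n" by (rule d)
    have "1 = measure (\<rho> n) ({-k<..k} \<union> ({..-k} \<union> {k..}))"
    proof -
      have "{-k<..k} \<union> ({..-k} \<union> {k..}) = space (\<rho> n)" by auto
      then show ?thesis by (simp only: prob_space)
    qed
    also have "\<dots> \<le> measure (\<rho> n) {-k<..k} + (measure (\<rho> n) {..-k} + measure (\<rho> n) {k..})"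
      by (intro order_trans[OF measure_Un_le] add_left_mono measure_Un_le) auto
    also have "measure (\<rho> n) {..-k} \<le> M * exp (- k)"
      by (rule exp_markov[OF d M(3,1)]) auto
    also have "measure (\<rho> n) {k..} \<le> M * exp (- k)"
      by (rule exp_markov[OF d M(2,1)]) auto
    finally show ?thesis using k(1) by simp
  qed
  then show "\<exists>a b. a < b \<and> (\<forall>n. 1 - \<epsilon> < measure (\<rho> n) {a<..b})"
    using k(2) by (intro exI[of _ "-k"] exI[of _ k]) auto
qed

text \<open>The exponential is unbounded, so weak convergence is applied to its truncations at height \<open>k\<close>, followed
  by monotone convergence in \<open>k\<close>.\<close>

lemma exp_moment_weak_limit:
  assumes d: "\<And>n. real_distribution (\<rho> n)" "real_distribution R" and w: "weak_conv_m \<rho> R"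
    and M: "0 \<le> M" "\<And>n. exp_moment s (\<rho> n) \<le> ennreal M"
  shows "exp_moment s R \<le> ennreal M"
proof -
  interpret R: real_distribution R by fact
  define g where "g k x = min (exp (s * x)) (real k)" for k :: nat and x :: real
  have g: "0 \<le> g k x" "norm (g k x) \<le> real k" "isCont (g k) x" for k x
    unfolding g_def by (auto intro!: continuous_intros)
  have [measurable]: "g k \<in> borel_measurable borel" for k unfolding g_def[abs_def] by measurable
  have le: "(\<integral>\<^sup>+x. ennreal (g k x) \<partial>R) \<le> ennreal M" for k
  proof -
    have int: "integrable H (g k)" if "real_distribution H" for H
    proof -
      interpret H: real_distribution H by fact
      show ?thesis by (rule H.integrable_const_bound[where B="real k"]) (use g in auto)
    qed
    have "(\<lambda>n. \<integral>x. g k x \<partial>\<rho> n) \<longlonglongrightarrow> (\<integral>x. g k x \<partial>R)"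
      by (rule weak_conv_imp_integral_bdd_continuous_conv[OF d w g(3,2)])
    moreover have "(\<integral>x. g k x \<partial>\<rho> n) \<le> M" for n
    proof -
      have "ennreal (\<integral>x. g k x \<partial>\<rho> n) = (\<integral>\<^sup>+x. ennreal (g k x) \<partial>\<rho> n)"
        by (rule nn_integral_eq_integral[symmetric, OF int[OF d(1)]]) (use g in auto)
      also have "\<dots> \<le> exp_moment s (\<rho> n)"
        unfolding exp_moment_def by (intro nn_integral_mono ennreal_leI) (simp add: g_def)
      also note M(2)
      finally show ?thesis using M(1) by simp
    qed
    ultimately have "(\<integral>x. g k x \<partial>R) \<le> M" by (intro LIMSEQ_le_const2) auto
    moreover have "(\<integral>\<^sup>+x. ennreal (g k x) \<partial>R) = ennreal (\<integral>x. g k x \<partial>R)"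
      by (rule nn_integral_eq_integral[OF int[OF d(2)]]) (use g in auto)
    ultimately show ?thesis by (simp add: ennreal_leI)
  qed
  have sup: "(SUP k. ennreal (g k x)) = ennreal (exp (s * x))" for x
  proof (rule antisym)
    show "(SUP k. ennreal (g k x)) \<le> ennreal (exp (s * x))"
      by (intro SUP_least ennreal_leI) (simp add: g_def)
    obtain k where "exp (s * x) \<le> real k" using real_arch_simple by blast
    then have "g k x = exp (s * x)" by (simp add: g_def)
    then show "ennreal (exp (s * x)) \<le> (SUP k. ennreal (g k x))"
      by (metis SUP_upper UNIV_I)
  qed
  have "exp_moment s R = (\<integral>\<^sup>+x. (SUP k. ennreal (g k x)) \<partial>R)"
    by (simp add: exp_moment_def sup)
  also have "\<dots> = (SUP k. \<integral>\<^sup>+x. ennreal (g k x) \<partial>R)"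
    by (rule nn_integral_monotone_convergence_SUP)
       (auto simp: incseq_def le_fun_def g_def intro!: ennreal_leI min.mono)
  also have "\<dots> \<le> ennreal M" by (intro SUP_least le)
  finally show ?thesis .
qed

lemma exp_minus_one_minus_le_square:
  fixes u :: real
  assumes "\<bar>u\<bar> \<le> 1"
  shows "exp u - 1 - u \<le> u\<^sup>2"
proof (cases "0 \<le> u")
  case True
  then show ?thesis using exp_bound[of u] assms by simp
next
  case False
  define v where "v = - u"
  have v: "0 \<le> v" "v \<le> 1" using False assms by (auto simp: v_def)
  have "1 \<le> (1 - v + v\<^sup>2) * (1 + v)" using v by (simp add: algebra_simps power2_eq_square)
  also have "\<dots> \<le> (1 - v + v\<^sup>2) * exp v"
    using v exp_ge_add_one_self[of v] by (intro mult_left_mono) (auto simp: add_nonneg_nonneg)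
  finally have "exp (- v) * 1 \<le> exp (- v) * ((1 - v + v\<^sup>2) * exp v)" by (intro mult_left_mono) auto
  also have "\<dots> = 1 - v + v\<^sup>2" by (simp add: mult_exp_exp mult.left_commute)
  finally show ?thesis by (simp add: v_def)
qed

text \<open>The existence part of the Levy--Khintchine theorem for jumps of size at most \<open>1\<close>. Jumps
  below \<open>1 / (n + 1)\<close> are dropped and the remaining compound Poisson law is centred. Because
  \<open>exp(u) - 1 - u \<le> u\<^sup>2\<close> for \<open>\<bar>u\<bar> \<le> 1\<close>, both exponential moments with parameter \<open>\<plusminus>1\<close> are at most
  \<open>exp(\<integral>y\<^sup>2 d\<nu>)\<close> over \<open>[-1, 1]\<close>, uniformly in \<open>n\<close>. By Helly's theorem a subsequence converges weakly, and the
  limit has the desired characteristic function and inherits the bound on the moments.\<close>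

lemma small_jumps_distribution:
  assumes L: "levy_measure \<nu>"
  obtains R where "real_distribution R" "\<And>z. char R z = exp (LINT y:{-1..1}|\<nu>. levy_exponent z y)"
    "exp_moment 1 R < \<infinity>"
proof -
  have [measurable_cong]: "sets \<nu> = sets borel" and N: "sets \<nu> = sets borel" and at0: "emeasure \<nu> {0} = 0"
    using L by (simp_all add: levy_measure_def)
  define S where "S n = {y::real. \<bar>y\<bar> \<le> 1 \<and> 1 / real (Suc n) \<le> \<bar>y\<bar>}" for n
  have [measurable]: "S n \<in> sets borel" for n unfolding S_def by measurable
  have S': "S n \<in> sets \<nu>" for n using N by simp
  have fin: "emeasure \<nu> (S n) < \<infinity>" for n
    by (rule levy_measure_finite_away_from_0[OF L, of "1 / real (Suc n)"]) (auto simp: S_def)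
  have intb: "set_integrable \<nu> (S n) f" if "f \<in> borel_measurable borel" "\<And>y. \<bar>y\<bar> \<le> 1 \<Longrightarrow> norm (f y) \<le> B"
    for n B and f :: "real \<Rightarrow> 'b::{banach, second_countable_topology}"
    by (rule set_integrable_bounded[where B=B, OF S' fin]) (use that in \<open>auto simp: S_def\<close>)
  define m where "m n = (LINT y:S n|\<nu>. y)" for n
  have "\<exists>Q. real_distribution Q \<and> (\<forall>z. char Q z = exp (LINT y:S n|\<nu>. iexp (z * y) - 1)) \<and>
      (\<forall>s. set_integrable \<nu> (S n) (\<lambda>y. exp (s * y)) \<longrightarrow> exp_moment s Q = ennreal (exp (LINT y:S n|\<nu>. exp (s * y) - 1)))" for n
    by (rule compound_poisson_of_finite_part[OF N _ fin, of n]) (auto simp: S_def[symmetric])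
  then obtain Q where Q: "\<And>n. real_distribution (Q n)"
    "\<And>n z. char (Q n) z = exp (LINT y:S n|\<nu>. iexp (z * y) - 1)"
    "\<And>n s. set_integrable \<nu> (S n) (\<lambda>y. exp (s * y)) \<Longrightarrow> exp_moment s (Q n) = ennreal (exp (LINT y:S n|\<nu>. exp (s * y) - 1))"
    by metis
  have ret: "real_distribution (return borel a)" for a
    using prob_space_return[of a borel] by (simp add: real_distribution_def real_distribution_axioms_def)
  \<comment> \<open>centring: without it the drifts \<open>m n\<close> may diverge\<close>
  define \<rho> where "\<rho> n = (Q n \<star> return borel (- m n))" for n
  have \<rho>: "real_distribution (\<rho> n)" for n
    unfolding \<rho>_def by (intro real_distribution_convolution Q ret)
  have char: "char (\<rho> n) z = exp (LINT y:S n|\<nu>. levy_exponent z y)" for n z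
  proof -
    have int1: "set_integrable \<nu> (S n) (\<lambda>y. iexp (z * y) - 1)"
      by (rule intb[of _ 2]) (auto intro!: order_trans[OF norm_triangle_ineq4])
    have int2: "set_integrable \<nu> (S n) (\<lambda>y. \<i> * complex_of_real (z * y))"
      by (rule intb[of _ "\<bar>z\<bar>"]) (auto simp: norm_mult abs_mult intro!: mult_left_le)
    have "(LINT y:S n|\<nu>. \<i> * complex_of_real (z * y)) = \<i> * complex_of_real (z * m n)"
    proof -
      have "(LINT y:S n|\<nu>. \<i> * complex_of_real (z * y)) =
          (\<integral>y. (\<i> * complex_of_real z) * complex_of_real (indicator (S n) y *\<^sub>R y) \<partial>\<nu>)"
        unfolding set_lebesgue_integral_def
        by (intro Bochner_Integration.integral_cong) (auto simp: indicator_def)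
      also have "\<dots> = (\<i> * complex_of_real z) * (\<integral>y. complex_of_real (indicator (S n) y *\<^sub>R y) \<partial>\<nu>)"
        by (rule integral_mult_right_zero)
      also have "(\<integral>y. complex_of_real (indicator (S n) y *\<^sub>R y) \<partial>\<nu>) = complex_of_real (m n)"
        unfolding m_def set_lebesgue_integral_def by (rule integral_complex_of_real)
      finally show ?thesis by simp
    qed
    moreover have "(LINT y:S n|\<nu>. levy_exponent z y) = (LINT y:S n|\<nu>. (iexp (z * y) - 1) - \<i> * complex_of_real (z * y))"
      by (rule set_lebesgue_integral_cong) (auto simp: S_def N levy_exponent_def indicator_def abs_le_iff)
    ultimately have "(LINT y:S n|\<nu>. levy_exponent z y) = (LINT y:S n|\<nu>. iexp (z * y) - 1) + \<i> * complex_of_real (z * (- m n))"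
      using set_integral_diff(2)[OF int1 int2] by simp
    then show ?thesis
      unfolding \<rho>_def char_convolution[OF Q(1) ret] Q(2) char_return by (simp only: exp_add)
  qed
  define M where "M = exp (LINT y:{-1..1}|\<nu>. y\<^sup>2)"
  have intsq: "set_integrable \<nu> {-1..1} (\<lambda>y. y\<^sup>2)"
  proof -
    have "set_integrable \<nu> {-1..1} (\<lambda>y. min 1 (y\<^sup>2))"
      using integrable_mult_indicator[OF _ levy_measure_integrable_min[OF L], of "{-1..1}"]
      by (simp add: set_integrable_def N)
    moreover have "y\<^sup>2 = min 1 (y\<^sup>2)" if "y \<in> {-1..1}" for y :: real
      using that abs_le_square_iff[of y 1] by auto
    ultimately show ?thesis
      by (subst set_integrable_cong[OF refl refl]) auto
  qed
  have mom: "exp_moment s (\<rho> n) \<le> ennreal M" if s: "\<bar>s\<bar> = 1" for s n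
  proof -
    have int0: "set_integrable \<nu> (S n) (\<lambda>y. exp (s * y))"
    proof (rule intb[of _ "exp 1"])
      fix y :: real assume "\<bar>y\<bar> \<le> 1"
      then have "s * y \<le> 1" using s abs_mult[of s y] by simp
      then show "norm (exp (s * y)) \<le> exp 1" by simp
    qed simp
    have int1: "set_integrable \<nu> (S n) (\<lambda>y. exp (s * y) - 1)"
      by (intro set_integral_diff int0 intb[of _ 1]) auto
    have int2: "set_integrable \<nu> (S n) (\<lambda>y. s * y)"
      by (rule intb[of _ 1]) (use s in \<open>auto simp: abs_mult\<close>)
    have int3: "set_integrable \<nu> (S n) (\<lambda>y. y\<^sup>2)"
      by (rule set_integrable_subset[OF intsq]) (auto simp: N S_def)
    have "exp_moment s (\<rho> n) = ennreal (exp (LINT y:S n|\<nu>. exp (s * y) - 1)) * ennreal (exp (s * (- m n)))"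
      unfolding \<rho>_def exp_moment_convolution[OF Q(1) ret] exp_moment_return Q(3)[OF int0] ..
    also have "\<dots> = ennreal (exp ((LINT y:S n|\<nu>. exp (s * y) - 1) + s * (- m n)))"
      by (simp only: exp_add ennreal_mult exp_ge_zero)
    also have "(LINT y:S n|\<nu>. exp (s * y) - 1) + s * (- m n) = (LINT y:S n|\<nu>. exp (s * y) - 1 - s * y)"
      using set_integral_diff(2)[OF int1 int2] by (simp add: m_def)
    also have "ennreal (exp \<dots>) \<le> ennreal M"
      unfolding M_def
    proof (intro ennreal_leI exp_le_cancel_iff[THEN iffD2])
      have "(LINT y:S n|\<nu>. exp (s * y) - 1 - s * y) \<le> (LINT y:S n|\<nu>. y\<^sup>2)"
      proof (rule set_integral_mono[OF set_integral_diff(1)[OF int1 int2] int3])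
        fix y assume "y \<in> S n"
        then have "\<bar>s * y\<bar> \<le> 1" using s by (simp add: S_def abs_mult)
        from exp_minus_one_minus_le_square[OF this] show "exp (s * y) - 1 - s * y \<le> y\<^sup>2"
          using s by (simp add: power_mult_distrib power2_abs[of s, symmetric] del: power2_abs)
      qed
      also have "\<dots> \<le> (LINT y:{-1..1}|\<nu>. y\<^sup>2)"
        using intsq int3 unfolding set_lebesgue_integral_def set_integrable_def
        by (intro integral_mono) (auto simp: indicator_def S_def)
      finally show "(LINT y:S n|\<nu>. exp (s * y) - 1 - s * y) \<le> (LINT y:{-1..1}|\<nu>. y\<^sup>2)" .
    qed
    finally show ?thesis .
  qed
  have M0: "0 \<le> M" by (simp add: M_def)
  have "tight \<rho>" by (rule tight_if_exp_moments[OF \<rho> M0]) (use mom in auto)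
  from tight_imp_convergent_subsubsequence[OF this strict_mono_id]
  obtain r R where r: "strict_mono r" and R: "real_distribution R" and w: "weak_conv_m (\<rho> \<circ> id \<circ> r) R"
    by blast
  have charR: "char R z = exp (LINT y:{-1..1}|\<nu>. levy_exponent z y)" for z
  proof (rule LIMSEQ_unique)
    show "(\<lambda>n. char ((\<rho> \<circ> id \<circ> r) n) z) \<longlonglongrightarrow> char R z"
      by (rule levy_continuity1[OF _ R w]) (simp add: \<rho>)
    have "(\<lambda>n. LINT y:S n|\<nu>. levy_exponent z y) \<longlonglongrightarrow> (LINT y:{-1..1}|\<nu>. levy_exponent z y)"
      unfolding set_lebesgue_integral_def
    proof (rule integral_dominated_convergence[where w="\<lambda>y. norm (indicator {-1..1} y *\<^sub>R levy_exponent z y)"])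
      show "integrable \<nu> (\<lambda>y. norm (indicator {-1..1} y *\<^sub>R levy_exponent z y))"
        using levy_measure_set_integrable_exponent[OF L, of "{-1..1}" z]
        unfolding set_integrable_def by (intro integrable_norm) simp
      show "AE y in \<nu>. (\<lambda>n. indicator (S n) y *\<^sub>R levy_exponent z y) \<longlonglongrightarrow> indicator {-1..1} y *\<^sub>R levy_exponent z y"
      proof (rule AE_I2)
        fix y
        have "eventually (\<lambda>n. indicator (S n) y *\<^sub>R levy_exponent z y = indicator {-1..1} y *\<^sub>R levy_exponent z y) sequentially"
        proof (cases "y = 0")
          case False
          then obtain k where k: "1 / real (Suc k) < \<bar>y\<bar>" using nat_approx_posE[of "\<bar>y\<bar>"] by auto
          show ?thesis
            using eventually_ge_at_top[of k]
          proof eventually_elim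
            case (elim n)
            have "1 / real (Suc n) \<le> 1 / real (Suc k)" using elim by (intro divide_left_mono) auto
            then show ?case using k by (auto simp: S_def indicator_def)
          qed
        qed (simp add: levy_exponent_def)
        then show "(\<lambda>n. indicator (S n) y *\<^sub>R levy_exponent z y) \<longlonglongrightarrow> indicator {-1..1} y *\<^sub>R levy_exponent z y"
          by (rule tendsto_eventually)
      qed
      show "AE y in \<nu>. norm (indicator (S n) y *\<^sub>R levy_exponent z y) \<le> norm (indicator {-1..1} y *\<^sub>R levy_exponent z y)" for n
        by (intro AE_I2) (auto simp: indicator_def S_def)
    qed (measurable)
    then have "(\<lambda>n. char (\<rho> n) z) \<longlonglongrightarrow> exp (LINT y:{-1..1}|\<nu>. levy_exponent z y)"
      unfolding char by (intro tendsto_intros)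
    from LIMSEQ_subseq_LIMSEQ[OF this r]
    show "(\<lambda>n. char ((\<rho> \<circ> id \<circ> r) n) z) \<longlonglongrightarrow> exp (LINT y:{-1..1}|\<nu>. levy_exponent z y)"
      by (simp add: comp_def)
  qed
  have "exp_moment 1 R \<le> ennreal M"
    by (rule exp_moment_weak_limit[OF _ R w M0]) (simp_all add: \<rho> mom)
  then have "exp_moment 1 R < \<infinity>" by (simp add: order_le_less_trans)
  with R charR show thesis by (rule that)
qed

section \<open>Decomposition of the infinitely divisible distribution\<close>

text \<open>The affine image of the standard normal distribution also covers \<open>b = 0\<close>, where there is no
  density.\<close>

lemma normal_distribution:
  obtains N where "real_distribution N" "\<And>z. char N z = exp (\<i> * complex_of_real (a * z) - complex_of_real (b\<^sup>2 * z\<^sup>2 / 2))"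
    "exp_moment 1 N < \<infinity>"
proof -
  let ?G = "std_normal_distribution"
  interpret G: real_distribution ?G by (rule real_dist_normal_dist)
  define N where "N = distr ?G borel (\<lambda>x. a + b * x)"
  have "real_distribution N"
    unfolding N_def by (rule G.real_distribution_distr) simp
  moreover have "char N z = exp (\<i> * complex_of_real (a * z) - complex_of_real (b\<^sup>2 * z\<^sup>2 / 2))" for z
  proof -
    have "char N z = (\<integral>x. iexp (z * (a + b * x)) \<partial>?G)"
      unfolding char_def N_def by (subst integral_distr) auto
    also have "\<dots> = (\<integral>x. iexp (a * z) * iexp ((z * b) * x) \<partial>?G)"
      by (intro Bochner_Integration.integral_cong) (auto simp: exp_add[symmetric] algebra_simps)
    also have "\<dots> = iexp (a * z) * char ?G (z * b)" by (simp add: char_def)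
    also have "\<dots> = exp (\<i> * complex_of_real (a * z)) * exp (- complex_of_real (b\<^sup>2 * z\<^sup>2 / 2))"
      by (simp add: char_std_normal_distribution exp_of_real[symmetric] power_mult_distrib mult.commute)
    also have "\<dots> = exp (\<i> * complex_of_real (a * z) - complex_of_real (b\<^sup>2 * z\<^sup>2 / 2))"
      by (simp add: exp_add[symmetric])
    finally show ?thesis .
  qed
  moreover have "exp_moment 1 N < \<infinity>"
  proof -
    have "exp_moment 1 N = (\<integral>\<^sup>+x. ennreal (exp (a + b * x)) \<partial>?G)"
      unfolding exp_moment_def N_def by (subst nn_integral_distr) auto
    also have "\<dots> = (\<integral>\<^sup>+x. ennreal (std_normal_density x) * ennreal (exp (a + b * x)) \<partial>lborel)"
      by (subst nn_integral_density) auto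
    also have "\<dots> = (\<integral>\<^sup>+x. ennreal (exp (a + b\<^sup>2 / 2)) * ennreal (normal_density b 1 x) \<partial>lborel)"
    proof (intro nn_integral_cong)
      fix x
      \<comment> \<open>completing the square: an exponential tilt shifts the mean by \<open>b\<close>\<close>
      have e: "- x\<^sup>2 / 2 + (a + b * x) = (a + b\<^sup>2 / 2) + - (x - b)\<^sup>2 / 2"
        by (simp add: power2_eq_square field_simps)
      have "std_normal_density x * exp (a + b * x) = 1 / sqrt (2 * pi) * exp (- x\<^sup>2 / 2 + (a + b * x))"
        by (simp only: std_normal_density_def exp_add mult.assoc)
      also have "\<dots> = exp (a + b\<^sup>2 / 2) * normal_density b 1 x"
        unfolding e exp_add[of "a + b\<^sup>2 / 2"] by (simp add: normal_density_def)
      finally show "ennreal (std_normal_density x) * ennreal (exp (a + b * x)) =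
          ennreal (exp (a + b\<^sup>2 / 2)) * ennreal (normal_density b 1 x)"
        by (simp add: ennreal_mult[symmetric])
    qed
    also have "\<dots> = ennreal (exp (a + b\<^sup>2 / 2)) * (\<integral>\<^sup>+x. ennreal (normal_density b 1 x) \<partial>lborel)"
      by (intro nn_integral_cmult) auto
    also have "(\<integral>\<^sup>+x. ennreal (normal_density b 1 x) \<partial>lborel) = ennreal 1"
      using nn_integral_eq_integral[OF integrable_normal_density[of 1 b]] integral_normal_density[of 1 b] by simp
    finally show ?thesis by (simp add: order_le_less_trans)
  qed
  ultimately show thesis by (rule that)
qed

text \<open>The jumps larger than \<open>1\<close> form the compound Poisson part. The remaining factor \<open>R\<close> collects the
  jumps below \<open>-1\<close> (compound Poisson on the negative half-line, so its exponential moment is at most \<open>1\<close>),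
  the compensated jumps in \<open>[-1, 1]\<close>, and the Gaussian part with drift. Both sides have the same
  characteristic function.\<close>

lemma levy_decomposition:
  assumes \<mu>: "real_distribution \<mu>" and T: "has_levy_triplet \<mu> a b \<nu>" and pos: "0 < emeasure \<nu> {1<..}"
  obtains R where "\<mu> = (compound_poisson (measure \<nu> {1<..}) (levy_tail \<nu>) \<star> R)" "real_distribution R"
    "exp_moment 1 R < \<infinity>"
proof -
  have L: "levy_measure \<nu>" using T by (simp add: has_levy_triplet_def)
  have N: "sets \<nu> = sets borel" using L by (simp add: levy_measure_def)
  have [measurable_cong]: "sets \<nu> = sets borel" by (fact N)
  have fin1: "emeasure \<nu> {1<..} < \<infinity>" and fin2: "emeasure \<nu> {..<-1} < \<infinity>"
    by (rule levy_measure_finite_away_from_0[OF L, of 1]; auto)+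
  obtain S where S: "real_distribution S" "\<And>z. char S z = exp (LINT y:{-1..1}|\<nu>. levy_exponent z y)"
    "exp_moment 1 S < \<infinity>"
    using small_jumps_distribution[OF L] by blast
  obtain G where G: "real_distribution G" "\<And>z. char G z = exp (\<i> * complex_of_real (a * z) - complex_of_real (b\<^sup>2 * z\<^sup>2 / 2))"
    "exp_moment 1 G < \<infinity>"
    using normal_distribution by blast
  obtain Q where Q: "real_distribution Q" "\<And>z. char Q z = exp (LINT y:{..<-1}|\<nu>. iexp (z * y) - 1)"
    "\<And>s. set_integrable \<nu> {..<-1} (\<lambda>y. exp (s * y)) \<Longrightarrow> exp_moment s Q = ennreal (exp (LINT y:{..<-1}|\<nu>. exp (s * y) - 1))"
    by (rule compound_poisson_of_finite_part[OF N _ fin2]) auto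
  have Qm: "exp_moment 1 Q < \<infinity>"
    by (subst Q(3)) (auto intro!: set_integrable_bounded[where B=1, OF _ fin2] simp: N)
  define R where "R = (Q \<star> (S \<star> G))"
  have SG: "real_distribution (S \<star> G)" by (intro real_distribution_convolution S G)
  have R: "real_distribution R" unfolding R_def by (intro real_distribution_convolution Q SG)
  have fin: "exp_moment 1 R < \<infinity>"
    unfolding R_def exp_moment_convolution[OF Q(1) SG] exp_moment_convolution[OF S(1) G(1)]
    using S(3) G(3) Qm by (simp add: ennreal_mult_less_top)
  let ?C = "compound_poisson (measure \<nu> {1<..}) (levy_tail \<nu>)"
  have P: "real_distribution (levy_tail \<nu>)"
    unfolding levy_tail_def by (rule real_distribution_uniform_measure[OF N]) (use pos fin1 in auto)
  have C: "real_distribution ?C" by (rule real_distribution_compound_poisson[OF P])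
  have charC: "char ?C z = exp (LINT y:{1<..}|\<nu>. iexp (z * y) - 1)" for z
    unfolding levy_tail_def by (rule char_compound_poisson_uniform[OF N]) (use pos fin1 in auto)
  have split: "(LINT y|\<nu>. levy_exponent z y) = (LINT y:{1<..}|\<nu>. iexp (z * y) - 1) +
      ((LINT y:{..<-1}|\<nu>. iexp (z * y) - 1) + (LINT y:{-1..1}|\<nu>. levy_exponent z y))" for z
  proof -
    note int = levy_measure_set_integrable_exponent[OF L, of _ z]
    have "(LINT y|\<nu>. levy_exponent z y) = (LINT y:{1<..} \<union> ({..<-1} \<union> {-1..1})|\<nu>. levy_exponent z y)"
    proof -
      have "{1<..} \<union> ({..<-1} \<union> {-1..1}) = (UNIV :: real set)" by auto
      then show ?thesis by (simp add: set_lebesgue_integral_def)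
    qed
    also have "\<dots> = (LINT y:{1<..}|\<nu>. levy_exponent z y) + (LINT y:{..<-1} \<union> {-1..1}|\<nu>. levy_exponent z y)"
      by (rule set_integral_Un) (auto intro!: int)
    also have "(LINT y:{..<-1} \<union> {-1..1}|\<nu>. levy_exponent z y) =
        (LINT y:{..<-1}|\<nu>. levy_exponent z y) + (LINT y:{-1..1}|\<nu>. levy_exponent z y)"
      by (rule set_integral_Un) (auto intro!: int)
    also have "(LINT y:{1<..}|\<nu>. levy_exponent z y) = (LINT y:{1<..}|\<nu>. iexp (z * y) - 1)"
      by (rule set_lebesgue_integral_cong) (auto simp: N levy_exponent_def)
    also have "(LINT y:{..<-1}|\<nu>. levy_exponent z y) = (LINT y:{..<-1}|\<nu>. iexp (z * y) - 1)"
      by (rule set_lebesgue_integral_cong) (auto simp: N levy_exponent_def)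
    finally show ?thesis .
  qed
  have "char \<mu> = char (?C \<star> R)"
  proof
    fix z
    have "char \<mu> z = exp ((LINT y|\<nu>. levy_exponent z y) + \<i> * complex_of_real (a * z) - complex_of_real (b\<^sup>2 * z\<^sup>2 / 2))"
      using T unfolding has_levy_triplet_def levy_exponent_def by blast
    also have "\<dots> = exp ((LINT y:{1<..}|\<nu>. iexp (z * y) - 1) + ((LINT y:{..<-1}|\<nu>. iexp (z * y) - 1)
        + ((LINT y:{-1..1}|\<nu>. levy_exponent z y) + (\<i> * complex_of_real (a * z) - complex_of_real (b\<^sup>2 * z\<^sup>2 / 2)))))"
      unfolding split by (rule arg_cong[where f=exp]) (simp only: add.assoc add_diff_eq)
    also have "\<dots> = char (?C \<star> R) z"
      unfolding R_def char_convolution[OF C R[unfolded R_def]] char_convolution[OF Q(1) SG]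
        char_convolution[OF S(1) G(1)] charC Q(2) S(2) G(2) exp_add ..
    finally show "char \<mu> z = char (?C \<star> R) z" .
  qed
  then have "\<mu> = (?C \<star> R)"
    by (rule Levy_uniqueness[OF \<mu> real_distribution_convolution[OF C R]])
  with R fin show thesis using that by blast
qed

text \<open>For \<open>x \<ge> 1\<close> the masses \<open>\<nu>(x + \<Delta>)\<close> and \<open>\<lambda> F(x + \<Delta>)\<close> coincide, which identifies condition (iii) with the
  asymptotic relation for the compound Poisson representation.\<close>

theorem theorem4p6:
  fixes c a b :: real and \<mu> \<nu> :: "real measure"
  assumes "0 < c"
    and "infinitely_divisible \<mu>"
    and "has_levy_triplet \<mu> a b \<nu>"
    and "0 < emeasure \<nu> {1<..}"
    and "levy_tail \<nu> \<in> L_Delta c"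
  shows "(\<mu> \<in> S_Delta c \<inter> D_Delta c \<longleftrightarrow> levy_tail \<nu> \<in> S_Delta c \<inter> D_Delta c)
    \<and> (levy_tail \<nu> \<in> S_Delta c \<inter> D_Delta c \<longleftrightarrow>
        levy_tail \<nu> \<in> L_Delta c \<inter> D_Delta c \<and> delta_mass c \<mu> \<sim>[at_top] delta_mass c \<nu>)"
proof -
  let ?l = "measure \<nu> {1<..}"
  have \<mu>: "real_distribution \<mu>" using assms(2) by (simp add: infinitely_divisible_def)
  have L: "levy_measure \<nu>" using assms(3) by (simp add: has_levy_triplet_def)
  have N: "sets \<nu> = sets borel" using L by (simp add: levy_measure_def)
  have fin: "emeasure \<nu> {1<..} < \<infinity>"
    by (rule levy_measure_finite_away_from_0[OF L, of 1]) auto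
  have l: "0 < ?l"
    by (rule emeasure_nontrivial(1)) (use assms(4) fin in auto)
  obtain R where R: "\<mu> = (compound_poisson ?l (levy_tail \<nu>) \<star> R)" "real_distribution R"
    "exp_moment 1 R < \<infinity>"
    using levy_decomposition[OF \<mu> assms(3,4)] by blast
  have "eventually (\<lambda>x. ?l * delta_mass c (levy_tail \<nu>) x = delta_mass c \<nu> x) at_top"
    using eventually_ge_at_top[of 1]
  proof eventually_elim
    case (elim x)
    have "{1<..} \<inter> {x<..x + c} = {x<..x + c}" using elim by auto
    then show ?case
      using l assms(4) fin unfolding delta_mass_def levy_tail_def
      by (subst measure_uniform_measure) (auto simp: N)
  qed
  then have "delta_mass c \<mu> \<sim>[at_top] (\<lambda>x. ?l * delta_mass c (levy_tail \<nu>) x) \<longleftrightarrow> delta_mass c \<mu> \<sim>[at_top] delta_mass c \<nu>"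
    by (intro asymp_equiv_cong) auto
  then show ?thesis
    using compound_poisson_local_subexponentiality[OF assms(1,5) l R(2,3)] unfolding R(1)[symmetric] by simp
qed

end
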